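(* Let $p$ be a prime and let $K$ be a finite extension of $\mathbb{Q}_p$ (inside a fixed algebraic closure $\overline{\mathbb{Q}_p}$) with residue field $\mathbb{F}_q$. Then there is a function $\varepsilon_K:\mathbb{Z}_{\geq 1}\to\mathbb{R}$ with $\varepsilon_K(d)\to 0$ as $d\to\infty$ such that for every non-zero $\alpha\in\overline{\mathbb{Q}}$ of degree $d=[\mathbb{Q}(\alpha):\mathbb{Q}]$, $$h(\alpha)\ \geq\ \frac{1}{2\,[K:\mathbb{Q}_p]}\left(\frac{|\mathcal{S}_K(\alpha)|}{d}\right)^2\frac{\log q}{q+1}\ +\ \varepsilon_K(d).$$ (In the paper's notation: $h(\alpha) \geq \frac{1}{2[K:\mathbb{Q}_p]}\left(\frac{|\mathcal{S}_K(\alpha)|}{d}\right)^2\frac{\log q}{q+1} + o_d(1)$, where $o_d(1)\to 0$ as $d\to\infty$.)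
   Context: $\overline{\mathbb{Q}}$ is the algebraic closure of $\mathbb{Q}$ in $\mathbb{C}$, and for each prime $p$ an embedding $i_p:\overline{\mathbb{Q}}\hookrightarrow\overline{\mathbb{Q}_p}$ is fixed. For non-zero $\alpha\in\overline{\mathbb{Q}}$ of degree $d$ with minimal polynomial $a_d x^d+\dots+a_0\in\mathbb{Z}[x]$ (primitive, $a_d>0$) and Galois conjugates $\alpha_1,\dots,\alpha_d\in\overline{\mathbb{Q}}$, the Mahler measure is $M(\alpha)=|a_d|\prod_i\max(1,|\alpha_i|)$ and the absolute logarithmic Weil height is $h(\alpha)=\frac{\log M(\alpha)}{d}$. For a finite extension $K$ of $\mathbb{Q}_p$, $\mathcal{S}_K(\alpha)=\{\alpha_i : i_p(\alpha_i)\in K,\ 1\le i\le d\}$ is the set of conjugates of $\alpha$ lying in $K$. *)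

theory Defs
  imports
    "HOL-Analysis.Analysis"
    "HOL-Algebra.Algebraic_Closure_Type"
    "Berlekamp_Zassenhaus.Finite_Field"
begin

hide_const (open) Divisibility.prime

section \<open>The \<open>p\<close>-adic absolute value on the rationals\<close>

definition padic_abs :: "nat \<Rightarrow> rat \<Rightarrow> real" where
  "padic_abs p x = (if x = 0 then 0 else
     (case quotient_of x of (a, b) \<Rightarrow>
        real p powi (int (multiplicity (int p) b) - int (multiplicity (int p) a))))"

lemma padic_abs_0 [simp]: "padic_abs p 0 = 0"
  by (simp add: padic_abs_def)

context
  fixes p :: nat
  assumes p: "prime p"
begin

lemma prime_int_p: "prime (int p)"
  using p by simp

lemma real_p_gt_1: "real p > 1"
  using prime_gt_1_nat[OF p] by simp

lemma padic_abs_divide: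
  assumes "a \<noteq> 0" "b \<noteq> 0"
  shows "padic_abs p (of_int a / of_int b) =
           real p powi (int (multiplicity (int p) b) - int (multiplicity (int p) a))"
proof -
  obtain c d where cd: "quotient_of (of_int a / of_int b) = (c, d)"
    by (cases "quotient_of (of_int a / of_int b)")
  from quotient_of_denom_pos[OF cd] have d: "d > 0" .
  from quotient_of_div[OF cd] have eq: "of_int a / of_int b = (of_int c / of_int d :: rat)" .
  have c: "c \<noteq> 0"
    using eq assms d by auto
  have "(of_int (a * d) :: rat) = of_int (c * b)"
    using eq assms d by (simp add: field_simps)
  hence "a * d = c * b"
    by (simp only: of_int_eq_iff)
  hence "multiplicity (int p) (a * d) = multiplicity (int p) (c * b)"
    by simp
  hence "multiplicity (int p) a + multiplicity (int p) d =
         multiplicity (int p) c + multiplicity (int p) b"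
    using assms c d prime_int_p by (simp add: prime_elem_multiplicity_mult_distrib)
  hence "int (multiplicity (int p) b) - int (multiplicity (int p) a) =
         int (multiplicity (int p) d) - int (multiplicity (int p) c)"
    by linarith
  thus ?thesis
    using assms cd by (simp add: padic_abs_def)
qed

lemma rat_cases_int:
  fixes x :: rat
  obtains a b where "x = of_int a / of_int b" "b > 0"
  by (metis quotient_of_denom_pos quotient_of_div surj_pair)

lemma padic_abs_of_int:
  "a \<noteq> 0 \<Longrightarrow> padic_abs p (of_int a) = real p powi (- int (multiplicity (int p) a))"
  using padic_abs_divide[of a 1] by simp

lemma padic_abs_1 [simp]: "padic_abs p 1 = 1"
  using padic_abs_of_int[of 1] by simp

lemma padic_abs_pos: "x \<noteq> 0 \<Longrightarrow> padic_abs p x > 0"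
  using real_p_gt_1 by (auto simp: padic_abs_def split: prod.splits)

lemma padic_abs_nonneg [simp]: "padic_abs p x \<ge> 0"
  using padic_abs_pos[of x] by (cases "x = 0") auto

lemma padic_abs_eq_0_iff [simp]: "padic_abs p x = 0 \<longleftrightarrow> x = 0"
  using padic_abs_pos[of x] by (cases "x = 0") auto

lemma padic_abs_mult: "padic_abs p (x * y) = padic_abs p x * padic_abs p y"
proof (cases "x = 0 \<or> y = 0")
  case False
  obtain a b where x: "x = of_int a / of_int b" "b > 0" by (rule rat_cases_int)
  obtain c d where y: "y = of_int c / of_int d" "d > 0" by (rule rat_cases_int)
  have nz: "a \<noteq> 0" "b \<noteq> 0" "c \<noteq> 0" "d \<noteq> 0"
    using False x y by auto
  have xy: "x * y = of_int (a * c) / of_int (b * d)"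
    using x y by simp
  show ?thesis
    using nz prime_int_p real_p_gt_1 unfolding xy unfolding x y
    by (simp add: padic_abs_divide prime_elem_multiplicity_mult_distrib
          flip: power_int_add of_int_mult)
       (simp add: algebra_simps)
qed auto

lemma padic_abs_minus [simp]: "padic_abs p (- x) = padic_abs p x"
proof -
  have "padic_abs p (of_int (- 1)) = 1"
    by (subst padic_abs_of_int) (simp_all add: multiplicity_unit_right)
  thus ?thesis
    using padic_abs_mult[of "- 1" x] by simp
qed

lemma padic_abs_diff_commute: "padic_abs p (x - y) = padic_abs p (y - x)"
  using padic_abs_minus[of "x - y"] by simp

lemma padic_abs_inverse: "padic_abs p (inverse x) = inverse (padic_abs p x)"
proof (cases "x = 0")
  case False
  thus ?thesis
    using padic_abs_mult[of x "inverse x"] padic_abs_pos[OF False]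
    by (simp add: field_simps)
qed auto

lemma padic_abs_of_int_le_1: "padic_abs p (of_int a) \<le> 1"
proof (cases "a = 0")
  case False
  thus ?thesis
    using real_p_gt_1 by (simp add: padic_abs_of_int power_int_minus field_simps)
qed auto

lemma padic_abs_ultrametric: "padic_abs p (x + y) \<le> max (padic_abs p x) (padic_abs p y)"
proof (cases "x = 0 \<or> y = 0 \<or> x + y = 0")
  case False
  obtain a b where x: "x = of_int a / of_int b" "b > 0" by (rule rat_cases_int)
  obtain c d where y: "y = of_int c / of_int d" "d > 0" by (rule rat_cases_int)
  define A where "A = a * d"
  define B where "B = c * b"
  define D where "D = b * d"
  have xx: "x = of_int A / of_int D" and yy: "y = of_int B / of_int D"
    using x y by (auto simp: A_def B_def D_def)
  have D: "D \<noteq> 0"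
    using x y by (auto simp: D_def)
  have xy: "x + y = of_int (A + B) / of_int D"
    using xx yy by (simp add: add_divide_distrib)
  have nz: "A \<noteq> 0" "B \<noteq> 0" "A + B \<noteq> 0"
    using False xx yy xy by auto
  let ?m = "multiplicity (int p)"
  have "int p ^ min (?m A) (?m B) dvd A" "int p ^ min (?m A) (?m B) dvd B"
    by (simp_all add: multiplicity_dvd')
  hence "int p ^ min (?m A) (?m B) dvd A + B"
    by (rule dvd_add)
  hence "min (?m A) (?m B) \<le> ?m (A + B)"
    using nz prime_int_p by (intro multiplicity_geI) (auto dest: not_prime_unit)
  hence "?m A \<le> ?m (A + B) \<or> ?m B \<le> ?m (A + B)"
    by linarith
  hence "padic_abs p (x + y) \<le> padic_abs p x \<or> padic_abs p (x + y) \<le> padic_abs p y"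
    using nz D real_p_gt_1 unfolding xy unfolding xx yy
    by (subst (1 2 3 4) padic_abs_divide) (auto intro!: power_int_increasing)
  thus ?thesis
    by linarith
qed (auto simp: le_max_iff_disj)

lemma padic_abs_triangle: "padic_abs p (x + y) \<le> padic_abs p x + padic_abs p y"
  using padic_abs_ultrametric[of x y] padic_abs_nonneg[of x] padic_abs_nonneg[of y] by linarith

lemma padic_abs_triangle': "\<bar>padic_abs p x - padic_abs p y\<bar> \<le> padic_abs p (x - y)"
  using padic_abs_triangle[of "x - y" y] padic_abs_triangle[of "y - x" x]
        padic_abs_diff_commute[of x y] by simp

end


section \<open>Cauchy sequences and null sequences of rationals\<close>

definition padic_Cauchy :: "nat \<Rightarrow> (nat \<Rightarrow> rat) \<Rightarrow> bool" where
  "padic_Cauchy p S \<longleftrightarrow> (\<forall>r>0. \<exists>k. \<forall>m\<ge>k. \<forall>n\<ge>k. padic_abs p (S m - S n) < r)"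

definition padic_null :: "nat \<Rightarrow> (nat \<Rightarrow> rat) \<Rightarrow> bool" where
  "padic_null p S \<longleftrightarrow> (\<lambda>n. padic_abs p (S n)) \<longlonglongrightarrow> 0"

definition padic_rel :: "nat \<Rightarrow> (nat \<Rightarrow> rat) \<Rightarrow> (nat \<Rightarrow> rat) \<Rightarrow> bool" where
  "padic_rel p S T \<longleftrightarrow> padic_Cauchy p S \<and> padic_Cauchy p T \<and> padic_null p (\<lambda>n. S n - T n)"

context
  fixes p :: nat
  assumes p: "prime p"
begin

lemma padic_Cauchy_const [simp]: "padic_Cauchy p (\<lambda>n. c)"
  by (simp add: padic_Cauchy_def)

lemma padic_null_const [simp]: "padic_null p (\<lambda>n. c) \<longleftrightarrow> c = 0"
  by (simp add: padic_null_def tendsto_const_iff padic_abs_eq_0_iff[OF p])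

lemma padic_Cauchy_minus: "padic_Cauchy p S \<Longrightarrow> padic_Cauchy p (\<lambda>n. - S n)"
  unfolding padic_Cauchy_def minus_diff_minus padic_abs_minus[OF p] .

lemma padic_null_minus: "padic_null p S \<Longrightarrow> padic_null p (\<lambda>n. - S n)"
  by (simp add: padic_null_def padic_abs_minus[OF p])

lemma padic_Cauchy_add:
  assumes "padic_Cauchy p S" "padic_Cauchy p T"
  shows "padic_Cauchy p (\<lambda>n. S n + T n)"
  unfolding padic_Cauchy_def
proof (intro allI impI)
  fix r :: real assume r: "r > 0"
  obtain k where k: "\<And>m n. m \<ge> k \<Longrightarrow> n \<ge> k \<Longrightarrow> padic_abs p (S m - S n) < r"
    using assms(1) r unfolding padic_Cauchy_def by blast
  obtain l where l: "\<And>m n. m \<ge> l \<Longrightarrow> n \<ge> l \<Longrightarrow> padic_abs p (T m - T n) < r"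
    using assms(2) r unfolding padic_Cauchy_def by blast
  have "padic_abs p (S m + T m - (S n + T n)) < r" if "m \<ge> max k l" "n \<ge> max k l" for m n
    using padic_abs_ultrametric[OF p, of "S m - S n" "T m - T n"] k[of m n] l[of m n] that
    by (simp add: add_diff_add)
  thus "\<exists>k. \<forall>m\<ge>k. \<forall>n\<ge>k. padic_abs p (S m + T m - (S n + T n)) < r"
    by blast
qed

lemma padic_null_add:
  assumes "padic_null p S" "padic_null p T"
  shows "padic_null p (\<lambda>n. S n + T n)"
proof -
  have "(\<lambda>n. padic_abs p (S n) + padic_abs p (T n)) \<longlonglongrightarrow> 0"
    using tendsto_add[OF assms[unfolded padic_null_def]] by simp
  thus ?thesis
    unfolding padic_null_def
    by (rule Lim_null_comparison[rotated])
       (simp add: padic_abs_nonneg[OF p] padic_abs_triangle[OF p])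
qed

lemma padic_abs_Cauchy:
  assumes "padic_Cauchy p S"
  shows "Cauchy (\<lambda>n. padic_abs p (S n))"
  unfolding Cauchy_def dist_real_def
proof (intro allI impI)
  fix r :: real assume "r > 0"
  then obtain k where k: "\<forall>m\<ge>k. \<forall>n\<ge>k. padic_abs p (S m - S n) < r"
    using assms unfolding padic_Cauchy_def by blast
  have "\<forall>m\<ge>k. \<forall>n\<ge>k. \<bar>padic_abs p (S m) - padic_abs p (S n)\<bar> < r"
    using k by (auto intro: le_less_trans[OF padic_abs_triangle'[OF p]])
  thus "\<exists>k. \<forall>m\<ge>k. \<forall>n\<ge>k. \<bar>padic_abs p (S m) - padic_abs p (S n)\<bar> < r" ..
qed

lemma padic_abs_convergent:
  "padic_Cauchy p S \<Longrightarrow> convergent (\<lambda>n. padic_abs p (S n))"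
  by (intro Cauchy_convergent padic_abs_Cauchy)

lemma padic_Cauchy_bounded:
  assumes "padic_Cauchy p S"
  obtains b where "b > 0" "\<And>n. padic_abs p (S n) \<le> b"
proof -
  obtain b where "b > 0" "\<And>n. norm (padic_abs p (S n)) \<le> b"
    using convergent_imp_Bseq[OF padic_abs_convergent[OF assms]] unfolding Bseq_def by blast
  thus ?thesis
    using that[of b] by (simp add: padic_abs_nonneg[OF p])
qed

lemma padic_null_mult:
  assumes "padic_Cauchy p S" "padic_null p T"
  shows "padic_null p (\<lambda>n. S n * T n)"
proof -
  have "(\<lambda>n. padic_abs p (S n)) \<longlonglongrightarrow> lim (\<lambda>n. padic_abs p (S n))"
    using padic_abs_convergent[OF assms(1)] by (simp add: convergent_LIMSEQ_iff)
  from tendsto_mult[OF this assms(2)[unfolded padic_null_def]] show ?thesis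
    by (simp add: padic_null_def padic_abs_mult[OF p])
qed

lemma padic_Cauchy_mult:
  assumes "padic_Cauchy p S" "padic_Cauchy p T"
  shows "padic_Cauchy p (\<lambda>n. S n * T n)"
  unfolding padic_Cauchy_def
proof (intro allI impI)
  fix r :: real assume r: "r > 0"
  obtain a where a: "a > 0" "\<And>n. padic_abs p (S n) \<le> a"
    using padic_Cauchy_bounded[OF assms(1)] by blast
  obtain b where b: "b > 0" "\<And>n. padic_abs p (T n) \<le> b"
    using padic_Cauchy_bounded[OF assms(2)] by blast
  obtain k where k: "\<And>m n. m \<ge> k \<Longrightarrow> n \<ge> k \<Longrightarrow> padic_abs p (S m - S n) < r / b"
    using assms(1) r b(1) unfolding padic_Cauchy_def by (meson divide_pos_pos)
  obtain l where l: "\<And>m n. m \<ge> l \<Longrightarrow> n \<ge> l \<Longrightarrow> padic_abs p (T m - T n) < r / a"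
    using assms(2) r a(1) unfolding padic_Cauchy_def by (meson divide_pos_pos)
  have "padic_abs p (S m * T m - S n * T n) < r" if mn: "m \<ge> max k l" "n \<ge> max k l" for m n
  proof -
    have eq: "S m * T m - S n * T n = S m * (T m - T n) + (S m - S n) * T n"
      by (simp add: algebra_simps)
    have "padic_abs p (S m * (T m - T n)) \<le> a * padic_abs p (T m - T n)"
      using a by (simp add: padic_abs_mult[OF p] mult_right_mono padic_abs_nonneg[OF p])
    also have "\<dots> < r"
      using l[of m n] mn a by (simp add: field_simps)
    finally have 1: "padic_abs p (S m * (T m - T n)) < r" .
    have "padic_abs p ((S m - S n) * T n) \<le> padic_abs p (S m - S n) * b"
      using b by (simp add: padic_abs_mult[OF p] mult_left_mono padic_abs_nonneg[OF p])
    also have "\<dots> < r"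
      using k[of m n] mn b by (simp add: field_simps)
    finally have 2: "padic_abs p ((S m - S n) * T n) < r" .
    show ?thesis
      using padic_abs_ultrametric[OF p, of "S m * (T m - T n)" "(S m - S n) * T n"] 1 2
      unfolding eq by linarith
  qed
  thus "\<exists>k. \<forall>m\<ge>k. \<forall>n\<ge>k. padic_abs p (S m * T m - S n * T n) < r"
    by blast
qed

lemma padic_Cauchy_not_null:
  assumes "padic_Cauchy p S" "\<not> padic_null p S"
  obtains b k where "b > 0" "\<And>n. n \<ge> k \<Longrightarrow> padic_abs p (S n) > b"
proof -
  define L where "L = lim (\<lambda>n. padic_abs p (S n))"
  have L: "(\<lambda>n. padic_abs p (S n)) \<longlonglongrightarrow> L"
    using padic_abs_convergent[OF assms(1)] by (simp add: convergent_LIMSEQ_iff L_def)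
  have "L \<ge> 0"
    by (rule LIMSEQ_le_const[OF L]) (simp add: padic_abs_nonneg[OF p])
  moreover have "L \<noteq> 0"
    using assms(2) L by (auto simp: padic_null_def)
  ultimately have pos: "L > 0"
    by simp
  hence "eventually (\<lambda>n. padic_abs p (S n) > L / 2) sequentially"
    by (intro order_tendstoD(1)[OF L]) simp
  then obtain k where "\<And>n. n \<ge> k \<Longrightarrow> padic_abs p (S n) > L / 2"
    unfolding eventually_sequentially by blast
  with pos that[of "L / 2" k] show ?thesis
    by simp
qed

lemma padic_abs_inverse_diff:
  assumes "b > 0" "padic_abs p x > b" "padic_abs p y > b"
  shows "padic_abs p (inverse x - inverse y) \<le> padic_abs p (x - y) / (b * b)"
proof -
  have nz: "x \<noteq> 0" "y \<noteq> 0"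
    using assms by auto
  have eq: "inverse x - inverse y = (y - x) * inverse (x * y)"
    using nz by (simp add: field_simps)
  have "b * b \<le> padic_abs p x * padic_abs p y"
    using assms by (intro mult_mono) auto
  hence "padic_abs p (x - y) / (padic_abs p x * padic_abs p y) \<le> padic_abs p (x - y) / (b * b)"
    using assms by (intro divide_left_mono) (auto simp: padic_abs_nonneg[OF p])
  moreover have "padic_abs p (inverse x - inverse y) =
                   padic_abs p (x - y) / (padic_abs p x * padic_abs p y)"
    unfolding eq padic_abs_mult[OF p] padic_abs_inverse[OF p]
    by (simp add: padic_abs_diff_commute[OF p, of y x] divide_simps)
  ultimately show ?thesis
    by simp
qed

lemma padic_Cauchy_inverse:
  assumes "padic_Cauchy p S" "\<not> padic_null p S"
  shows "padic_Cauchy p (\<lambda>n. inverse (S n))"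
  unfolding padic_Cauchy_def
proof (intro allI impI)
  fix r :: real assume r: "r > 0"
  obtain b k where b: "b > 0" and k: "\<And>n. n \<ge> k \<Longrightarrow> padic_abs p (S n) > b"
    using padic_Cauchy_not_null[OF assms] by blast
  have "r * (b * b) > 0"
    using r b by simp
  then obtain l where l: "\<And>m n. m \<ge> l \<Longrightarrow> n \<ge> l \<Longrightarrow> padic_abs p (S m - S n) < r * (b * b)"
    using assms(1) unfolding padic_Cauchy_def by blast
  have "padic_abs p (inverse (S m) - inverse (S n)) < r" if "m \<ge> max k l" "n \<ge> max k l" for m n
  proof -
    have "padic_abs p (inverse (S m) - inverse (S n)) \<le> padic_abs p (S m - S n) / (b * b)"
      using that by (intro padic_abs_inverse_diff b k) auto
    also have "\<dots> < r"
      using l[of m n] that b by (simp add: field_simps)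
    finally show ?thesis .
  qed
  thus "\<exists>k. \<forall>m\<ge>k. \<forall>n\<ge>k. padic_abs p (inverse (S m) - inverse (S n)) < r"
    by blast
qed

lemma padic_null_inverse_diff:
  assumes "padic_Cauchy p S" "\<not> padic_null p S" "padic_Cauchy p T" "\<not> padic_null p T"
    and "padic_null p (\<lambda>n. S n - T n)"
  shows "padic_null p (\<lambda>n. inverse (S n) - inverse (T n))"
proof -
  obtain b k where b: "b > 0" and k: "\<And>n. n \<ge> k \<Longrightarrow> padic_abs p (S n) > b"
    using padic_Cauchy_not_null[OF assms(1,2)] by blast
  obtain c l where c: "c > 0" and l: "\<And>n. n \<ge> l \<Longrightarrow> padic_abs p (T n) > c"
    using padic_Cauchy_not_null[OF assms(3,4)] by blast
  define a where "a = min b c"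
  have a: "a > 0"
    using b c by (simp add: a_def)
  have "(\<lambda>n. padic_abs p (S n - T n) / (a * a)) \<longlonglongrightarrow> 0"
    using tendsto_divide[OF assms(5)[unfolded padic_null_def] tendsto_const[of "a * a"]] a by simp
  moreover have "eventually (\<lambda>n. norm (padic_abs p (inverse (S n) - inverse (T n))) \<le>
                   padic_abs p (S n - T n) / (a * a)) sequentially"
    using eventually_ge_at_top[of "max k l"]
  proof eventually_elim
    case (elim n)
    have "padic_abs p (S n) > a" "padic_abs p (T n) > a"
      using k[of n] l[of n] elim by (auto simp: a_def)
    from padic_abs_inverse_diff[OF a this] show ?case
      by (simp add: padic_abs_nonneg[OF p])
  qed
  ultimately show ?thesis
    unfolding padic_null_def by (rule Lim_null_comparison[rotated])
qed

lemma padic_rel_refl: "padic_Cauchy p S \<Longrightarrow> padic_rel p S S"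
  by (simp add: padic_rel_def)

lemma part_equivp_padic_rel: "part_equivp (padic_rel p)"
proof (rule part_equivpI)
  show "\<exists>S. padic_rel p S S"
    by (rule exI[of _ "\<lambda>_. 0"]) (simp add: padic_rel_refl)
  show "symp (padic_rel p)"
    unfolding symp_def padic_rel_def padic_null_def
    by (simp add: padic_abs_diff_commute[OF p])
  show "transp (padic_rel p)"
  proof (rule transpI)
    fix S T Z assume "padic_rel p S T" "padic_rel p T Z"
    thus "padic_rel p S Z"
      using padic_null_add[of "\<lambda>n. S n - T n" "\<lambda>n. T n - Z n"] by (simp add: padic_rel_def)
  qed
qed

lemma padic_rel_null_iff:
  assumes "padic_rel p S T"
  shows "padic_null p S \<longleftrightarrow> padic_null p T"
proof -
  have "padic_null p T" if "padic_null p S"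
    using padic_null_add[OF that padic_null_minus[of "\<lambda>n. S n - T n"]] assms
    by (simp add: padic_rel_def)
  moreover have "padic_null p S" if "padic_null p T"
    using padic_null_add[OF that, of "\<lambda>n. S n - T n"] assms by (simp add: padic_rel_def)
  ultimately show ?thesis by blast
qed

lemma padic_rel_lim_eq:
  assumes "padic_rel p S T"
  shows "lim (\<lambda>n. padic_abs p (S n)) = lim (\<lambda>n. padic_abs p (T n))"
proof -
  have S: "(\<lambda>n. padic_abs p (S n)) \<longlonglongrightarrow> lim (\<lambda>n. padic_abs p (S n))"
    using padic_abs_convergent[of S] assms unfolding padic_rel_def convergent_LIMSEQ_iff by blast
  have "(\<lambda>n. padic_abs p (S n) - padic_abs p (T n)) \<longlonglongrightarrow> 0"
    using assms unfolding padic_rel_def padic_null_def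
    by - (rule Lim_null_comparison[where g = "\<lambda>n. padic_abs p (S n - T n)"],
          auto simp: padic_abs_triangle'[OF p])
  from tendsto_diff[OF S this] have "(\<lambda>n. padic_abs p (T n)) \<longlonglongrightarrow> lim (\<lambda>n. padic_abs p (S n))"
    by simp
  thus ?thesis
    by (rule limI[symmetric])
qed

end


section \<open>The field of \<open>p\<close>-adic numbers\<close>

text \<open>
  The prime \<open>p\<close> is the cardinality of the index type \<open>'p\<close>, whose sort \<open>prime_card\<close> says that
  \<open>CARD('p)\<close> is prime. The field is the completion of the rationals, built as for the type
  \<open>real\<close>: Cauchy sequences for \<open>padic_abs\<close> modulo null sequences.
\<close>

typedef (overloaded) ('p :: prime_card) padic =
  "{C. \<exists>S. padic_rel CARD('p) S S \<and> C = Collect (padic_rel CARD('p) S)}"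
  using padic_rel_refl[OF prime_card padic_Cauchy_const[OF prime_card]] by blast

definition abs_padic :: "(nat \<Rightarrow> rat) \<Rightarrow> 'p :: prime_card padic" where
  "abs_padic S = Abs_padic (Collect (padic_rel CARD('p) S))"

definition rep_padic :: "'p :: prime_card padic \<Rightarrow> nat \<Rightarrow> rat" where
  "rep_padic x = (SOME S. S \<in> Rep_padic x)"

definition cr_padic :: "(nat \<Rightarrow> rat) \<Rightarrow> 'p :: prime_card padic \<Rightarrow> bool" where
  "cr_padic = (\<lambda>S x. padic_rel CARD('p) S S \<and> abs_padic S = x)"

lemma Quotient_padic:
  "Quotient (padic_rel CARD('p :: prime_card)) (abs_padic :: _ \<Rightarrow> 'p padic) rep_padic cr_padic"
proof -
  interpret quot_type "padic_rel CARD('p)" "Abs_padic :: _ \<Rightarrow> 'p padic" Rep_padic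
  proof
    show "part_equivp (padic_rel CARD('p))"
      by (rule part_equivp_padic_rel[OF prime_card])
    show "\<exists>S. padic_rel CARD('p) S S \<and> Rep_padic x = Collect (padic_rel CARD('p) S)"
      for x :: "'p padic"
      using Rep_padic[of x] by simp
    show "Rep_padic (Abs_padic C :: 'p padic) = C"
      if "\<exists>S. padic_rel CARD('p) S S \<and> C = Collect (padic_rel CARD('p) S)" for C
      using that by (intro Abs_padic_inverse) simp
  qed (auto simp: Rep_padic_inverse Rep_padic_inject)
  have "abs_padic = (abs :: _ \<Rightarrow> 'p padic)" "rep_padic = (rep :: 'p padic \<Rightarrow> _)"
    by (auto simp: abs_padic_def rep_padic_def abs_def rep_def fun_eq_iff)
  with Quotient have "Quotient3 (padic_rel CARD('p)) (abs_padic :: _ \<Rightarrow> 'p padic) rep_padic"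
    by simp
  thus ?thesis
    by (rule Quotient3_to_Quotient) (simp add: cr_padic_def)
qed

setup_lifting Quotient_padic

instantiation padic :: (prime_card) field
begin

lift_definition zero_padic :: "'a padic" is "\<lambda>n. 0"
  by (simp add: padic_rel_refl prime_card)

lift_definition one_padic :: "'a padic" is "\<lambda>n. 1"
  by (simp add: padic_rel_refl prime_card)

lift_definition plus_padic :: "'a padic \<Rightarrow> 'a padic \<Rightarrow> 'a padic" is "\<lambda>S T n. S n + T n"
  unfolding padic_rel_def add_diff_add
  using padic_Cauchy_add[OF prime_card] padic_null_add[OF prime_card] by blast

lift_definition uminus_padic :: "'a padic \<Rightarrow> 'a padic" is "\<lambda>S n. - S n"
  unfolding padic_rel_def minus_diff_minus
  using padic_Cauchy_minus[OF prime_card] padic_null_minus[OF prime_card] by blast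

lift_definition times_padic :: "'a padic \<Rightarrow> 'a padic \<Rightarrow> 'a padic" is "\<lambda>S T n. S n * T n"
proof -
  fix S T Z W :: "nat \<Rightarrow> rat"
  assume *: "padic_rel CARD('a) S T" "padic_rel CARD('a) Z W"
  have "padic_null CARD('a) (\<lambda>n. S n * (Z n - W n) + W n * (S n - T n))"
    using * unfolding padic_rel_def
    by (intro padic_null_add padic_null_mult prime_card) auto
  also have "(\<lambda>n. S n * (Z n - W n) + W n * (S n - T n)) = (\<lambda>n. S n * Z n - T n * W n)"
    by (simp add: algebra_simps)
  finally show "padic_rel CARD('a) (\<lambda>n. S n * Z n) (\<lambda>n. T n * W n)"
    using * padic_Cauchy_mult[OF prime_card] unfolding padic_rel_def by blast
qed

lift_definition inverse_padic :: "'a padic \<Rightarrow> 'a padic"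
  is "\<lambda>S. if padic_null CARD('a) S then (\<lambda>n. 0) else (\<lambda>n. inverse (S n))"
proof -
  fix S T :: "nat \<Rightarrow> rat"
  assume *: "padic_rel CARD('a) S T"
  have iff: "padic_null CARD('a) S \<longleftrightarrow> padic_null CARD('a) T"
    using * by (rule padic_rel_null_iff[OF prime_card])
  show "padic_rel CARD('a)
          (if padic_null CARD('a) S then (\<lambda>n. 0) else (\<lambda>n. inverse (S n)))
          (if padic_null CARD('a) T then (\<lambda>n. 0) else (\<lambda>n. inverse (T n)))"
  proof (cases "padic_null CARD('a) S")
    case True
    thus ?thesis using iff by (simp add: padic_rel_refl prime_card)
  next
    case False
    thus ?thesis
      using iff * unfolding padic_rel_def
      by (auto intro!: padic_Cauchy_inverse padic_null_inverse_diff prime_card)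
  qed
qed

definition "x - y = x + - y" for x y :: "'a padic"

definition "x div y = x * inverse y" for x y :: "'a padic"

instance
proof
  fix a b c :: "'a padic"
  note [simp] = padic_rel_def padic_Cauchy_add[OF prime_card] padic_Cauchy_mult[OF prime_card]
    padic_Cauchy_minus[OF prime_card] padic_Cauchy_const[OF prime_card]
    padic_null_const[OF prime_card]
  show "a + b = b + a"
    by transfer (simp add: ac_simps)
  show "(a + b) + c = a + (b + c)"
    by transfer (simp add: ac_simps)
  show "0 + a = a"
    by transfer simp
  show "- a + a = 0"
    by transfer simp
  show "a - b = a + - b"
    by (rule minus_padic_def)
  show "(a * b) * c = a * (b * c)"
    by transfer (simp add: ac_simps)
  show "a * b = b * a"
    by transfer (simp add: ac_simps)
  show "1 * a = a"
    by transfer simp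
  show "(a + b) * c = a * c + b * c"
    by transfer (simp add: distrib_right)
  show "(0 :: 'a padic) \<noteq> 1"
    by transfer simp
  have "padic_null CARD('a) (\<lambda>n. inverse (S n) * S n - 1)"
    if S: "padic_Cauchy CARD('a) S" "\<not> padic_null CARD('a) S" for S
  proof -
    obtain b k where b: "b > 0" and k: "\<And>n. n \<ge> k \<Longrightarrow> padic_abs CARD('a) (S n) > b"
      using padic_Cauchy_not_null[OF prime_card S] by blast
    have nz: "S n \<noteq> 0" if "n \<ge> k" for n
      using k[OF that] b by auto
    have "eventually (\<lambda>n. padic_abs CARD('a) (inverse (S n) * S n - 1) = 0) sequentially"
      using eventually_ge_at_top[of k] by eventually_elim (use nz in simp)
    thus ?thesis
      unfolding padic_null_def by (rule tendsto_eventually)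
  qed
  thus "a \<noteq> 0 \<Longrightarrow> inverse a * a = 1"
    by transfer (auto simp: padic_Cauchy_inverse[OF prime_card])
  show "a div b = a * inverse b"
    by (rule divide_padic_def)
  show "inverse (0 :: 'a padic) = 0"
    by transfer simp
qed

end

lift_definition padic_norm :: "'p :: prime_card padic \<Rightarrow> real"
  is "\<lambda>S. lim (\<lambda>n. padic_abs CARD('p) (S n))"
  by (rule padic_rel_lim_eq[OF prime_card])

definition padic_ints :: "'p :: prime_card padic set" where
  "padic_ints = {x. padic_norm x \<le> 1}"


section \<open>Finite extensions of the field of \<open>p\<close>-adic numbers\<close>

text \<open>
  The library type \<open>'p padic alg_closure\<close> is the fixed algebraic closure; \<open>to_ac\<close> is the
  inclusion of the \<open>p\<close>-adic numbers into it.
\<close>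

abbreviation padic_closure :: "'p :: prime_card padic alg_closure ring" where
  "padic_closure \<equiv> ring_of_type_algebra"

definition finite_padic_extension :: "'p :: prime_card padic alg_closure set \<Rightarrow> bool" where
  "finite_padic_extension K \<longleftrightarrow>
     subfield K padic_closure \<and> range to_ac \<subseteq> K \<and>
     ring.finite_dimension padic_closure (range to_ac) K"

definition padic_extension_degree :: "'p :: prime_card padic alg_closure set \<Rightarrow> nat" where
  "padic_extension_degree K = ring.dim padic_closure (range to_ac) K"

definition padic_integral :: "'p :: prime_card padic alg_closure \<Rightarrow> bool" where
  "padic_integral x \<longleftrightarrow> (\<exists>f :: 'p padic poly.
     Polynomial.lead_coeff f = 1 \<and> (\<forall>j. Polynomial.coeff f j \<in> padic_ints) \<and>
     poly (map_poly to_ac f) x = 0)"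

definition ring_of_integers ::
    "'p :: prime_card padic alg_closure set \<Rightarrow> 'p padic alg_closure ring" where
  "ring_of_integers K = padic_closure \<lparr>carrier := {x \<in> K. padic_integral x}\<rparr>"

text \<open>The ring of integers is local, so its maximal ideal is the set of its non-units.\<close>

definition maximal_ideal_of ::
    "'p :: prime_card padic alg_closure set \<Rightarrow> 'p padic alg_closure set" where
  "maximal_ideal_of K = carrier (ring_of_integers K) - Units (ring_of_integers K)"

definition residue_field ::
    "'p :: prime_card padic alg_closure set \<Rightarrow> 'p padic alg_closure set ring" where
  "residue_field K = ring_of_integers K Quot maximal_ideal_of K"


section \<open>Algebraic numbers\<close>

abbreviation Qbar :: "complex set" where
  "Qbar \<equiv> {\<alpha>. algebraic \<alpha>}"

definition is_min_int_poly :: "complex \<Rightarrow> int poly \<Rightarrow> bool" where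
  "is_min_int_poly \<alpha> f \<longleftrightarrow>
     f \<noteq> 0 \<and> poly (map_poly of_int f) \<alpha> = 0 \<and>
     (\<forall>g :: int poly. g \<noteq> 0 \<and> poly (map_poly of_int g) \<alpha> = 0 \<longrightarrow>
        Polynomial.degree f \<le> Polynomial.degree g) \<and>
     content f = 1 \<and> Polynomial.lead_coeff f > 0"

definition min_int_poly :: "complex \<Rightarrow> int poly" where
  "min_int_poly \<alpha> = (THE f. is_min_int_poly \<alpha> f)"

lemma is_min_int_poly_unique:
  assumes "is_min_int_poly \<alpha> f" "is_min_int_poly \<alpha> g"
  shows "f = g"
proof -
  define a where "a = Polynomial.lead_coeff f"
  define b where "b = Polynomial.lead_coeff g"
  have ab: "a > 0" "b > 0"
    using assms by (auto simp: is_min_int_poly_def a_def b_def)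
  have deg: "Polynomial.degree f = Polynomial.degree g"
    using assms unfolding is_min_int_poly_def by (meson le_antisym)
  define h where "h = Polynomial.smult b f - Polynomial.smult a g"
  have "poly (map_poly of_int h) \<alpha> = 0"
    using assms by (simp add: h_def is_min_int_poly_def of_int_poly_hom.hom_minus
      of_int_hom.map_poly_hom_smult)
  have "h = 0"
  proof (rule ccontr)
    assume "h \<noteq> 0"
    have "Polynomial.degree f \<le> Polynomial.degree h"
      using assms(1) \<open>h \<noteq> 0\<close> \<open>poly (map_poly of_int h) \<alpha> = 0\<close>
      unfolding is_min_int_poly_def by blast
    moreover have "Polynomial.degree h \<le> Polynomial.degree f"
      unfolding h_def using deg by (intro degree_diff_le) (auto simp: Polynomial.degree_smult_le)
    ultimately have "Polynomial.lead_coeff h = Polynomial.coeff h (Polynomial.degree f)"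
      by simp
    also have "\<dots> = 0"
      using deg by (simp add: h_def a_def b_def)
    finally show False
      using \<open>h \<noteq> 0\<close> by simp
  qed
  hence eq: "Polynomial.smult b f = Polynomial.smult a g"
    by (simp add: h_def)
  hence "content (Polynomial.smult b f) = content (Polynomial.smult a g)"
    by simp
  hence "a = b"
    using assms ab by (simp add: is_min_int_poly_def)
  with eq have "Polynomial.smult b (f - g) = 0"
    by (simp add: smult_diff_right)
  with ab show ?thesis
    by simp
qed

lemma is_min_int_poly_exists:
  assumes "algebraic \<alpha>"
  shows "\<exists>f. is_min_int_poly \<alpha> f"
proof -
  define P where "P = (\<lambda>f :: int poly. f \<noteq> 0 \<and> poly (map_poly of_int f) \<alpha> = 0)"
  obtain g where g: "\<And>i. Polynomial.coeff g i \<in> \<int>" "g \<noteq> 0" "poly g \<alpha> = 0"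
    using assms unfolding algebraic_def by blast
  define g' :: "int poly" where "g' = map_poly (\<lambda>z. \<lfloor>Re z\<rfloor>) g"
  have g': "g = map_poly of_int g'"
  proof (rule poly_eqI)
    fix n
    obtain z where "Polynomial.coeff g n = of_int z"
      using g(1)[of n] by (elim Ints_cases)
    thus "Polynomial.coeff g n = Polynomial.coeff (map_poly of_int g') n"
      by (simp add: g'_def coeff_map_poly)
  qed
  have "P g'"
    using g g' by (auto simp: P_def)
  then obtain f where f: "P f" "\<And>h. P h \<Longrightarrow> Polynomial.degree f \<le> Polynomial.degree h"
    using ex_has_least_nat[of P g' Polynomial.degree] by blast
  define f1 where "f1 = primitive_part f"
  define u :: int where "u = (if Polynomial.lead_coeff f1 > 0 then 1 else - 1)"
  define f' where "f' = Polynomial.smult u f1"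
  define c where "c = content f * u"
  have f0: "f \<noteq> 0"
    using f by (simp add: P_def)
  have f10: "f1 \<noteq> 0"
    using f0 by (simp add: f1_def)
  have uu: "u * u = 1" "u \<noteq> 0"
    by (simp_all add: u_def)
  have ff': "f = Polynomial.smult c f'"
    using uu by (simp add: c_def f'_def f1_def mult.assoc)
  have c0: "c \<noteq> 0"
    using f0 uu by (simp add: c_def)
  have "content f' = 1"
    using f0 by (simp add: f'_def f1_def u_def)
  moreover have "Polynomial.lead_coeff f' > 0"
    using f10 leading_coeff_0_iff[of f1] by (auto simp: f'_def u_def not_less order_le_less)
  moreover have "poly (map_poly of_int f') \<alpha> = 0"
  proof -
    have "poly (map_poly of_int (Polynomial.smult c f')) \<alpha> = 0"
      using f(1) ff' by (simp add: P_def)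
    thus ?thesis
      using c0 by (simp add: of_int_hom.map_poly_hom_smult)
  qed
  moreover have "Polynomial.degree f' = Polynomial.degree f"
    using c0 by (subst ff') simp
  moreover have "f' \<noteq> 0"
    using ff' f0 by auto
  ultimately have "is_min_int_poly \<alpha> f'"
    using f(2) by (auto simp: is_min_int_poly_def P_def)
  thus ?thesis ..
qed

lemma is_min_int_poly_min_int_poly:
  "algebraic \<alpha> \<Longrightarrow> is_min_int_poly \<alpha> (min_int_poly \<alpha>)"
  unfolding min_int_poly_def
  by (rule theI') (use is_min_int_poly_exists is_min_int_poly_unique in blast)

definition alg_degree :: "complex \<Rightarrow> nat" where
  "alg_degree \<alpha> = Polynomial.degree (min_int_poly \<alpha>)"

lemma alg_degree_eq_dim:
  assumes "algebraic \<alpha>"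
  shows "alg_degree \<alpha> =
           ring.dim ring_of_type_algebra \<rat> (ring.simple_extension ring_of_type_algebra \<rat> \<alpha>)"
proof -
  define R where "R = (ring_of_type_algebra :: complex ring)"
  interpret R: field R
    unfolding R_def by rule
  have R_simps: "carrier R = UNIV" "\<zero>\<^bsub>R\<^esub> = 0" "\<one>\<^bsub>R\<^esub> = 1"
    "x \<otimes>\<^bsub>R\<^esub> y = x * y" "x \<oplus>\<^bsub>R\<^esub> y = x + y" for x y
    by (simp_all add: R_def ring_of_type_algebra_def)
  have pow: "x [^]\<^bsub>R\<^esub> (n :: nat) = x ^ n" for x n
    by (induction n) (simp_all add: R_simps)
  have minus: "\<ominus>\<^bsub>R\<^esub> x = - x" for x
    by (rule R.minus_equality) (simp_all add: R_simps)
  have inv: "inv\<^bsub>R\<^esub> x = inverse x" if "x \<noteq> 0" for x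
    by (rule R.inv_unique'[symmetric]) (use that in \<open>simp_all add: R_simps\<close>)
  have eval: "R.eval xs x = poly (Poly (rev xs)) x" for xs x
    by (induction xs) (simp_all add: R_simps pow Poly_append poly_monom)
  have sf: "subfield \<rat> R"
    using R.ring_axioms
    by (intro R.subfieldI' R.subringI) (auto simp: R_simps minus inv)

  define f where "f = min_int_poly \<alpha>"
  have f: "is_min_int_poly \<alpha> f"
    unfolding f_def by (rule is_min_int_poly_min_int_poly[OF assms])
  define g :: "complex poly" where "g = map_poly of_int f"
  define xs where "xs = rev (coeffs g)"
  have g: "g \<noteq> 0" "poly g \<alpha> = 0" "Polynomial.degree g = Polynomial.degree f"
    using f by (auto simp: g_def is_min_int_poly_def)
  have "set xs \<subseteq> \<rat>"
    using g(1) by (auto simp: xs_def set_coeffs_map_poly g_def)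
  moreover have "hd xs \<noteq> 0"
    using g(1) by (simp add: xs_def hd_rev last_coeffs_eq_coeff_degree)
  ultimately have xs: "xs \<in> carrier (\<rat>[X]\<^bsub>R\<^esub>)"
    by (simp add: univ_poly_def polynomial_def R_simps)
  have xs0: "xs \<noteq> []" "R.eval xs \<alpha> = \<zero>\<^bsub>R\<^esub>"
    using g by (simp_all add: xs_def eval R_simps)
  have alg: "(R.algebraic over \<rat>) \<alpha>"
    by (rule R.algebraicI[OF xs xs0])

  define ys where "ys = R.Irr \<rat> \<alpha>"
  have \<alpha>: "\<alpha> \<in> carrier R"
    by (simp add: R_simps)
  note Irr = R.IrrE[OF sf \<alpha> alg, folded ys_def]
  have "ys pdivides\<^bsub>R\<^esub> xs"
    unfolding ys_def by (rule R.Irr_minimal[OF sf \<alpha> alg xs xs0(2)])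
  hence "length ys - 1 \<le> length xs - 1"
    using R.pdivides_imp_degree_le[OF subfieldE(1)[OF sf] Irr(1) xs xs0(1)] by simp
  hence le: "length ys - 1 \<le> Polynomial.degree f"
    using g by (simp add: xs_def length_coeffs_degree)

  have ys: "ys \<noteq> []" "set ys \<subseteq> \<rat>" "hd ys = 1"
    using Irr(1,2,3) by (auto simp: univ_poly_def polynomial_def R_simps ring_irreducible_def)
  define h where "h = Poly (rev ys)"
  have deg_h: "Polynomial.degree h \<le> length ys - 1"
    by (rule degree_le) (auto simp: h_def nth_default_def)
  have "Polynomial.coeff h (length ys - 1) = 1"
    using ys by (simp add: h_def nth_default_def rev_nth hd_conv_nth)
  hence h0: "h \<noteq> 0"
    by auto
  have h\<alpha>: "poly h \<alpha> = 0"
    using Irr(4) by (simp add: eval R_simps h_def)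
  have hQ: "Polynomial.coeff h n \<in> \<rat>" for n
    using ys(2) nth_mem[of _ "rev ys"] by (auto simp: h_def nth_default_def)
  have "\<exists>D :: int. D \<noteq> 0 \<and> (\<forall>n<N. of_int D * Polynomial.coeff h n \<in> \<int>)" for N
  proof (induction N)
    case 0
    show ?case
      by (rule exI[of _ 1]) simp
  next
    case (Suc N)
    then obtain D :: int where D: "D \<noteq> 0" "\<forall>n<N. of_int D * Polynomial.coeff h n \<in> \<int>"
      by blast
    obtain a b :: int where ab: "b \<noteq> 0" "Polynomial.coeff h N = of_int a / of_int b"
      using hQ[of N] by (elim Rats_cases') (metis less_irrefl)
    have "of_int (D * b) * Polynomial.coeff h n \<in> \<int>" if "n < Suc N" for n
    proof (cases "n = N")
      case True
      have "of_int (D * b) * Polynomial.coeff h n = of_int (D * a)"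
        using ab by (simp add: True)
      thus ?thesis
        by (simp only: Ints_of_int)
    next
      case False
      with that D(2) have "of_int D * Polynomial.coeff h n \<in> \<int>"
        by auto
      hence "of_int b * (of_int D * Polynomial.coeff h n) \<in> \<int>"
        by (rule Ints_mult[OF Ints_of_int])
      thus ?thesis
        by (simp add: ac_simps)
    qed
    with D(1) ab(1) show ?case
      by (intro exI[of _ "D * b"]) auto
  qed
  then obtain D :: int where D: "D \<noteq> 0"
      "\<And>n. n < Suc (Polynomial.degree h) \<Longrightarrow> of_int D * Polynomial.coeff h n \<in> \<int>"
    by blast
  define k :: "int poly" where "k = map_poly (\<lambda>z. \<lfloor>Re z\<rfloor>) (Polynomial.smult (of_int D) h)"
  have k: "map_poly of_int k = Polynomial.smult (of_int D) h"
  proof (rule poly_eqI)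
    fix n
    have "of_int D * Polynomial.coeff h n \<in> \<int>"
      using D(2)[of n] by (cases "n \<le> Polynomial.degree h") (auto simp: coeff_eq_0)
    then obtain z where "of_int D * Polynomial.coeff h n = of_int z"
      by (elim Ints_cases)
    thus "Polynomial.coeff (map_poly of_int k) n = Polynomial.coeff (Polynomial.smult (of_int D) h) n"
      by (simp add: k_def coeff_map_poly)
  qed
  have "k \<noteq> 0"
    using k D(1) h0 by auto
  moreover have "poly (map_poly of_int k) \<alpha> = 0"
    using h\<alpha> by (simp add: k)
  moreover have "Polynomial.degree k = Polynomial.degree h"
    using arg_cong[OF k, of Polynomial.degree] D(1) by simp
  ultimately have "Polynomial.degree f \<le> Polynomial.degree h"
    using f unfolding is_min_int_poly_def by metis
  with le deg_h have "Polynomial.degree f = length ys - 1"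
    by linarith
  moreover have "R.dim \<rat> (R.simple_extension \<rat> \<alpha>) = length ys - 1"
    using R.simple_extension_dim[OF sf \<alpha> alg] by (simp add: over_def ys_def)
  ultimately show ?thesis
    by (simp add: alg_degree_def f_def R_def)
qed

definition galois_conjugates :: "complex \<Rightarrow> complex set" where
  "galois_conjugates \<alpha> = {\<beta>. poly (map_poly of_int (min_int_poly \<alpha>)) \<beta> = 0}"

definition mahler_measure :: "complex \<Rightarrow> real" where
  "mahler_measure \<alpha> = real_of_int \<bar>Polynomial.lead_coeff (min_int_poly \<alpha>)\<bar> *
     (\<Prod>\<beta>\<in>galois_conjugates \<alpha>. max 1 (cmod \<beta>))"

definition weil_height :: "complex \<Rightarrow> real" where
  "weil_height \<alpha> = ln (mahler_measure \<alpha>) / real (alg_degree \<alpha>)"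

definition Qbar_embedding :: "(complex \<Rightarrow> 'p :: prime_card padic alg_closure) \<Rightarrow> bool" where
  "Qbar_embedding i \<longleftrightarrow>
     i \<in> Ring.ring_hom (ring_of_type_algebra \<lparr>carrier := Qbar\<rparr>) padic_closure \<and> inj_on i Qbar"

definition conjugates_in ::
    "(complex \<Rightarrow> 'p :: prime_card padic alg_closure) \<Rightarrow> 'p padic alg_closure set \<Rightarrow>
     complex \<Rightarrow> complex set" where
  "conjugates_in i K \<alpha> = {\<beta> \<in> galois_conjugates \<alpha>. i \<beta> \<in> K}"

end

theory Submission
  imports Defs "Jordan_Normal_Form.Char_Poly"
begin

hide_const (open) up_ring.monom up_ring.coeff Polynomials.degree Polynomials.lead_coeff module.smult Coset.order

text \<open>
  Let \<open>f\<close> be the minimal polynomial of \<open>\<alpha>\<close>, with leading coefficient \<open>a\<close> and roots \<open>\<alpha>\<^sub>1, \<dots>, \<alpha>\<^sub>d\<close>. The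
  determinant \<open>E\<close> of the Bezout matrix of \<open>f\<close> and \<open>f'\<close> is a non-zero integer, and over every field
  in which \<open>f\<close> has \<open>d\<close> distinct roots it equals \<open>a\<^sup>2\<^sup>d V\<^sup>2\<close>, where \<open>V\<close> is the Vandermonde determinant of
  the roots. At the infinite place, the Leibniz formula gives \<open>|E| \<le> (d!)\<^sup>2 M(\<alpha>)\<^sup>2\<^sup>d\<close>. At \<open>p\<close>, the Gauss
  lemma bounds \<open>|E|\<^sub>p\<close> by the product of the chordal distances of all ordered pairs of conjugates. The
  points of \<open>K\<close> fall into the \<open>q + 1\<close> residue classes of the projective line, two points in the same
  class have chordal distance at most \<open>q\<^sup>-\<^sup>1\<^sup>/\<^sup>n\<close> with \<open>n = [K : \<rat>\<^sub>p]\<close> (because \<open>e f \<le> n\<close>), and by Cauchy-Schwarz at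
  least \<open>N\<^sup>2 / (q + 1) - N\<close> ordered pairs of the \<open>N\<close> conjugates in \<open>K\<close> share a class. The product
  formula \<open>1 \<le> |E| |E|\<^sub>p\<close> combines the two estimates.
\<close>

section \<open>The norm on the \<open>p\<close>-adic numbers\<close>

text \<open>The absolute value on the closure of Q_p has to be built from integrality alone. Its
  unit ball is the ring of integral elements; a Hensel factorisation over Q_p shows that
  \<open>x\<close> or its inverse always lies in it, and multiplicativity of the valuation follows
  from that. The Bezout determinant stands in for the discriminant because it is an integer by
  construction, while its factorisation into root differences is an identity checked once for any
  field of characteristic zero. The embedding then only has to carry roots to distinct roots. No
  uniformiser of \<open>K\<close> is chosen: \<open>e f \<le> n\<close> enters only as
  \<open>q |x|^n \<le> 1\<close> for every non-zero \<open>x\<close> of the maximal ideal, which is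
  why the \<open>p\<close>-adic estimates are raised to the power \<open>n\<close> instead of using
  real roots of \<open>q\<close>. Constants: the height enters as
  \<open>M^(2d) = exp (2 d^2 h)\<close>, and each pair in a common class contributes
  \<open>ln q / n\<close>. Division by \<open>2 d^2\<close> gives the main term; the errors are
  \<open>ln q / (2 n d)\<close>, from pairs of a point with itself, and \<open>ln d / d\<close>,
  from the factorials.\<close>

definition padic_of_rat :: "rat \<Rightarrow> 'p :: prime_card padic" where
  "padic_of_rat r = abs_padic (\<lambda>_. r)"

lemma padic_rel_self_iff: "padic_rel CARD('p :: prime_card) S S \<longleftrightarrow> padic_Cauchy CARD('p) S"
  by (auto simp: padic_rel_def padic_null_const[OF prime_card])

lemma padic_cases:
  fixes x :: "'p :: prime_card padic"
  obtains S where "padic_Cauchy CARD('p) S" "x = abs_padic S"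
  by (metis Quotient_padic Quotient_def padic_rel_self_iff)

lemma abs_padic_arith:
  assumes "padic_Cauchy CARD('p :: prime_card) S" "padic_Cauchy CARD('p) T"
  shows "(abs_padic S :: 'p padic) + abs_padic T = abs_padic (\<lambda>n. S n + T n)"
    and "(abs_padic S :: 'p padic) * abs_padic T = abs_padic (\<lambda>n. S n * T n)"
    and "- (abs_padic S :: 'p padic) = abs_padic (\<lambda>n. - S n)"
    and "(abs_padic S :: 'p padic) - abs_padic T = abs_padic (\<lambda>n. S n - T n)"
proof -
  have S: "padic_rel CARD('p) S S" and T: "padic_rel CARD('p) T T"
    using assms by (simp_all add: padic_rel_self_iff)
  have T': "padic_rel CARD('p) (\<lambda>n. - T n) (\<lambda>n. - T n)"
    using assms(2) by (simp add: padic_rel_self_iff padic_Cauchy_minus[OF prime_card])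
  show "(abs_padic S :: 'p padic) + abs_padic T = abs_padic (\<lambda>n. S n + T n)"
    by (rule plus_padic.abs_eq[OF S T])
  show "(abs_padic S :: 'p padic) * abs_padic T = abs_padic (\<lambda>n. S n * T n)"
    by (rule times_padic.abs_eq[OF S T])
  show "- (abs_padic S :: 'p padic) = abs_padic (\<lambda>n. - S n)"
    by (rule uminus_padic.abs_eq[OF S])
  have "(abs_padic S :: 'p padic) - abs_padic T = abs_padic S + abs_padic (\<lambda>n. - T n)"
    by (simp add: uminus_padic.abs_eq[OF T])
  also have "\<dots> = abs_padic (\<lambda>n. S n + - T n)"
    by (rule plus_padic.abs_eq[OF S T'])
  finally show "(abs_padic S :: 'p padic) - abs_padic T = abs_padic (\<lambda>n. S n - T n)"
    by simp
qed

lemma padic_norm_tendsto: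
  assumes "padic_Cauchy CARD('p :: prime_card) S"
  shows "(\<lambda>n. padic_abs CARD('p) (S n)) \<longlonglongrightarrow> padic_norm (abs_padic S :: 'p padic)"
proof -
  have "padic_rel CARD('p) S S"
    using assms by (simp add: padic_rel_self_iff)
  from padic_norm.abs_eq[OF this]
  have "padic_norm (abs_padic S :: 'p padic) = lim (\<lambda>n. padic_abs CARD('p) (S n))" .
  with padic_abs_convergent[OF prime_card assms] show ?thesis
    by (simp add: convergent_LIMSEQ_iff)
qed

lemma padic_norm_of_rat [simp]:
  "padic_norm (padic_of_rat r :: 'p :: prime_card padic) = padic_abs CARD('p) r"
proof -
  have "(\<lambda>n :: nat. padic_abs CARD('p) r) \<longlonglongrightarrow> padic_norm (padic_of_rat r :: 'p padic)"
    unfolding padic_of_rat_def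
    by (rule padic_norm_tendsto[OF padic_Cauchy_const[OF prime_card]])
  thus ?thesis
    by (rule LIMSEQ_unique[OF _ tendsto_const])
qed

lemma padic_of_rat_arith [simp]:
  "padic_of_rat 0 = (0 :: 'p :: prime_card padic)"
  "padic_of_rat 1 = (1 :: 'p padic)"
  "padic_of_rat (r + s) = (padic_of_rat r + padic_of_rat s :: 'p padic)"
  "padic_of_rat (r - s) = (padic_of_rat r - padic_of_rat s :: 'p padic)"
  "padic_of_rat (r * s) = (padic_of_rat r * padic_of_rat s :: 'p padic)"
  unfolding padic_of_rat_def zero_padic_def one_padic_def
  by (simp_all add: abs_padic_arith padic_Cauchy_const[OF prime_card])

lemma padic_of_rat_of_nat: "padic_of_rat (of_nat n) = (of_nat n :: 'p :: prime_card padic)"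
  by (induction n) simp_all

lemma padic_of_rat_of_int: "padic_of_rat (of_int k) = (of_int k :: 'p :: prime_card padic)"
proof (cases k rule: int_cases2)
  case (nonpos n)
  have "padic_of_rat (0 - of_nat n) = (0 - of_nat n :: 'p padic)"
    by (simp only: padic_of_rat_arith padic_of_rat_of_nat)
  thus ?thesis by (simp add: nonpos)
qed (simp add: padic_of_rat_of_nat)

lemma padic_norm_of_int: "padic_norm (of_int k :: 'p :: prime_card padic) = padic_abs CARD('p) (of_int k)"
  by (metis padic_norm_of_rat padic_of_rat_of_int)

lemma padic_norm_of_nat_le_1: "padic_norm (of_nat n :: 'p :: prime_card padic) \<le> 1"
  using padic_norm_of_int[of "int n", where 'p = 'p] padic_abs_of_int_le_1[OF prime_card, of "int n", where 'a1 = 'p]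
  by simp

lemma padic_norm_nonneg [simp]: "padic_norm (x :: 'p :: prime_card padic) \<ge> 0"
proof -
  obtain S where S: "padic_Cauchy CARD('p) S" "x = abs_padic S" by (rule padic_cases)
  show ?thesis
    unfolding S(2) by (rule LIMSEQ_le_const[OF padic_norm_tendsto[OF S(1)]])
      (auto simp: padic_abs_nonneg[OF prime_card])
qed

lemma padic_norm_mult: "padic_norm (x * y) = padic_norm x * padic_norm (y :: 'p :: prime_card padic)"
proof -
  obtain S where S: "padic_Cauchy CARD('p) S" "x = abs_padic S" by (rule padic_cases)
  obtain T where T: "padic_Cauchy CARD('p) T" "y = abs_padic T" by (rule padic_cases)
  have "(\<lambda>n. padic_abs CARD('p) (S n * T n)) \<longlonglongrightarrow> padic_norm x * padic_norm y"
    unfolding padic_abs_mult[OF prime_card] S(2) T(2)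
    by (intro tendsto_mult padic_norm_tendsto S T)
  moreover have "(\<lambda>n. padic_abs CARD('p) (S n * T n)) \<longlonglongrightarrow> padic_norm (x * y)"
    unfolding S(2) T(2) abs_padic_arith[OF S(1) T(1)]
    by (intro padic_norm_tendsto padic_Cauchy_mult prime_card S T)
  ultimately show ?thesis
    using LIMSEQ_unique by blast
qed

lemma padic_norm_ultrametric:
  "padic_norm (x + y) \<le> max (padic_norm x) (padic_norm (y :: 'p :: prime_card padic))"
proof -
  obtain S where S: "padic_Cauchy CARD('p) S" "x = abs_padic S" by (rule padic_cases)
  obtain T where T: "padic_Cauchy CARD('p) T" "y = abs_padic T" by (rule padic_cases)
  have 1: "(\<lambda>n. max (padic_abs CARD('p) (S n)) (padic_abs CARD('p) (T n)))
          \<longlonglongrightarrow> max (padic_norm x) (padic_norm y)"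
    unfolding S(2) T(2) by (intro tendsto_max padic_norm_tendsto S T)
  have 2: "(\<lambda>n. padic_abs CARD('p) (S n + T n)) \<longlonglongrightarrow> padic_norm (x + y)"
    unfolding S(2) T(2) abs_padic_arith[OF S(1) T(1)]
    by (intro padic_norm_tendsto padic_Cauchy_add prime_card S T)
  show ?thesis
    by (rule LIMSEQ_le[OF 2 1]) (simp add: padic_abs_ultrametric[OF prime_card])
qed

lemma padic_norm_0 [simp]: "padic_norm (0 :: 'p :: prime_card padic) = 0"
  using padic_norm_of_rat[of 0, where 'p = 'p] by simp

lemma padic_norm_1 [simp]: "padic_norm (1 :: 'p :: prime_card padic) = 1"
  using padic_norm_of_rat[of 1, where 'p = 'p] by (simp add: padic_abs_1[OF prime_card])

lemma padic_norm_eq_0_iff [simp]: "padic_norm (x :: 'p :: prime_card padic) = 0 \<longleftrightarrow> x = 0"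
proof
  assume *: "padic_norm x = 0"
  show "x = 0"
  proof (rule ccontr)
    assume "x \<noteq> 0"
    hence "padic_norm (x * inverse x) = 1" by simp
    with * show False unfolding padic_norm_mult by simp
  qed
qed simp

lemma padic_norm_pos: "x \<noteq> 0 \<Longrightarrow> padic_norm (x :: 'p :: prime_card padic) > 0"
  using padic_norm_nonneg[of x] padic_norm_eq_0_iff[of x] by linarith

lemma padic_norm_minus [simp]: "padic_norm (- x :: 'p :: prime_card padic) = padic_norm x"
proof -
  have "padic_norm (- 1 :: 'p padic) = 1"
    using padic_norm_of_int[of "-1", where 'p = 'p] padic_norm_of_int[of 1, where 'p = 'p]
    by (simp add: padic_abs_minus[OF prime_card])
  thus ?thesis using padic_norm_mult[of "-1" x] by simp
qed

lemma padic_norm_ultrametric_diff: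
  "padic_norm (x - y) \<le> max (padic_norm x) (padic_norm (y :: 'p :: prime_card padic))"
  using padic_norm_ultrametric[of x "- y"] by simp

lemma padic_norm_inverse: "padic_norm (inverse x :: 'p :: prime_card padic) = inverse (padic_norm x)"
proof (cases "x = 0")
  case False
  thus ?thesis using padic_norm_mult[of x "inverse x"] padic_norm_pos[OF False]
    by (simp add: field_simps)
qed simp

lemma padic_norm_divide: "padic_norm (x / y :: 'p :: prime_card padic) = padic_norm x / padic_norm y"
  by (simp only: divide_inverse padic_norm_mult padic_norm_inverse)

lemma padic_norm_power: "padic_norm (x ^ n :: 'p :: prime_card padic) = padic_norm x ^ n"
  by (induction n) (simp_all add: padic_norm_mult)

lemma padic_norm_sum_le:
  assumes "\<And>i. i \<in> A \<Longrightarrow> padic_norm (f i :: 'p :: prime_card padic) \<le> B" "B \<ge> 0"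
  shows "padic_norm (sum f A) \<le> B"
  using assms
proof (induction A rule: infinite_finite_induct)
  case (insert i A)
  have "padic_norm (f i + sum f A) \<le> max (padic_norm (f i)) (padic_norm (sum f A))"
    by (rule padic_norm_ultrametric)
  also have "\<dots> \<le> B" using insert by auto
  finally show ?case using insert by simp
qed auto

section \<open>Discreteness, density, completeness and residues\<close>

lemma padic_abs_discrete:
  assumes "prime p" "padic_abs p r < 1"
  shows "padic_abs p r \<le> 1 / real p"
proof (cases "r = 0")
  case False
  obtain a b where ab: "quotient_of r = (a, b)" by force
  define k where "k = int (multiplicity (int p) b) - int (multiplicity (int p) a)"
  have *: "padic_abs p r = real p powi k"
    using False ab by (simp add: padic_abs_def k_def)
  have p: "real p > 1" using real_p_gt_1[OF assms(1)] .
  have "k < 0"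
  proof (rule ccontr)
    assume "\<not> k < 0"
    hence "real p powi k \<ge> real p powi 0" using p by (intro power_int_increasing) auto
    thus False using * assms(2) by simp
  qed
  hence "real p powi k \<le> real p powi (-1)" using p by (intro power_int_increasing) auto
  thus ?thesis using * by (simp add: power_int_minus field_simps)
qed simp

lemma padic_norm_p: "padic_norm (of_nat CARD('p) :: 'p :: prime_card padic) = 1 / real CARD('p)"
proof -
  have p: "prime (int CARD('p))" using prime_card[where 'a = 'p] by simp
  hence "padic_abs CARD('p) (of_int (int CARD('p))) = 1 / real CARD('p)"
    using prime_card[where 'a = 'p]
    by (subst padic_abs_of_int[OF prime_card])
       (auto simp: power_int_minus field_simps dest: not_prime_unit)
  thus ?thesis using padic_norm_of_int[of "int CARD('p)", where 'p = 'p] by simp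
qed

text \<open>Non-zero rationals have integer powers of \<open>p\<close> as absolute values, so there
  is a gap between \<open>1 / p\<close> and 1. A representing sequence is eventually below 1, hence
  below the gap, and a closed bound passes to the limit.\<close>

lemma padic_norm_discrete:
  assumes "padic_norm (x :: 'p :: prime_card padic) < 1"
  shows "padic_norm x \<le> 1 / real CARD('p)"
proof -
  obtain S where S: "padic_Cauchy CARD('p) S" "x = abs_padic S" by (rule padic_cases)
  note lim = padic_norm_tendsto[OF S(1), folded S(2)]
  have "eventually (\<lambda>n. padic_abs CARD('p) (S n) < 1) sequentially"
    using assms by (rule order_tendstoD(2)[OF lim])
  hence "eventually (\<lambda>n. padic_abs CARD('p) (S n) \<le> 1 / real CARD('p)) sequentially"
    by eventually_elim (rule padic_abs_discrete[OF prime_card])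
  thus ?thesis
    using tendsto_upperbound[OF lim] by simp
qed

lemma padic_dense:
  fixes x :: "'p :: prime_card padic"
  assumes "r > 0"
  obtains s where "padic_norm (x - padic_of_rat s) < r"
proof -
  obtain S where S: "padic_Cauchy CARD('p) S" "x = abs_padic S" by (rule padic_cases)
  \<comment> \<open>Half of \<open>r\<close>, since the limit only keeps a non-strict bound.\<close>
  obtain k where k: "\<And>m n. m \<ge> k \<Longrightarrow> n \<ge> k \<Longrightarrow> padic_abs CARD('p) (S m - S n) < r / 2"
    using S(1) assms unfolding padic_Cauchy_def by (meson half_gt_zero)
  have C: "padic_Cauchy CARD('p) (\<lambda>n. S n - S k)"
    using padic_Cauchy_add[OF prime_card S(1) padic_Cauchy_const[OF prime_card, of "- S k"]] by simp
  have "x - padic_of_rat (S k) = abs_padic (\<lambda>n. S n - S k)"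
    unfolding S(2) padic_of_rat_def
    by (rule abs_padic_arith(4)[OF S(1) padic_Cauchy_const[OF prime_card]])
  moreover have "padic_norm (abs_padic (\<lambda>n. S n - S k) :: 'p padic) \<le> r / 2"
    by (rule tendsto_upperbound[OF padic_norm_tendsto[OF C]])
       (use k in \<open>auto simp: eventually_sequentially intro!: exI[of _ k] less_imp_le\<close>)
  ultimately have "padic_norm (x - padic_of_rat (S k)) < r" using assms by simp
  thus ?thesis by (rule that)
qed

text \<open>Each \<open>u n\<close> is replaced by a rational within \<open>1 / (n + 1)\<close>;
  these rationals form a Cauchy sequence, and its class is the limit.\<close>

lemma padic_complete:
  fixes u :: "nat \<Rightarrow> 'p :: prime_card padic"
  assumes "\<And>r. r > 0 \<Longrightarrow> \<exists>k. \<forall>m\<ge>k. \<forall>n\<ge>k. padic_norm (u m - u n) < r"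
  obtains x where "(\<lambda>n. padic_norm (u n - x)) \<longlonglongrightarrow> 0"
proof -
  have "\<exists>s. padic_norm (u n - padic_of_rat s) < 1 / real (Suc n)" for n
    by (rule padic_dense[of "1 / real (Suc n)" "u n"]) (auto intro: exI)
  then obtain S where S: "\<And>n. padic_norm (u n - padic_of_rat (S n)) < 1 / real (Suc n)"
    by metis
  have small: "\<exists>k. \<forall>n\<ge>k. 1 / real (Suc n) < r" if "r > 0" for r :: real
  proof -
    obtain k where "1 / real (Suc k) < r" using nat_approx_posE[OF \<open>r > 0\<close>] by metis
    moreover have "1 / real (Suc n) \<le> 1 / real (Suc k)" if "n \<ge> k" for n
      using that by (simp add: frac_le)
    ultimately show ?thesis by (meson le_less_trans)
  qed
  have C: "padic_Cauchy CARD('p) S"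
    unfolding padic_Cauchy_def
  proof (intro allI impI)
    fix r :: real assume r: "r > 0"
    obtain k where k: "\<And>m n. m \<ge> k \<Longrightarrow> n \<ge> k \<Longrightarrow> padic_norm (u m - u n) < r"
      using assms[OF r] by blast
    obtain l where l: "\<And>n. n \<ge> l \<Longrightarrow> 1 / real (Suc n) < r" using small[OF r] by blast
    have "padic_abs CARD('p) (S m - S n) < r" if "m \<ge> max k l" "n \<ge> max k l" for m n
    proof -
      have e: "(padic_of_rat (S m - S n) :: 'p padic) =
              (u m - u n) + ((u n - padic_of_rat (S n)) - (u m - padic_of_rat (S m)))"
        by simp
      have "padic_norm (padic_of_rat (S m - S n) :: 'p padic) \<le>
              max (padic_norm (u m - u n)) (max (padic_norm (u n - padic_of_rat (S n)))
                 (padic_norm (u m - padic_of_rat (S m))))"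
        using padic_norm_ultrametric[of "u m - u n" "(u n - padic_of_rat (S n)) - (u m - padic_of_rat (S m))"]
          padic_norm_ultrametric_diff[of "u n - padic_of_rat (S n)" "u m - padic_of_rat (S m)"]
        unfolding e by linarith
      also have "\<dots> < r"
        using k[of m n] l[of m] l[of n] S[of m] S[of n] that by simp
      finally show ?thesis by (simp only: padic_norm_of_rat)
    qed
    thus "\<exists>k. \<forall>m\<ge>k. \<forall>n\<ge>k. padic_abs CARD('p) (S m - S n) < r" by blast
  qed
  define x :: "'p padic" where "x = abs_padic S"
  have "(\<lambda>n. padic_norm (u n - x)) \<longlonglongrightarrow> 0"
  proof (rule LIMSEQ_I)
    fix r :: real assume r: "r > 0"
    obtain k where k: "\<And>m n. m \<ge> k \<Longrightarrow> n \<ge> k \<Longrightarrow> padic_abs CARD('p) (S m - S n) < r / 2"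
      using C r unfolding padic_Cauchy_def by (meson half_gt_zero)
    obtain l where l: "\<And>n. n \<ge> l \<Longrightarrow> 1 / real (Suc n) < r" using small[OF r] by blast
    have "padic_norm (u n - x) < r" if n: "n \<ge> max k l" for n
    proof -
      have C': "padic_Cauchy CARD('p) (\<lambda>m. S m - S n)"
        using padic_Cauchy_add[OF prime_card C padic_Cauchy_const[OF prime_card, of "- S n"]] by simp
      have "x - padic_of_rat (S n) = abs_padic (\<lambda>m. S m - S n)"
        unfolding x_def padic_of_rat_def
        by (rule abs_padic_arith(4)[OF C padic_Cauchy_const[OF prime_card]])
      moreover have "padic_norm (abs_padic (\<lambda>m. S m - S n) :: 'p padic) \<le> r / 2"
        by (rule tendsto_upperbound[OF padic_norm_tendsto[OF C']])
           (use k n in \<open>auto simp: eventually_sequentially intro!: exI[of _ k] less_imp_le\<close>)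
      ultimately have "padic_norm (x - padic_of_rat (S n)) < r" using r by simp
      moreover have "padic_norm (u n - padic_of_rat (S n)) < r" using S[of n] l[of n] n by simp
      moreover have "u n - x = (u n - padic_of_rat (S n)) - (x - padic_of_rat (S n))" by simp
      ultimately show ?thesis
        using padic_norm_ultrametric_diff[of "u n - padic_of_rat (S n)" "x - padic_of_rat (S n)"]
        by simp
    qed
    thus "\<exists>no. \<forall>n\<ge>no. norm (padic_norm (u n - x) - 0) < r"
      by (intro exI[of _ "max k l"]) simp
  qed
  thus ?thesis by (rule that)
qed

text \<open>In lowest terms the denominator is prime to \<open>p\<close>, so \<open>c\<close> can be
  taken as the numerator times an inverse of the denominator modulo \<open>p\<close>.\<close>

lemma padic_abs_residue:
  assumes p: "prime p" and r: "padic_abs p r \<le> 1"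
  obtains c where "c < p" "padic_abs p (r - of_nat c) < 1"
proof -
  obtain a b where ab: "quotient_of r = (a, b)" by force
  have b: "b > 0" and cop: "coprime a b" and eq: "r = of_int a / of_int b"
    using quotient_of_denom_pos[OF ab] quotient_of_coprime[OF ab] quotient_of_div[OF ab] by auto
  have ip: "prime (int p)" using p by simp
  have nd: "\<not> int p dvd b"
  proof
    assume d: "int p dvd b"
    hence "\<not> int p dvd a" using cop ip by (meson coprime_common_divisor not_prime_unit)
    hence a: "multiplicity (int p) a = 0" "a \<noteq> 0" by (auto intro: not_dvd_imp_multiplicity_0)
    have "multiplicity (int p) b > 0" using d b ip
      by (simp add: prime_multiplicity_gt_zero_iff)
    moreover have "padic_abs p r = real p powi int (multiplicity (int p) b)"
      using a b unfolding eq by (subst padic_abs_divide[OF p]) auto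
    ultimately have "padic_abs p r > 1" using real_p_gt_1[OF p] by simp
    with r show False by simp
  qed
  hence "coprime b (int p)" using prime_imp_coprime[OF ip nd] by (simp add: coprime_commute)
  then obtain x where x: "[b * x = 1] (mod int p)" using cong_solve_coprime_int by blast
  define c where "c = nat ((a * x) mod int p)"
  have p0: "p > 0" using p by (simp add: prime_gt_0_nat)
  have c: "int c = (a * x) mod int p" using p0 by (simp add: c_def)
  have "[b * int c = b * (a * x)] (mod int p)"
    unfolding c by (intro cong_mult cong_refl) (simp add: cong_def)
  also have "b * (a * x) = a * (b * x)" by (simp add: ac_simps)
  also have "[a * (b * x) = a * 1] (mod int p)" by (intro cong_mult cong_refl x)
  finally have d: "int p dvd a - b * int c" by (simp add: cong_iff_dvd_diff dvd_diff_commute)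
  have "c < p" unfolding c_def using p0 by (simp add: nat_less_iff)
  moreover have "padic_abs p (r - of_nat c) < 1"
  proof (cases "a - b * int c = 0")
    case True
    hence "a = b * int c" by simp
    hence "r = of_nat c" using b by (simp add: eq)
    thus ?thesis by simp
  next
    case False
    have e: "r - of_nat c = of_int (a - b * int c) / of_int b" using b unfolding eq by (simp add: field_simps)
    have "multiplicity (int p) (a - b * int c) > 0" using d False ip
      by (simp add: prime_multiplicity_gt_zero_iff)
    moreover have "multiplicity (int p) b = 0" using nd by (rule not_dvd_imp_multiplicity_0)
    ultimately have "padic_abs p (r - of_nat c) = real p powi (- int (multiplicity (int p) (a - b * int c)))"
      using False b unfolding e by (subst padic_abs_divide[OF p]) auto
    also have "\<dots> < 1" using real_p_gt_1[OF p] \<open>multiplicity (int p) (a - b * int c) > 0\<close>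
      by (simp add: power_int_minus field_simps)
    finally show ?thesis .
  qed
  ultimately show ?thesis by (rule that)
qed

lemma padic_residue:
  fixes x :: "'p :: prime_card padic"
  assumes "padic_norm x \<le> 1"
  obtains c where "c < CARD('p)" "padic_norm (x - of_nat c) < 1"
proof -
  obtain r where r: "padic_norm (x - padic_of_rat r) < 1" by (rule padic_dense[of 1]) auto
  have "padic_norm (x - (x - padic_of_rat r)) \<le> 1"
    using padic_norm_ultrametric_diff[of x "x - padic_of_rat r"] r assms by simp
  hence "padic_abs CARD('p) r \<le> 1" by simp
  then obtain c where c: "c < CARD('p)" "padic_abs CARD('p) (r - of_nat c) < 1"
    by (rule padic_abs_residue[OF prime_card])
  have "padic_norm (padic_of_rat (r - of_nat c) :: 'p padic) < 1"
    using c by (simp only: padic_norm_of_rat)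
  moreover have "x - of_nat c = (x - padic_of_rat r) + padic_of_rat (r - of_nat c)"
    by (simp add: padic_of_rat_of_nat)
  ultimately have "padic_norm (x - of_nat c) < 1"
    using padic_norm_ultrametric[of "x - padic_of_rat r" "padic_of_rat (r - of_nat c)"] r by simp
  with c show ?thesis by (intro that)
qed

text \<open>Characteristic zero passes to the algebraic closure, where the Bezout identities are
  evaluated at the images of the conjugates.\<close>

instance padic :: (prime_card) field_char_0
proof
  show "inj (of_nat :: nat \<Rightarrow> 'a padic)"
  proof (rule injI)
    fix m n assume "of_nat m = (of_nat n :: 'a padic)"
    hence "padic_norm (of_int (int m - int n) :: 'a padic) = 0" by simp
    hence "rat_of_int (int m - int n) = 0"
      unfolding padic_norm_of_int padic_abs_eq_0_iff[OF prime_card] .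
    thus "m = n" by simp
  qed
qed

section \<open>Integral elements\<close>

text \<open>Used twice: for the \<open>p\<close>-adic integers inside the algebraic closure, and
  with \<open>Z\<close> all of the rationals inside the complex numbers, where
  \<open>integral\<close> means algebraic.\<close>

locale integral_extension =
  fixes h :: "'a :: comm_ring_1 \<Rightarrow> 'b :: field" and Z :: "'a set"
  assumes h: "comm_ring_hom h"
    and Z_0 [simp]: "0 \<in> Z" and Z_1 [simp]: "1 \<in> Z"
    and Z_add: "x \<in> Z \<Longrightarrow> y \<in> Z \<Longrightarrow> x + y \<in> Z"
    and Z_minus: "x \<in> Z \<Longrightarrow> - x \<in> Z"
    and Z_mult: "x \<in> Z \<Longrightarrow> y \<in> Z \<Longrightarrow> x * y \<in> Z"
begin

sublocale h: comm_ring_hom h by (rule h)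

definition integral :: "'b \<Rightarrow> bool" where
  "integral x \<longleftrightarrow> (\<exists>f. lead_coeff f = 1 \<and> (\<forall>j. coeff f j \<in> Z) \<and> poly (map_poly h f) x = 0)"

lemma Z_sum: "(\<And>i. i \<in> A \<Longrightarrow> f i \<in> Z) \<Longrightarrow> sum f A \<in> Z"
  by (induction A rule: infinite_finite_induct) (auto intro: Z_add)

lemma coeff_sum_in_Z: "(\<And>i j. i \<in> A \<Longrightarrow> coeff (f i) j \<in> Z) \<Longrightarrow> coeff (sum f A) j \<in> Z"
  by (simp add: coeff_sum Z_sum)

lemma coeff_mult_in_Z:
  "(\<And>j. coeff f j \<in> Z) \<Longrightarrow> (\<And>j. coeff g j \<in> Z) \<Longrightarrow> coeff (f * g) j \<in> Z"
  by (simp add: coeff_mult Z_sum Z_mult)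

lemma coeff_prod_in_Z: "(\<And>i j. i \<in> A \<Longrightarrow> coeff (f i) j \<in> Z) \<Longrightarrow> coeff (prod f A) j \<in> Z"
proof (induction A arbitrary: j rule: infinite_finite_induct)
  case (insert i A)
  thus ?case by (auto intro!: coeff_mult_in_Z)
qed (auto simp: coeff_1)

text \<open>The Leibniz formula expresses the coefficients by sums, products and signs, all of which
  stay in \<open>Z\<close>.\<close>

lemma coeff_char_poly_in_Z:
  assumes A: "A \<in> carrier_mat n n" and Z: "\<And>i j. i < n \<Longrightarrow> j < n \<Longrightarrow> A $$ (i, j) \<in> Z"
  shows "coeff (char_poly A) k \<in> Z"
proof -
  have entry: "coeff (char_poly_matrix A $$ (i, j)) l \<in> Z" if "i < n" "j < n" for i j l
    using A Z[OF that] that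
    by (auto simp: char_poly_matrix_def coeff_pCons split: nat.splits intro: Z_minus)
  have sgn: "coeff (signof p :: 'a poly) l \<in> Z" for p :: "nat \<Rightarrow> nat" and l
    by (auto simp: sign_def coeff_1 intro: Z_minus)
  show ?thesis
    unfolding char_poly_def det_def'[OF char_poly_matrix_closed[OF A]]
  proof (intro coeff_sum_in_Z coeff_mult_in_Z coeff_prod_in_Z sgn entry)
    fix p i assume p: "p \<in> {p. p permutes {0..<n}}" and i: "i \<in> {0..<n}"
    show "i < n" using i by simp
    show "p i < n" using p i permutes_in_image[of p "{0..<n}" i] by simp
  qed
qed

section \<open>Finitely generated modules over \<open>Z\<close> and the determinant trick\<close>

definition module_span :: "'b set \<Rightarrow> 'b set" where
  "module_span B = {\<Sum>b\<in>B. h (c b) * b | c. \<forall>b\<in>B. c b \<in> Z}"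

lemma module_span_add:
  assumes "x \<in> module_span B" "y \<in> module_span B"
  shows "x + y \<in> module_span B"
proof -
  obtain c where c: "x = (\<Sum>b\<in>B. h (c b) * b)" "\<forall>b\<in>B. c b \<in> Z"
    using assms(1) by (auto simp: module_span_def)
  obtain d where d: "y = (\<Sum>b\<in>B. h (d b) * b)" "\<forall>b\<in>B. d b \<in> Z"
    using assms(2) by (auto simp: module_span_def)
  have "x + y = (\<Sum>b\<in>B. h (c b + d b) * b)"
    by (simp add: c d h.hom_add sum.distrib distrib_right)
  thus ?thesis using c d by (auto simp: module_span_def intro!: exI[of _ "\<lambda>b. c b + d b"] Z_add)
qed

lemma module_span_scale:
  assumes "x \<in> module_span B" "a \<in> Z"
  shows "h a * x \<in> module_span B"
proof -
  obtain c where c: "x = (\<Sum>b\<in>B. h (c b) * b)" "\<forall>b\<in>B. c b \<in> Z"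
    using assms(1) by (auto simp: module_span_def)
  have "h a * x = (\<Sum>b\<in>B. h (a * c b) * b)"
    by (simp add: c h.hom_mult sum_distrib_left mult.assoc)
  thus ?thesis using c assms by (auto simp: module_span_def intro!: exI[of _ "\<lambda>b. a * c b"] Z_mult)
qed

lemma module_span_0: "0 \<in> module_span B"
  by (auto simp: module_span_def intro!: exI[of _ "\<lambda>_. 0"])

lemma module_span_sum: "(\<And>i. i \<in> A \<Longrightarrow> f i \<in> module_span B) \<Longrightarrow> sum f A \<in> module_span B"
  by (induction A rule: infinite_finite_induct) (auto intro: module_span_0 module_span_add)

lemma module_span_superset:
  assumes "finite B" "b \<in> B"
  shows "b \<in> module_span B"
proof -
  have "(\<Sum>b'\<in>B. h (if b' = b then 1 else 0) * b') = (\<Sum>b'\<in>B. if b' = b then b' else 0)"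
    by (intro sum.cong) auto
  also have "\<dots> = b" using assms by simp
  finally show ?thesis
    by (auto simp: module_span_def intro!: exI[of _ "\<lambda>b'. if b' = b then 1 else 0"])
qed

text \<open>Multiplication by \<open>z\<close> acts on the generators through a matrix over
  \<open>Z\<close>, the generators form an eigenvector for \<open>z\<close>, and the characteristic
  polynomial is monic over \<open>Z\<close>. The non-zero generator \<open>b0\<close> keeps the
  eigenvector non-zero.\<close>

lemma integral_if_module:
  assumes B: "finite B" "b0 \<in> B" "b0 \<noteq> 0" and z: "\<And>b. b \<in> B \<Longrightarrow> z * b \<in> module_span B"
  shows "integral z"
proof -
  define n where "n = card B"
  obtain v where v: "bij_betw v {0..<n} B"
    using ex_bij_betw_nat_finite[OF B(1)] by (auto simp: n_def)
  have "\<exists>c. \<forall>b\<in>B. z * b = (\<Sum>b'\<in>B. h (c b b') * b') \<and> (\<forall>b'\<in>B. c b b' \<in> Z)"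
    using z unfolding module_span_def by (intro bchoice) blast
  then obtain c where c: "\<And>b. b \<in> B \<Longrightarrow> z * b = (\<Sum>b'\<in>B. h (c b b') * b')"
      "\<And>b b'. b \<in> B \<Longrightarrow> b' \<in> B \<Longrightarrow> c b b' \<in> Z"
    by blast
  define A where "A = mat n n (\<lambda>(i, j). c (v i) (v j))"
  have A: "A \<in> carrier_mat n n" by (simp add: A_def)
  have vB: "v i \<in> B" if "i < n" for i using v that by (auto simp: bij_betw_def)
  define w where "w = vec n v"
  have "map_mat h A *\<^sub>v w = z \<cdot>\<^sub>v w"
  proof (intro eq_vecI)
    fix i assume "i < dim_vec (z \<cdot>\<^sub>v w)"
    hence i: "i < n" by (simp add: w_def)
    have "(map_mat h A *\<^sub>v w) $ i = (\<Sum>j\<in>{0..<n}. h (c (v i) (v j)) * v j)"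
      using i by (simp add: A_def w_def scalar_prod_def)
    also have "\<dots> = (\<Sum>b'\<in>B. h (c (v i) b') * b')"
      by (rule sum.reindex_bij_betw[OF v])
    also have "\<dots> = z * v i" using c(1)[OF vB[OF i]] by simp
    finally show "(map_mat h A *\<^sub>v w) $ i = (z \<cdot>\<^sub>v w) $ i" using i by (simp add: w_def)
  qed (simp add: A_def w_def)
  moreover have "w \<noteq> 0\<^sub>v n"
  proof
    assume "w = 0\<^sub>v n"
    hence "w $ i = 0\<^sub>v n $ i" if "i < n" for i by simp
    hence "v i = 0" if "i < n" for i using that by (simp add: w_def)
    moreover obtain i where "i < n" "v i = b0" using v B(2) by (auto simp: bij_betw_def)
    ultimately show False using B(3) by blast
  qed
  ultimately have "eigenvalue (map_mat h A) z"
    unfolding eigenvalue_def eigenvector_def using A by (auto intro!: exI[of _ w] simp: w_def)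
  hence "poly (char_poly (map_mat h A)) z = 0"
    using eigenvalue_root_char_poly[of "map_mat h A" n z] A by simp
  hence "poly (map_poly h (char_poly A)) z = 0"
    by (simp add: h.char_poly_hom[OF A])
  moreover have "lead_coeff (char_poly A) = 1" using degree_monic_char_poly[OF A] by simp
  moreover have "coeff (char_poly A) j \<in> Z" for j
    by (rule coeff_char_poly_in_Z[OF A]) (auto simp: A_def intro!: c vB)
  ultimately show ?thesis unfolding integral_def by blast
qed

text \<open>The powers below \<open>n\<close> span a module stable under \<open>z\<close>, so no
  polynomial has to be assembled from the relation.\<close>

lemma integralI:
  assumes "z ^ n = (\<Sum>i<n. h (c i) * z ^ i)" "\<And>i. i < n \<Longrightarrow> c i \<in> Z" "n > 0"
  shows "integral z"
proof (rule integral_if_module)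
  let ?B = "(\<lambda>i. z ^ i) ` {..<n}"
  have span: "z ^ i \<in> module_span ?B" if "i < n" for i
    using that by (intro module_span_superset) auto
  show "finite ?B" "z ^ 0 \<noteq> 0" by auto
  show "z ^ 0 \<in> ?B" using assms(3) by blast
  fix b assume "b \<in> ?B"
  then obtain i where i: "b = z ^ i" "i < n" by auto
  show "z * b \<in> module_span ?B"
  proof (cases "Suc i = n")
    case True
    have "z * b = z ^ n" using i True by auto
    also have "\<dots> \<in> module_span ?B"
      unfolding assms(1) by (intro module_span_sum module_span_scale span assms) auto
    finally show ?thesis .
  next
    case False
    thus ?thesis using i span[of "Suc i"] by simp
  qed
qed

lemma integralE:
  assumes "integral z"
  obtains n c where "z ^ n = (\<Sum>i<n. h (c i) * z ^ i)" "\<And>i. c i \<in> Z" "n > 0"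
proof -
  obtain f where f: "lead_coeff f = 1" "\<And>j. coeff f j \<in> Z" "poly (map_poly h f) z = 0"
    using assms unfolding integral_def by blast
  define n where "n = degree f"
  have le: "i \<le> degree (map_poly h f)" if "h (coeff f i) \<noteq> 0" for i
    using le_degree[of "map_poly h f" i] that by simp
  have "poly (map_poly h f) z = (\<Sum>i\<le>n. h (coeff f i) * z ^ i)"
    unfolding poly_altdef n_def
    by (intro sum.mono_neutral_cong_left) (auto simp: degree_map_poly_le coeff_eq_0 intro: le)
  also have "\<dots> = z ^ n + (\<Sum>i<n. h (coeff f i) * z ^ i)"
    using f(1) by (simp add: n_def lessThan_Suc_atMost[symmetric])
  finally have *: "z ^ n = (\<Sum>i<n. h (- coeff f i) * z ^ i)"
    using f(3) by (simp add: h.hom_uminus sum_negf eq_neg_iff_add_eq_0)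
  have "n > 0"
  proof (rule ccontr)
    assume "\<not> n > 0"
    with * show False by simp
  qed
  with * f(2) show ?thesis by (intro that[of n "\<lambda>i. - coeff f i"]) (auto intro: Z_minus)
qed

text \<open>The monomials \<open>x^i y^j\<close> with \<open>i < m\<close> and \<open>j < n\<close>
  span a module that contains 1 and is stable under \<open>x\<close> and \<open>y\<close>.\<close>

lemma integral_add_mult:
  assumes "integral x" "integral y"
  shows "integral (x + y)" "integral (x * y)"
proof -
  obtain m c where m: "x ^ m = (\<Sum>i<m. h (c i) * x ^ i)" "\<And>i. c i \<in> Z" "m > 0"
    using integralE[OF assms(1)] by blast
  obtain n d where n: "y ^ n = (\<Sum>i<n. h (d i) * y ^ i)" "\<And>i. d i \<in> Z" "n > 0"
    using integralE[OF assms(2)] by blast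
  define B where "B = (\<lambda>(i, j). x ^ i * y ^ j) ` ({..<m} \<times> {..<n})"
  have B: "finite B" by (simp add: B_def)
  have "(\<lambda>(i, j). x ^ i * y ^ j) (0, 0) \<in> B" unfolding B_def using m n by (intro imageI) auto
  hence one: "1 \<in> B" by simp
  have span1: "x ^ i * y ^ j \<in> module_span B" if "i < m" "j < n" for i j
    using that B by (intro module_span_superset) (auto simp: B_def)
  \<comment> \<open>Exponents of \<open>y\<close> are lowered first, for small \<open>i\<close>;
    lowering those of \<open>x\<close> can then rely on arbitrary exponents of
    \<open>y\<close>.\<close>
  have span2: "x ^ i * y ^ j \<in> module_span B" if "i < m" for i j
  proof (induction j rule: less_induct)
    case (less j)
    show ?case
    proof (cases "j < n")
      case False
      hence "x ^ i * y ^ j = x ^ i * (y ^ n * y ^ (j - n))" by (simp flip: power_add)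
      also have "\<dots> = (\<Sum>l<n. h (d l) * (x ^ i * y ^ (l + (j - n))))"
        by (simp add: n(1) sum_distrib_left sum_distrib_right power_add mult_ac)
      also have "\<dots> \<in> module_span B"
        using False by (intro module_span_sum module_span_scale less n) auto
      finally show ?thesis .
    qed (use that span1 in auto)
  qed
  have span: "x ^ i * y ^ j \<in> module_span B" for i j
  proof (induction i rule: less_induct)
    case (less i)
    show ?case
    proof (cases "i < m")
      case False
      hence "x ^ i * y ^ j = (x ^ m * x ^ (i - m)) * y ^ j" by (simp flip: power_add)
      also have "\<dots> = (\<Sum>l<m. h (c l) * (x ^ (l + (i - m)) * y ^ j))"
        by (simp add: m(1) sum_distrib_left sum_distrib_right power_add mult_ac)
      also have "\<dots> \<in> module_span B"
        using False by (intro module_span_sum module_span_scale less m) auto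
      finally show ?thesis .
    qed (use span2 in auto)
  qed
  show "integral (x + y)"
  proof (rule integral_if_module[OF B one])
    fix b assume "b \<in> B"
    then obtain i j where b: "b = x ^ i * y ^ j" by (auto simp: B_def)
    have eq: "(x + y) * b = x ^ Suc i * y ^ j + x ^ i * y ^ Suc j" by (simp add: b algebra_simps)
    show "(x + y) * b \<in> module_span B" unfolding eq by (intro module_span_add span)
  qed simp
  show "integral (x * y)"
  proof (rule integral_if_module[OF B one])
    fix b assume "b \<in> B"
    then obtain i j where b: "b = x ^ i * y ^ j" by (auto simp: B_def)
    have eq: "(x * y) * b = x ^ Suc i * y ^ Suc j" by (simp add: b algebra_simps)
    show "(x * y) * b \<in> module_span B" unfolding eq by (rule span)
  qed simp
qed

lemma integral_hom: "a \<in> Z \<Longrightarrow> integral (h a)"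
  by (rule integralI[of _ 1 "\<lambda>_. a"]) auto

lemma integral_power: "integral x \<Longrightarrow> integral (x ^ n)"
  using integral_hom[of 1] by (induction n) (auto intro: integral_add_mult)

lemma integral_sum: "(\<And>i. i \<in> A \<Longrightarrow> integral (f i)) \<Longrightarrow> integral (sum f A)"
  using integral_hom[of 0]
  by (induction A rule: infinite_finite_induct) (auto intro: integral_add_mult)

end

section \<open>Hensel's lemma\<close>

definition coeffs_le :: "'p :: prime_card padic poly \<Rightarrow> real \<Rightarrow> bool" where
  "coeffs_le f B \<longleftrightarrow> (\<forall>i. padic_norm (coeff f i) \<le> B)"

text \<open>A degree bound in which \<open>n = 0\<close> singles out the zero polynomial; remainders
  modulo a polynomial of degree 0 then need no special case.\<close>

definition coeffs_below :: "'a :: zero poly \<Rightarrow> nat \<Rightarrow> bool" where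
  "coeffs_below f n \<longleftrightarrow> (\<forall>i\<ge>n. coeff f i = 0)"

lemma coeffs_le_nonneg: "coeffs_le f B \<Longrightarrow> B \<ge> 0"
  unfolding coeffs_le_def using padic_norm_nonneg order.trans by blast

lemma coeffs_le_add: "coeffs_le f B \<Longrightarrow> coeffs_le g B \<Longrightarrow> coeffs_le (f + g) B"
  unfolding coeffs_le_def by (auto intro!: order.trans[OF padic_norm_ultrametric])

lemma coeffs_le_diff: "coeffs_le f B \<Longrightarrow> coeffs_le g B \<Longrightarrow> coeffs_le (f - g) B"
  unfolding coeffs_le_def by (auto intro!: order.trans[OF padic_norm_ultrametric_diff])

lemma coeffs_le_mono: "coeffs_le f B \<Longrightarrow> B \<le> C \<Longrightarrow> coeffs_le f C"
  unfolding coeffs_le_def using order.trans by blast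

lemma coeffs_le_mult:
  assumes "coeffs_le f B" "coeffs_le g C"
  shows "coeffs_le (f * g) (B * C)"
  unfolding coeffs_le_def
proof
  fix i
  have "padic_norm (coeff f j * coeff g (i - j)) \<le> B * C" for j
    using assms coeffs_le_nonneg[OF assms(1)]
    unfolding coeffs_le_def padic_norm_mult by (intro mult_mono) auto
  thus "padic_norm (coeff (f * g) i) \<le> B * C"
    unfolding coeff_mult using coeffs_le_nonneg[OF assms(1)] coeffs_le_nonneg[OF assms(2)]
    by (intro padic_norm_sum_le) auto
qed

lemma coeffs_le_monom: "padic_norm c \<le> B \<Longrightarrow> coeffs_le (monom c n) B"
  unfolding coeffs_le_def using order.trans[OF padic_norm_nonneg] by (auto simp: coeff_monom)

lemma coeffs_le_0: "B \<ge> 0 \<Longrightarrow> coeffs_le 0 B"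
  by (simp add: coeffs_le_def)

lemma coeffs_below_add: "coeffs_below f n \<Longrightarrow> coeffs_below g n \<Longrightarrow> coeffs_below (f + g) n"
  by (simp add: coeffs_below_def)

lemma coeffs_below_diff: "coeffs_below f n \<Longrightarrow> coeffs_below g n \<Longrightarrow> coeffs_below (f - g) n"
  for f :: "'a :: ab_group_add poly"
  by (simp add: coeffs_below_def)

lemma coeffs_below_mono: "coeffs_below f m \<Longrightarrow> m \<le> n \<Longrightarrow> coeffs_below f n"
  by (simp add: coeffs_below_def)

lemma coeffs_below_mult:
  assumes "coeffs_below f m" "coeffs_below g n"
  shows "coeffs_below (f * g :: 'a :: comm_semiring_0 poly) (m + n - 1)"
  unfolding coeffs_below_def
proof (intro allI impI)
  fix i assume i: "i \<ge> m + n - 1"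
  show "coeff (f * g) i = 0"
    unfolding coeff_mult
  proof (intro sum.neutral ballI)
    fix j assume "j \<in> {..i}"
    hence "j \<ge> m \<or> i - j \<ge> n" using i by auto
    thus "coeff f j * coeff g (i - j) = 0"
      using assms unfolding coeffs_below_def by auto
  qed
qed

text \<open>Since the coefficient of \<open>g\<close> at \<open>r\<close> is a unit, each
  elimination step subtracts a multiple of \<open>g\<close> by a monomial of norm at most
  \<open>B\<close>; division therefore never enlarges coefficients.\<close>

lemma padic_poly_division:
  fixes g :: "'p :: prime_card padic poly"
  assumes g: "coeffs_le g 1" "padic_norm (coeff g r) = 1" "coeffs_below g (Suc r)"
    and "coeffs_le f B" "coeffs_below f n"
  shows "\<exists>Q R. f = g * Q + R \<and> coeffs_le Q B \<and> coeffs_le R B \<and> coeffs_below Q (n - r) \<and> coeffs_below R r"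
  using assms(4,5)
proof (induction n arbitrary: f)
  case 0
  hence "f = 0" by (auto simp: coeffs_below_def intro: poly_eqI)
  thus ?case using coeffs_le_nonneg[OF 0(1)]
    by (intro exI[of _ 0]) (auto simp: coeffs_le_0 coeffs_below_def)
next
  case (Suc n)
  show ?case
  proof (cases "n < r")
    case True
    hence "coeffs_below f r" using Suc.prems(2) by (auto intro: coeffs_below_mono)
    thus ?thesis using Suc.prems(1) coeffs_le_nonneg[OF Suc.prems(1)]
      by (intro exI[of _ 0] exI[of _ f]) (auto simp: coeffs_le_0 coeffs_below_def)
  next
    case False
    define c where "c = coeff f n / coeff g r"
    have g0: "coeff g r \<noteq> 0" using g(2) by auto
    have "padic_norm c \<le> B" using Suc.prems(1) g(2) by (simp add: c_def padic_norm_divide coeffs_le_def)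
    hence mc: "coeffs_le (monom c (n - r)) B" by (rule coeffs_le_monom)
    define f' where "f' = f - g * monom c (n - r)"
    have "coeffs_le (g * monom c (n - r)) B" using coeffs_le_mult[OF g(1) mc] by simp
    hence 1: "coeffs_le f' B" unfolding f'_def by (rule coeffs_le_diff[OF Suc.prems(1)])
    have 2: "coeffs_below f' n"
      unfolding coeffs_below_def
    proof (intro allI impI)
      fix i assume i: "i \<ge> n"
      have "coeff f' i = coeff f i - c * coeff g (i - (n - r))"
        using i False by (simp add: f'_def mult.commute[of g] coeff_monom_mult)
      also have "\<dots> = 0"
      proof (cases "i = n")
        case True
        thus ?thesis using False g0 by (simp add: c_def)
      next
        case neq: False
        hence "coeff f i = 0" "coeff g (i - (n - r)) = 0"
          using i False Suc.prems(2) g(3) by (auto simp: coeffs_below_def)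
        thus ?thesis by simp
      qed
      finally show "coeff f' i = 0" .
    qed
    obtain Q R where QR: "f' = g * Q + R" "coeffs_le Q B" "coeffs_le R B"
        "coeffs_below Q (n - r)" "coeffs_below R r"
      using Suc.IH[OF 1 2] by blast
    have "f = g * (Q + monom c (n - r)) + R"
      using QR(1) by (simp add: f'_def algebra_simps)
    moreover have "coeffs_below (Q + monom c (n - r)) (Suc n - r)"
      using QR(4) False by (auto simp: coeffs_below_def coeff_monom)
    ultimately show ?thesis using QR coeffs_le_add[OF QR(2) mc] by blast
  qed
qed

text \<open>By the ultrametric inequality the distance from \<open>u k\<close> to any later term is
  bounded by the largest single step, which is the first; no geometric series appears.\<close>

lemma padic_Cauchy_geometric:
  fixes u :: "nat \<Rightarrow> 'p :: prime_card padic"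
  assumes \<epsilon>: "0 < \<epsilon>" "\<epsilon> < 1" and u: "\<And>k. padic_norm (u (Suc k) - u k) \<le> \<epsilon> ^ Suc k"
  obtains x where "\<And>k. padic_norm (x - u k) \<le> \<epsilon> ^ Suc k"
proof -
  have *: "padic_norm (u (k + j) - u k) \<le> \<epsilon> ^ Suc k" for k j
  proof (induction j)
    case (Suc j)
    have "u (k + Suc j) - u k = (u (Suc (k + j)) - u (k + j)) + (u (k + j) - u k)" by simp
    also have "padic_norm \<dots> \<le> max (padic_norm (u (Suc (k + j)) - u (k + j))) (padic_norm (u (k + j) - u k))"
      by (rule padic_norm_ultrametric)
    also have "\<dots> \<le> \<epsilon> ^ Suc k"
      using Suc order.trans[OF u[of "k + j"] power_decreasing[of "Suc k" "Suc (k + j)" \<epsilon>]] \<epsilon> by simp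
    finally show ?case .
  qed (use \<epsilon> in simp)
  have "\<exists>k. \<forall>m\<ge>k. \<forall>n\<ge>k. padic_norm (u m - u n) < r" if r: "r > 0" for r
  proof -
    obtain k where k: "\<epsilon> ^ k < r" using real_arch_pow_inv[OF r \<epsilon>(2)] by blast
    have "padic_norm (u m - u n) < r" if "m \<ge> k" "n \<ge> k" for m n
    proof -
      have "u m - u n = (u (k + (m - k)) - u k) - (u (k + (n - k)) - u k)" using that by simp
      also have "padic_norm \<dots> \<le> \<epsilon> ^ Suc k"
        by (intro order.trans[OF padic_norm_ultrametric_diff] max.boundedI *)
      also have "\<dots> \<le> \<epsilon> ^ k" using \<epsilon> by (intro power_decreasing) auto
      finally show ?thesis using k by simp
    qed
    thus ?thesis by blast
  qed
  then obtain x where x: "(\<lambda>n. padic_norm (u n - x)) \<longlonglongrightarrow> 0" by (rule padic_complete)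
  have "padic_norm (x - u k) \<le> \<epsilon> ^ Suc k" for k
  proof -
    have "eventually (\<lambda>n. padic_norm (u n - x) < \<epsilon> ^ Suc k) sequentially"
      using \<epsilon> by (intro order_tendstoD[OF x]) auto
    then obtain n where n: "n \<ge> k" "padic_norm (u n - x) < \<epsilon> ^ Suc k"
      by (metis (no_types, lifting) eventually_sequentially nle_le)
    have "x - u k = (u (k + (n - k)) - u k) - (u n - x)" using n by simp
    also have "padic_norm \<dots> \<le> max (padic_norm (u (k + (n - k)) - u k)) (padic_norm (u n - x))"
      by (rule padic_norm_ultrametric_diff)
    also have "\<dots> \<le> \<epsilon> ^ Suc k" using n *[of k "n - k"] by (intro max.boundedI) auto
    finally show ?thesis .
  qed
  thus ?thesis by (rule that)
qed

lemma padic_poly_limit: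
  fixes F :: "nat \<Rightarrow> 'p :: prime_card padic poly"
  assumes \<epsilon>: "0 < \<epsilon>" "\<epsilon> < 1" and F: "\<And>k. coeffs_le (F (Suc k) - F k) (\<epsilon> ^ Suc k)"
    and below: "\<And>k. coeffs_below (F k) n"
  obtains G where "coeffs_below G n" "\<And>k. coeffs_le (G - F k) (\<epsilon> ^ Suc k)"
proof -
  have "\<exists>x. \<forall>k. padic_norm (x - coeff (F k) i) \<le> \<epsilon> ^ Suc k" for i
    by (rule padic_Cauchy_geometric[OF \<epsilon>, of "\<lambda>k. coeff (F k) i"])
       (use F in \<open>auto simp: coeffs_le_def\<close>)
  then obtain x where x: "\<And>i k. padic_norm (x i - coeff (F k) i) \<le> \<epsilon> ^ Suc k" by metis
  define G where "G = (\<Sum>i<n. monom (x i) i)"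
  have G: "coeff G i = (if i < n then x i else 0)" for i
    by (simp add: G_def coeff_sum coeff_monom)
  show ?thesis
  proof
    show "coeffs_below G n" by (simp add: coeffs_below_def G)
    show "coeffs_le (G - F k) (\<epsilon> ^ Suc k)" for k
      using x \<epsilon> below[of k] by (auto simp: coeffs_le_def coeffs_below_def G)
  qed
qed

text \<open>
  Newton-like iteration: if \<open>f = g Q + R\<close> with \<open>Q\<close> congruent to 1, replace \<open>g\<close> by \<open>g + R\<close> and
  divide the new error \<open>R (1 - Q)\<close>, which is smaller by one more power of \<open>p\<close>, by \<open>g + R\<close>.
\<close>

lemma padic_hensel:
  fixes f :: "'p :: prime_card padic poly"
  assumes f: "coeffs_le f 1" "padic_norm (coeff f r) = 1" "\<And>i. i > r \<Longrightarrow> padic_norm (coeff f i) < 1"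
  obtains g Q where "f = g * Q" "coeff g r \<noteq> 0" "degree g = r"
proof -
  define \<epsilon> where "\<epsilon> = 1 / real CARD('p)"
  have "real CARD('p) > 1" using real_p_gt_1[OF prime_card[where 'a = 'p]] .
  hence \<epsilon>: "0 < \<epsilon>" "\<epsilon> < 1" by (simp_all add: \<epsilon>_def)
  define n where "n = Suc (degree f)"
  have fn: "coeffs_below f n" by (simp add: coeffs_below_def n_def coeff_eq_0)
  have rn: "r < n" using f(2) le_degree[of f r] by (fastforce simp: n_def)
  define I :: "nat \<Rightarrow> 'p padic poly \<times> 'p padic poly \<Rightarrow> bool"
    where "I = (\<lambda>k (g, Q). coeffs_le g 1 \<and> coeff g r = coeff f r \<and> coeffs_below g (Suc r) \<and>
     coeffs_le (Q - 1) \<epsilon> \<and> coeffs_below Q (n - r) \<and> coeffs_le (f - g * Q) (\<epsilon> ^ Suc k) \<and>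
     coeffs_below (f - g * Q) r)"
  define J :: "nat \<Rightarrow> 'p padic poly \<times> 'p padic poly \<Rightarrow> 'p padic poly \<times> 'p padic poly \<Rightarrow> bool"
    where "J = (\<lambda>k (g, Q) (g', Q'). coeffs_le (g' - g) (\<epsilon> ^ Suc k) \<and> coeffs_le (Q' - Q) (\<epsilon> ^ Suc k))"
  have one: "coeffs_below (1 :: 'p padic poly) (n - r)"
    using rn by (auto simp: coeffs_below_def coeff_1)
  have "\<exists>s. I 0 s"
  proof -
    \<comment> \<open>Truncation at \<open>r\<close> leaves an error whose coefficients have norm
      below 1, hence at most \<open>\<epsilon>\<close> by discreteness.\<close>
    define g where "g = (\<Sum>i<Suc r. monom (coeff f i) i)"
    have cg: "coeff g i = (if i < Suc r then coeff f i else 0)" for i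
      by (simp add: g_def coeff_sum coeff_monom)
    have g: "coeffs_le g 1" "coeff g r = coeff f r" "coeffs_below g (Suc r)"
      using f(1) by (auto simp: coeffs_le_def coeffs_below_def cg)
    have "coeffs_le (f - g) \<epsilon>"
      using padic_norm_discrete[where ?'p = 'p] f(3) \<epsilon> by (auto simp: coeffs_le_def cg \<epsilon>_def)
    moreover have "coeffs_below (f - g) n"
      using rn by (intro coeffs_below_diff fn coeffs_below_mono[OF g(3)]) auto
    ultimately obtain Q R where QR: "f - g = g * Q + R" "coeffs_le Q \<epsilon>" "coeffs_le R \<epsilon>"
        "coeffs_below Q (n - r)" "coeffs_below R r"
      using padic_poly_division[OF g(1) _ g(3), of "f - g" \<epsilon> n] f(2) g(2) by auto
    have "f - g * (1 + Q) = R" using QR(1) by (simp add: algebra_simps)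
    hence "I 0 (g, 1 + Q)" unfolding I_def using g QR one by (auto intro: coeffs_below_add)
    thus ?thesis ..
  qed
  moreover have "\<exists>t. I (Suc k) t \<and> J k s t" if "I k s" for k s
  proof -
    obtain g Q where s: "s = (g, Q)" by force
    define R where "R = f - g * Q"
    have g: "coeffs_le g 1" "coeff g r = coeff f r" "coeffs_below g (Suc r)"
      and Q: "coeffs_le (Q - 1) \<epsilon>" "coeffs_below Q (n - r)"
      and R: "coeffs_le R (\<epsilon> ^ Suc k)" "coeffs_below R r"
      using that by (auto simp: I_def s R_def)
    have \<epsilon>k: "\<epsilon> ^ Suc k \<le> 1" "\<epsilon> ^ Suc (Suc k) \<le> \<epsilon> ^ Suc k" "\<epsilon> ^ Suc (Suc k) \<le> \<epsilon>"
      using \<epsilon> power_decreasing[of 1 "Suc (Suc k)" \<epsilon>] by (auto intro: power_le_one power_decreasing simp del: power_Suc)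
    \<comment> \<open>\<open>R\<close> has degree below \<open>r\<close>, so the unit coefficient at
      \<open>r\<close> is untouched.\<close>
    define g' where "g' = g + R"
    have g': "coeffs_le g' 1" "coeff g' r = coeff f r" "coeffs_below g' (Suc r)"
      using g R \<epsilon>k coeffs_below_mono[OF R(2), of "Suc r"]
      unfolding g'_def by (auto intro!: coeffs_le_add coeffs_below_add coeffs_le_mono[OF R(1)])
        (simp add: coeffs_below_def)
    \<comment> \<open>This is \<open>f - g' * Q = R - R * Q\<close>, the error left by the old
      quotient.\<close>
    define T where "T = - (R * (Q - 1))"
    have "coeffs_le (R * (Q - 1)) (\<epsilon> ^ Suc (Suc k))"
      using coeffs_le_mult[OF R(1) Q(1)] by (simp add: mult_ac)
    hence "coeffs_le T (\<epsilon> ^ Suc (Suc k))" by (simp add: T_def coeffs_le_def)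
    moreover have "coeffs_below T n"
    proof -
      have "coeffs_below (R * (Q - 1)) (r + (n - r) - 1)"
        by (intro coeffs_below_mult R coeffs_below_diff Q one)
      hence "coeffs_below (R * (Q - 1)) n" by (rule coeffs_below_mono) (use rn in auto)
      thus ?thesis by (simp add: T_def coeffs_below_def)
    qed
    ultimately obtain Q'' R'' where Q'': "T = g' * Q'' + R''" "coeffs_le Q'' (\<epsilon> ^ Suc (Suc k))"
        "coeffs_le R'' (\<epsilon> ^ Suc (Suc k))" "coeffs_below Q'' (n - r)" "coeffs_below R'' r"
      using padic_poly_division[OF g'(1) _ g'(3), of T "\<epsilon> ^ Suc (Suc k)" n] f(2) g'(2) by (auto simp del: power_Suc)
    define Q' where "Q' = Q + Q''"
    have "f - g' * Q' = R''"
      using Q''(1) by (simp add: g'_def Q'_def T_def R_def algebra_simps)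
    moreover have "coeffs_le (Q' - 1) \<epsilon>"
      using coeffs_le_add[OF Q(1) coeffs_le_mono[OF Q''(2) \<epsilon>k(3)]] by (simp add: Q'_def algebra_simps)
    moreover have "coeffs_below Q' (n - r)" unfolding Q'_def by (intro coeffs_below_add Q Q'')
    ultimately have "I (Suc k) (g', Q')" using g' Q'' by (simp add: I_def)
    moreover have "J k s (g', Q')"
      using R(1) coeffs_le_mono[OF Q''(2) \<epsilon>k(2)] by (simp add: J_def s g'_def Q'_def)
    ultimately show ?thesis by blast
  qed
  ultimately obtain S where S: "\<And>k. I k (S k)" "\<And>k. J k (S k) (S (Suc k))"
    using dependent_nat_choice[of I J] by metis
  define g where "g = (\<lambda>k. fst (S k))"
  define Q where "Q = (\<lambda>k. snd (S k))"
  have I: "I k (g k, Q k)" for k using S(1)[of k] by (simp add: g_def Q_def)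
  have J: "J k (g k, Q k) (g (Suc k), Q (Suc k))" for k using S(2)[of k] by (simp add: g_def Q_def)
  obtain gl where g: "coeffs_below gl (Suc r)" "\<And>k. coeffs_le (gl - g k) (\<epsilon> ^ Suc k)"
    by (rule padic_poly_limit[OF \<epsilon>, of g "Suc r"]) (use I J in \<open>auto simp: I_def J_def\<close>)
  obtain Ql where Q: "coeffs_below Ql (n - r)" "\<And>k. coeffs_le (Ql - Q k) (\<epsilon> ^ Suc k)"
    by (rule padic_poly_limit[OF \<epsilon>, of Q "n - r"]) (use I J in \<open>auto simp: I_def J_def\<close>)
  have \<epsilon>k: "\<epsilon> ^ Suc k \<le> 1" for k using \<epsilon> by (intro power_le_one) auto
  have gk: "coeffs_le (g k) 1" for k using I[of k] by (simp add: I_def)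
  have "coeffs_le (Q 0) 1"
    using coeffs_le_add[OF coeffs_le_mono[of "Q 0 - 1" \<epsilon> 1] coeffs_le_monom[of 1 1 0]] I[of 0] \<epsilon>
    by (simp add: I_def)
  hence Q1: "coeffs_le Ql 1"
    using coeffs_le_add[OF coeffs_le_mono[OF Q(2)[of 0] \<epsilon>k[of 0]], of "Q 0"] by simp
  have "coeffs_le (f - gl * Ql) (\<epsilon> ^ Suc k)" for k
  proof -
    have 1: "coeffs_le (f - g k * Q k) (\<epsilon> ^ Suc k)" using I[of k] by (simp add: I_def)
    have 2: "coeffs_le (g k * (Ql - Q k)) (\<epsilon> ^ Suc k)"
      using coeffs_le_mult[OF gk[of k] Q(2)[of k]] by simp
    have 3: "coeffs_le ((gl - g k) * Ql) (\<epsilon> ^ Suc k)"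
      using coeffs_le_mult[OF g(2)[of k] Q1] by simp
    have "f - gl * Ql = (f - g k * Q k) - (g k * (Ql - Q k) + (gl - g k) * Ql)"
      by (simp add: algebra_simps)
    also have "coeffs_le \<dots> (\<epsilon> ^ Suc k)"
      by (rule coeffs_le_diff[OF 1 coeffs_le_add[OF 2 3]])
    finally show ?thesis .
  qed
  hence small: "padic_norm (coeff (f - gl * Ql) i) \<le> \<epsilon> ^ Suc k" for i k
    by (simp only: coeffs_le_def)
  have "coeff (f - gl * Ql) i = 0" for i
  proof (rule ccontr)
    assume "coeff (f - gl * Ql) i \<noteq> 0"
    then obtain k where "\<epsilon> ^ k < padic_norm (coeff (f - gl * Ql) i)"
      using real_arch_pow_inv[OF padic_norm_pos \<epsilon>(2)] by blast
    moreover have "\<epsilon> ^ Suc k \<le> \<epsilon> ^ k" using \<epsilon> by (intro power_decreasing) auto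
    ultimately show False using small[of i k] by linarith
  qed
  hence eq: "f = gl * Ql" by (metis eq_iff_diff_eq_0 poly_eqI coeff_0)
  have "padic_norm (coeff gl r - coeff f r) \<le> \<epsilon>"
    using g(2)[of 0] I[of 0] by (auto simp: coeffs_le_def I_def dest: spec[of _ r])
  hence nz: "coeff gl r \<noteq> 0" using f(2) \<epsilon> by auto
  moreover have "degree gl = r"
    using g(1) nz by (intro antisym degree_le le_degree) (auto simp: coeffs_below_def)
  ultimately show ?thesis using eq by (intro that)
qed

section \<open>The absolute value on the algebraic closure\<close>

interpretation padic_int: integral_extension
  "to_ac :: 'p :: prime_card padic \<Rightarrow> 'p padic alg_closure" padic_ints
proof
  fix x y :: "'p padic"
  show "x \<in> padic_ints \<Longrightarrow> y \<in> padic_ints \<Longrightarrow> x + y \<in> padic_ints"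
    using padic_norm_ultrametric[of x y] by (simp add: padic_ints_def)
  show "x \<in> padic_ints \<Longrightarrow> y \<in> padic_ints \<Longrightarrow> x * y \<in> padic_ints"
    by (simp add: padic_ints_def padic_norm_mult mult_le_one)
qed (simp_all add: padic_ints_def)

lemma padic_integral_eq: "padic_int.integral = padic_integral"
  by (simp add: fun_eq_iff padic_int.integral_def padic_integral_def)

lemmas padic_integralI = padic_int.integralI[unfolded padic_integral_eq]
lemmas padic_integralE = padic_int.integralE[unfolded padic_integral_eq]
lemmas padic_integral_add = padic_int.integral_add_mult(1)[unfolded padic_integral_eq]
lemmas padic_integral_mult = padic_int.integral_add_mult(2)[unfolded padic_integral_eq]
lemmas padic_integral_hom = padic_int.integral_hom[unfolded padic_integral_eq]
lemmas padic_integral_power = padic_int.integral_power[unfolded padic_integral_eq]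
lemmas padic_integral_sum = padic_int.integral_sum[unfolded padic_integral_eq]

text \<open>The \<open>p\<close>-adic integers are integrally closed: if \<open>y\<close> had norm
  above 1, the power \<open>y^n\<close> would exceed every lower term of its monic equation.\<close>

lemma padic_integral_to_ac_iff [simp]:
  "padic_integral (to_ac y) \<longleftrightarrow> padic_norm (y :: 'p :: prime_card padic) \<le> 1"
proof
  assume "padic_integral (to_ac y)"
  then obtain n c where n: "to_ac y ^ n = (\<Sum>i<n. to_ac (c i) * to_ac y ^ i)"
      "\<And>i. c i \<in> padic_ints" "n > 0"
    by (rule padic_integralE) blast
  have "to_ac (y ^ n) = to_ac (\<Sum>i<n. c i * y ^ i)" using n(1) by (simp add: to_ac_sum)
  hence eq: "y ^ n = (\<Sum>i<n. c i * y ^ i)" by (simp only: to_ac_eq_iff)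
  show "padic_norm y \<le> 1"
  proof (rule ccontr)
    assume "\<not> padic_norm y \<le> 1"
    hence y: "padic_norm y > 1" by simp
    have "padic_norm (\<Sum>i<n. c i * y ^ i) \<le> padic_norm y ^ (n - 1)"
    proof (rule padic_norm_sum_le)
      fix i assume i: "i \<in> {..<n}"
      have "padic_norm (c i * y ^ i) \<le> 1 * padic_norm y ^ (n - 1)"
        unfolding padic_norm_mult padic_norm_power using n(2)[of i] i y
        by (intro mult_mono power_increasing) (auto simp: padic_ints_def)
      thus "padic_norm (c i * y ^ i) \<le> padic_norm y ^ (n - 1)" by simp
    qed simp
    moreover have "padic_norm y ^ (n - 1) < padic_norm y ^ n"
      using y n(3) by (intro power_strict_increasing) auto
    ultimately show False using eq by (metis padic_norm_power not_less)
  qed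
qed (auto intro: padic_integral_hom simp: padic_ints_def)

lemma padic_integral_of_nat [simp]: "padic_integral (of_nat n :: 'p :: prime_card padic alg_closure)"
  using padic_integral_to_ac_iff[of "of_nat n :: 'p padic"] padic_norm_of_nat_le_1 by simp

lemma padic_integral_of_int [simp]: "padic_integral (of_int n :: 'p :: prime_card padic alg_closure)"
  using padic_integral_to_ac_iff[of "of_int n :: 'p padic"] padic_abs_of_int_le_1[OF prime_card]
  by (simp add: padic_norm_of_int)

abbreviation ac_p :: "'p :: prime_card padic alg_closure" where
  "ac_p \<equiv> of_nat CARD('p)"

lemma padic_p_nonzero: "(of_nat CARD('p) :: 'p :: prime_card padic) \<noteq> 0"
proof
  assume "(of_nat CARD('p) :: 'p padic) = 0"
  hence "padic_norm (of_nat CARD('p) :: 'p padic) = 0" by simp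
  thus False using padic_norm_p[where 'p = 'p] by simp
qed

lemma ac_p_nonzero [simp]: "(ac_p :: 'p :: prime_card padic alg_closure) \<noteq> 0"
  using padic_p_nonzero[where 'p = 'p] by (metis to_ac_of_nat to_ac_eq_0_iff)

text \<open>Scaled by a coefficient of largest norm instead of being made monic: its reduction
  modulo \<open>p\<close> is then non-zero, and the degree of the reduction is the place where
  Hensel's lemma will be applied.\<close>

lemma ac_minimal_poly:
  fixes x :: "'p :: prime_card padic alg_closure"
  obtains f where "f \<noteq> 0" "poly (map_poly to_ac f) x = 0"
    "\<And>g. g \<noteq> 0 \<Longrightarrow> poly (map_poly to_ac g) x = 0 \<Longrightarrow> degree f \<le> degree g"
    "\<And>i. padic_norm (coeff f i) \<le> 1" "\<exists>i. padic_norm (coeff f i) = 1"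
proof -
  define P where "P = (\<lambda>f :: 'p padic poly. f \<noteq> 0 \<and> poly (map_poly to_ac f) x = 0)"
  obtain f0 where "P f0" unfolding P_def by (rule alg_closure_algebraic[of x]) blast
  then obtain f where f: "P f" "\<And>g. P g \<Longrightarrow> degree f \<le> degree g"
    using ex_has_least_nat[of P f0 degree] by blast
  define M where "M = Max ((\<lambda>i. padic_norm (coeff f i)) ` {..degree f})"
  have "M \<in> (\<lambda>i. padic_norm (coeff f i)) ` {..degree f}"
    unfolding M_def by (rule Max_in) auto
  then obtain j where j: "M = padic_norm (coeff f j)" by auto
  have M: "padic_norm (coeff f i) \<le> M" if "i \<le> degree f" for i
    unfolding M_def using that by (intro Max_ge) auto
  have "coeff f (degree f) \<noteq> 0" using f(1) by (simp add: P_def)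
  hence Mpos: "M > 0" using M[of "degree f"] padic_norm_pos[of "coeff f (degree f)"] by simp
  have M': "padic_norm (coeff f i) \<le> M" for i
    using M[of i] Mpos by (cases "i \<le> degree f") (auto simp: coeff_eq_0)
  define c where "c = inverse (coeff f j)"
  have c: "c \<noteq> 0" "padic_norm c = inverse M" using Mpos j by (auto simp: c_def padic_norm_inverse)
  show ?thesis
  proof
    show "smult c f \<noteq> 0" using f(1) c by (simp add: P_def)
    have "map_poly to_ac (smult c f) = smult (to_ac c) (map_poly to_ac f)"
      by (rule poly_eqI) (simp add: coeff_map_poly)
    thus "poly (map_poly to_ac (smult c f)) x = 0" using f(1) by (simp add: P_def)
    show "degree (smult c f) \<le> degree g" if "g \<noteq> 0" "poly (map_poly to_ac g) x = 0" for g
      using f(2)[of g] that c by (simp add: P_def)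
    show "padic_norm (coeff (smult c f) i) \<le> 1" for i
      using M'[of i] Mpos by (simp add: padic_norm_mult c(2) field_simps)
    show "\<exists>i. padic_norm (coeff (smult c f) i) = 1"
      using Mpos by (intro exI[of _ j]) (simp add: padic_norm_mult c(2) j[symmetric])
  qed
qed

lemma poly_map_to_ac:
  "poly (map_poly to_ac f) x = (\<Sum>i\<le>degree f. to_ac (coeff f i) * x ^ i)"
  by (simp add: poly_altdef coeff_map_poly degree_map_poly)

text \<open>
  This is where completeness enters: the minimal polynomial, scaled to be primitive, has no
  proper factorisation, so its reduction modulo \<open>p\<close> is constant or has full degree.
\<close>

lemma padic_integral_dichotomy:
  fixes x :: "'p :: prime_card padic alg_closure"
  assumes x: "x \<noteq> 0"
  shows "padic_integral x \<or>
    (padic_integral (inverse x) \<and> (\<exists>N>0. padic_integral (inverse x ^ N * inverse ac_p)))"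
proof -
  obtain f where f: "f \<noteq> 0" "poly (map_poly to_ac f) x = 0"
    "\<And>g. g \<noteq> 0 \<Longrightarrow> poly (map_poly to_ac g) x = 0 \<Longrightarrow> degree f \<le> degree g"
    "\<And>i. padic_norm (coeff f i) \<le> 1" "\<exists>i. padic_norm (coeff f i) = 1"
    by (rule ac_minimal_poly[of x]) blast
  define n where "n = degree f"
  have root: "(\<Sum>i\<le>n. to_ac (coeff f i) * x ^ i) = 0"
    using f(2) by (simp add: poly_map_to_ac n_def)
  define A where "A = {i. padic_norm (coeff f i) = 1}"
  have An: "A \<subseteq> {..n}"
  proof
    fix i assume "i \<in> A"
    hence "coeff f i \<noteq> 0" by (auto simp: A_def)
    thus "i \<in> {..n}" by (simp add: n_def le_degree)
  qed
  hence fin: "finite A" by (rule finite_subset) simp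
  define r where "r = Max A"
  have "A \<noteq> {}" using f(5) by (auto simp: A_def)
  hence "r \<in> A" using fin by (simp add: r_def)
  hence r: "padic_norm (coeff f r) = 1" "r \<le> n" using An by (auto simp: A_def)
  have above: "padic_norm (coeff f i) < 1" if "i > r" for i
  proof -
    have "i \<notin> A" using Max_ge[OF fin, of i] that by (auto simp: r_def)
    thus ?thesis using f(4)[of i] by (auto simp: A_def)
  qed
  have n0: "n > 0"
  proof (rule ccontr)
    assume "\<not> n > 0"
    hence "coeff f 0 = 0" using root by simp
    moreover have "degree f = 0" using \<open>\<not> n > 0\<close> by (simp add: n_def)
    ultimately show False using f(1) leading_coeff_0_iff[of f] by metis
  qed
  have fle: "coeffs_le f 1" using f(4) by (simp add: coeffs_le_def)
  obtain g Q where g: "f = g * Q" "coeff g r \<noteq> 0" "degree g = r"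
    by (rule padic_hensel[OF fle r(1) above])
  have "r = 0 \<or> r = n"
  proof -
    have nz: "g \<noteq> 0" "Q \<noteq> 0" using f(1) g(1) by auto
    have deg: "n = r + degree Q" using nz g by (simp add: n_def degree_mult_eq)
    interpret mp: map_poly_comm_ring_hom "to_ac :: 'p padic \<Rightarrow> 'p padic alg_closure" ..
    have "map_poly to_ac f = map_poly to_ac g * map_poly to_ac Q"
      unfolding g(1) by (rule mp.hom_mult)
    hence "poly (map_poly to_ac g) x = 0 \<or> poly (map_poly to_ac Q) x = 0"
      using f(2) by simp
    thus ?thesis using f(3)[OF nz(1)] f(3)[OF nz(2)] deg g(3) by (auto simp: n_def[symmetric])
  qed
  thus ?thesis
  proof
    assume "r = n"
    define c where "c = (\<lambda>i. - (coeff f i / coeff f n))"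
    have cn: "coeff f n \<noteq> 0" using f(1) by (simp add: n_def)
    have c: "c i \<in> padic_ints" for i
      using f(4)[of i] r(1) \<open>r = n\<close> by (simp add: c_def padic_ints_def padic_norm_divide)
    have "to_ac (coeff f n) * x ^ n = - (\<Sum>i<n. to_ac (coeff f i) * x ^ i)"
      using root by (simp add: lessThan_Suc_atMost[symmetric] eq_neg_iff_add_eq_0 add.commute)
    hence "x ^ n = (\<Sum>i<n. to_ac (c i) * x ^ i)"
      using cn by (simp add: c_def sum_negf sum_divide_distrib[symmetric] field_simps)
    hence "padic_integral x" using c n0 by (intro padic_integralI) auto
    thus ?thesis ..
  next
    \<comment> \<open>The constant coefficient is a unit and all others are divisible by
      \<open>p\<close>. The reversed equation for \<open>w = 1 / x\<close>, made monic, keeps lower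
      coefficients divisible by \<open>p\<close>, so even \<open>w^n / p\<close> is
      integral.\<close>
    assume r0: "r = 0"
    define w where "w = inverse x"
    have wx: "w * x = 1" "w \<noteq> 0" using x by (simp_all add: w_def)
    have c0: "coeff f 0 \<noteq> 0" "padic_norm (coeff f 0) = 1" using r(1) r0 by auto
    define c where "c = (\<lambda>j. - (coeff f (n - j) / coeff f 0))"
    have "0 = w ^ n * (\<Sum>i\<le>n. to_ac (coeff f i) * x ^ i)" using root by simp
    also have "\<dots> = (\<Sum>i\<le>n. to_ac (coeff f i) * w ^ (n - i))"
      unfolding sum_distrib_left
    proof (intro sum.cong refl)
      fix i assume "i \<in> {..n}"
      hence "w ^ n = w ^ (n - i) * w ^ i" by (simp flip: power_add)
      moreover have "w ^ i * x ^ i = 1" using wx by (simp flip: power_mult_distrib)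
      ultimately show "w ^ n * (to_ac (coeff f i) * x ^ i) = to_ac (coeff f i) * w ^ (n - i)"
        by (simp add: mult_ac)
    qed
    also have "\<dots> = (\<Sum>j\<le>n. to_ac (coeff f (n - j)) * w ^ j)"
      by (rule sum.reindex_bij_witness[of _ "\<lambda>j. n - j" "\<lambda>j. n - j"]) auto
    also have "\<dots> = to_ac (coeff f 0) * w ^ n + (\<Sum>j<n. to_ac (coeff f (n - j)) * w ^ j)"
      by (simp add: lessThan_Suc_atMost[symmetric] add.commute)
    finally have eq: "w ^ n = (\<Sum>j<n. to_ac (c j) * w ^ j)"
      using c0 by (simp add: c_def sum_negf sum_divide_distrib[symmetric] field_simps
          eq_neg_iff_add_eq_0)
    have c: "padic_norm (c j) \<le> 1 / real CARD('p)" if "j < n" for j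
      using padic_norm_discrete[OF above, of "n - j"] that r0 c0
      by (simp add: c_def padic_norm_divide)
    have c1: "c j \<in> padic_ints" if "j < n" for j
      using c[OF that] order.trans[of _ "1 / real CARD('p)" 1] real_p_gt_1[OF prime_card[where 'a = 'p]]
      by (simp add: padic_ints_def)
    have w: "padic_integral w" using eq c1 n0 by (rule padic_integralI)
    have "w ^ n * inverse ac_p = (\<Sum>j<n. to_ac (c j / of_nat CARD('p)) * w ^ j)"
      unfolding eq sum_distrib_right by (intro sum.cong refl) (simp add: divide_inverse mult_ac)
    moreover have "padic_integral (\<Sum>j<n. to_ac (c j / of_nat CARD('p)) * w ^ j)"
    proof (intro padic_integral_sum padic_integral_mult padic_integral_power w)
      fix j assume "j \<in> {..<n}"
      thus "padic_integral (to_ac (c j / of_nat CARD('p)))"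
        unfolding padic_integral_to_ac_iff padic_norm_divide padic_norm_p
        using c[of j] by (simp add: field_simps)
    qed
    ultimately show ?thesis using w n0 by (auto simp: w_def)
  qed
qed

lemma padic_integral_p_powi [simp]:
  "padic_integral ((ac_p :: 'p :: prime_card padic alg_closure) powi k) \<longleftrightarrow> k \<ge> 0"
proof -
  have p: "real CARD('p) > 1" by (rule real_p_gt_1[OF prime_card[where 'a = 'p]])
  have "(ac_p :: 'p padic alg_closure) powi k = to_ac (of_nat CARD('p) powi k)"
    by (simp add: power_int_def)
  moreover have "padic_norm ((of_nat CARD('p) :: 'p padic) powi k) = real CARD('p) powi (- k)"
  proof (cases "k \<ge> 0")
    case True
    hence "padic_norm ((of_nat CARD('p) :: 'p padic) powi k) = inverse (real CARD('p)) ^ nat k"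
      by (simp only: power_int_def if_True padic_norm_power padic_norm_p inverse_eq_divide)
    also have "\<dots> = real CARD('p) powi (- k)"
      using True by (cases "k = 0") (auto simp: power_int_def)
    finally show ?thesis .
  next
    case False
    have "padic_norm (inverse (of_nat CARD('p)) :: 'p padic) = real CARD('p)"
      unfolding padic_norm_inverse padic_norm_p by simp
    thus ?thesis using False by (simp only: power_int_def if_False padic_norm_power) simp
  qed
  moreover have "real CARD('p) powi (- k) \<le> 1 \<longleftrightarrow> k \<ge> 0"
    using power_int_increasing[of "- k" 0 "real CARD('p)"]
      power_int_strict_increasing[of 0 "- k" "real CARD('p)"] p by (cases "k \<ge> 0") auto
  ultimately show ?thesis by simp
qed

text \<open>
  The slopes are the rationals \<open>a / b\<close> such that \<open>x\<^sup>b / p\<^sup>a\<close> is integral; their supremum is the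
  extension of the \<open>p\<close>-adic valuation.
\<close>

definition ac_slopes :: "'p :: prime_card padic alg_closure \<Rightarrow> real set" where
  "ac_slopes x = {of_int a / real b | a b. b > 0 \<and> padic_integral (x ^ b * ac_p powi (- a))}"

definition ac_val :: "'p :: prime_card padic alg_closure \<Rightarrow> real" where
  "ac_val x = Sup (ac_slopes x)"

lemma ac_slopesI: "b > 0 \<Longrightarrow> padic_integral (x ^ b * ac_p powi (- a)) \<Longrightarrow> of_int a / real b \<in> ac_slopes x"
  by (auto simp: ac_slopes_def)

text \<open>Raising to the powers \<open>d\<close> and \<open>b\<close> brings both slopes to the
  common denominator \<open>b d\<close>.\<close>

lemma ac_slopes_add:
  fixes x y :: "'p :: prime_card padic alg_closure"
  assumes "s \<in> ac_slopes x" "t \<in> ac_slopes y"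
  shows "s + t \<in> ac_slopes (x * y)"
proof -
  obtain a b where ab: "s = of_int a / real b" "b > 0" "padic_integral (x ^ b * ac_p powi (- a))"
    using assms(1) by (auto simp: ac_slopes_def)
  obtain c d where cd: "t = of_int c / real d" "d > 0" "padic_integral (y ^ d * ac_p powi (- c))"
    using assms(2) by (auto simp: ac_slopes_def)
  have "padic_integral ((x ^ b * ac_p powi (- a)) ^ d * (y ^ d * ac_p powi (- c)) ^ b)"
    by (rule padic_integral_mult[OF padic_integral_power[OF ab(3)] padic_integral_power[OF cd(3)]])
  also have "(x ^ b * ac_p powi (- a)) ^ d * (y ^ d * ac_p powi (- c)) ^ b =
               (x * y) ^ (b * d) * ac_p powi (- (a * int d + c * int b))"
    by (simp add: power_mult_distrib power_int_power' power_int_add[symmetric] power_mult[symmetric]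
        mult_ac)
  finally have "of_int (a * int d + c * int b) / real (b * d) \<in> ac_slopes (x * y)"
    using ab cd by (intro ac_slopesI) auto
  moreover have "of_int (a * int d + c * int b) / real (b * d) = s + t"
    unfolding ab(1) cd(1) using ab(2) cd(2) by (simp add: add_frac_eq)
  ultimately show ?thesis by simp
qed

text \<open>Some power \<open>p^n\<close> outweighs the denominators in the monic equation of
  \<open>x\<close>, so that \<open>p^n x\<close> is integral.\<close>

lemma ac_slopes_nonempty:
  fixes x :: "'p :: prime_card padic alg_closure"
  obtains n where "- real n \<in> ac_slopes x"
proof -
  obtain f where f: "f \<noteq> 0" "poly (map_poly to_ac f) x = 0"
    using alg_closure_algebraic[of x] by blast
  define D where "D = degree f"
  have lc: "coeff f D \<noteq> 0" using f(1) by (simp add: D_def)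
  define c where "c = (\<lambda>i. - (coeff f i / coeff f D))"
  have root: "(\<Sum>i\<le>D. to_ac (coeff f i) * x ^ i) = 0"
    using f(2) by (simp add: poly_map_to_ac D_def)
  have D0: "D > 0"
  proof (rule ccontr)
    assume "\<not> D > 0"
    thus False using root lc by simp
  qed
  have "to_ac (coeff f D) * x ^ D = - (\<Sum>i<D. to_ac (coeff f i) * x ^ i)"
    using root by (simp add: lessThan_Suc_atMost[symmetric] eq_neg_iff_add_eq_0 add.commute)
  hence eq: "x ^ D = (\<Sum>i<D. to_ac (c i) * x ^ i)"
    using lc by (simp add: c_def sum_negf sum_divide_distrib[symmetric] field_simps)
  have p: "real CARD('p) > 1" by (rule real_p_gt_1[OF prime_card[where 'a = 'p]])
  obtain n where n: "(\<Sum>i<D. padic_norm (c i)) < real CARD('p) ^ n"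
    using real_arch_pow[OF p] by blast
  have cn: "padic_norm (c i) \<le> real CARD('p) ^ n" if "i < D" for i
    using member_le_sum[of i "{..<D}" "\<lambda>i. padic_norm (c i)"] n that by simp
  define P :: "'p padic" where "P = of_nat CARD('p) ^ n"
  have P: "padic_norm P = inverse (real CARD('p) ^ n)"
    by (simp add: P_def padic_norm_power padic_norm_p power_divide inverse_eq_divide)
  have "padic_integral (to_ac P * x)"
  proof (rule padic_integralI[OF _ _ D0])
    have "(to_ac P * x) ^ D = to_ac P ^ D * (\<Sum>i<D. to_ac (c i) * x ^ i)"
      by (simp add: power_mult_distrib eq)
    also have "\<dots> = (\<Sum>i<D. to_ac (c i * P ^ (D - i)) * (to_ac P * x) ^ i)"
      unfolding sum_distrib_left
    proof (intro sum.cong refl)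
      fix i assume "i \<in> {..<D}"
      hence "to_ac P ^ D = to_ac P ^ (D - i) * to_ac P ^ i" by (simp flip: power_add)
      thus "to_ac P ^ D * (to_ac (c i) * x ^ i) = to_ac (c i * P ^ (D - i)) * (to_ac P * x) ^ i"
        by (simp add: power_mult_distrib mult_ac)
    qed
    finally show "(to_ac P * x) ^ D = (\<Sum>i<D. to_ac (c i * P ^ (D - i)) * (to_ac P * x) ^ i)" .
    fix i assume i: "i < D"
    have P1: "padic_norm P \<le> 1" using p by (simp add: P field_simps)
    have "padic_norm P ^ (D - i) \<le> padic_norm P ^ 1" using P1 i by (intro power_decreasing) auto
    hence "padic_norm (c i) * padic_norm P ^ (D - i) \<le> real CARD('p) ^ n * padic_norm P"
      using cn[OF i] by (intro mult_mono) auto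
    also have "\<dots> = 1" using p by (simp add: P)
    finally show "c i * P ^ (D - i) \<in> padic_ints"
      by (simp add: padic_ints_def padic_norm_mult padic_norm_power)
  qed
  hence "of_int (- int n) / real 1 \<in> ac_slopes x"
    by (intro ac_slopesI) (simp_all add: P_def mult.commute)
  thus ?thesis by (intro that[of n]) simp
qed

lemma ac_slopes_1: "s \<in> ac_slopes (1 :: 'p :: prime_card padic alg_closure) \<Longrightarrow> s \<le> 0"
  by (auto simp: ac_slopes_def divide_le_0_iff)

text \<open>A fixed slope \<open>- n\<close> of \<open>1 / x\<close> bounds every slope of
  \<open>x\<close>, because the sum is a slope of 1.\<close>

lemma ac_slopes_bdd_above:
  fixes x :: "'p :: prime_card padic alg_closure"
  assumes "x \<noteq> 0"
  shows "bdd_above (ac_slopes x)"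
proof -
  obtain n where n: "- real n \<in> ac_slopes (inverse x)" by (rule ac_slopes_nonempty)
  have "s \<le> real n" if "s \<in> ac_slopes x" for s
    using ac_slopes_1[of "s + - real n"] ac_slopes_add[OF that n] assms by simp
  thus ?thesis by (auto simp: bdd_above_def)
qed

lemma ac_slopes_le_val: "x \<noteq> 0 \<Longrightarrow> s \<in> ac_slopes x \<Longrightarrow> s \<le> ac_val x"
  unfolding ac_val_def by (intro cSup_upper ac_slopes_bdd_above)

lemma ac_val_le:
  assumes "\<And>s. s \<in> ac_slopes x \<Longrightarrow> s \<le> B"
  shows "ac_val x \<le> B"
proof -
  obtain n where n: "- real n \<in> ac_slopes x" by (rule ac_slopes_nonempty)
  thus ?thesis unfolding ac_val_def using assms by (intro cSup_least) auto
qed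

lemma ac_val_1: "ac_val (1 :: 'p :: prime_card padic alg_closure) = 0"
proof (rule antisym)
  show "ac_val (1 :: 'p padic alg_closure) \<le> 0" by (intro ac_val_le ac_slopes_1)
  have "of_int 0 / real 1 \<in> ac_slopes (1 :: 'p padic alg_closure)"
    using padic_integral_of_nat[of 1, where 'p = 'p] by (intro ac_slopesI) auto
  thus "ac_val (1 :: 'p padic alg_closure) \<ge> 0" using ac_slopes_le_val[of 1 0] by simp
qed

lemma ac_val_mult_ge:
  fixes x y :: "'p :: prime_card padic alg_closure"
  assumes "x \<noteq> 0" "y \<noteq> 0"
  shows "ac_val x + ac_val y \<le> ac_val (x * y)"
proof -
  have "s + t \<le> ac_val (x * y)" if "s \<in> ac_slopes x" "t \<in> ac_slopes y" for s t
    using ac_slopes_le_val[OF _ ac_slopes_add[OF that]] assms by simp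
  hence "ac_val x \<le> ac_val (x * y) - t" if "t \<in> ac_slopes y" for t
    using that by (intro ac_val_le) (simp add: algebra_simps)
  hence "ac_val y \<le> ac_val (x * y) - ac_val x"
    by (intro ac_val_le) (simp add: algebra_simps)
  thus ?thesis by simp
qed

text \<open>If this failed, a rational \<open>a / b\<close> in the gap would make
  \<open>z = x^b / p^a\<close> non-integral; by the dichotomy \<open>1 / z\<close> is integral,
  which gives \<open>1 / x\<close> the slope \<open>- a / b\<close>.\<close>

lemma ac_val_inverse_ge:
  fixes x :: "'p :: prime_card padic alg_closure"
  assumes x: "x \<noteq> 0"
  shows "- ac_val x \<le> ac_val (inverse x)"
proof (rule ccontr)
  assume "\<not> - ac_val x \<le> ac_val (inverse x)"
  hence "ac_val x < - ac_val (inverse x)" by simp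
  then obtain r where r: "r \<in> \<rat>" "ac_val x < r" "r < - ac_val (inverse x)"
    using Rats_dense_in_real by blast
  obtain a :: int and b' :: int where "b' > 0" "r = of_int a / of_int b'"
    using r(1) by (rule Rats_cases')
  then obtain b where b: "b > 0" "r = of_int a / real b"
    by (metis of_int_of_nat_eq pos_int_cases)
  define z where "z = x ^ b * ac_p powi (- a)"
  have z: "z \<noteq> 0" using x by (simp add: z_def)
  have "\<not> padic_integral z"
    using ac_slopes_le_val[OF x ac_slopesI[OF b(1), of x a]] r(2) b(2) by (auto simp: z_def)
  hence "padic_integral (inverse z)" using padic_integral_dichotomy[OF z] by blast
  also have "inverse z = inverse x ^ b * ac_p powi (- (- a))"
    by (simp add: z_def power_int_minus power_inverse)
  finally have "of_int (- a) / real b \<in> ac_slopes (inverse x)" using b(1) by (intro ac_slopesI)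
  hence "- r \<le> ac_val (inverse x)" using ac_slopes_le_val[of "inverse x"] x b(2) by simp
  thus False using r(3) by simp
qed

text \<open>Superadditivity, applied also to the product of \<open>x * y\<close> and
  \<open>inverse y\<close>, gives the reverse inequality.\<close>

lemma ac_val_mult:
  fixes x y :: "'p :: prime_card padic alg_closure"
  assumes "x \<noteq> 0" "y \<noteq> 0"
  shows "ac_val (x * y) = ac_val x + ac_val y"
proof -
  have "ac_val (x * y) + ac_val (inverse y) \<le> ac_val (x * y * inverse y)"
    using assms by (intro ac_val_mult_ge) auto
  also have "x * y * inverse y = x" using assms by simp
  finally show ?thesis
    using ac_val_inverse_ge[OF assms(2)] ac_val_mult_ge[OF assms] by simp
qed

lemma ac_val_inverse: "x \<noteq> 0 \<Longrightarrow> ac_val (inverse x) = - ac_val x"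
  using ac_val_mult[of x "inverse x"] by (simp add: ac_val_1)

text \<open>A supremum equal to 0 alone would not show integrality. The second half of the dichotomy
  does: for non-integral \<open>x\<close> some \<open>1 / N\<close> is a slope of
  \<open>1 / x\<close>, so \<open>ac_val x\<close> is strictly negative.\<close>

lemma ac_val_nonneg_iff:
  fixes x :: "'p :: prime_card padic alg_closure"
  assumes x: "x \<noteq> 0"
  shows "ac_val x \<ge> 0 \<longleftrightarrow> padic_integral x"
proof
  assume "padic_integral x"
  hence "of_int 0 / real 1 \<in> ac_slopes x" by (intro ac_slopesI) auto
  thus "ac_val x \<ge> 0" using ac_slopes_le_val[OF x, of 0] by simp
next
  assume v: "ac_val x \<ge> 0"
  show "padic_integral x"
  proof (rule ccontr)
    assume "\<not> padic_integral x"
    then obtain N where N: "N > 0" "padic_integral (inverse x ^ N * inverse ac_p)"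
      using padic_integral_dichotomy[OF x] by blast
    hence "of_int 1 / real N \<in> ac_slopes (inverse x)"
      by (intro ac_slopesI) (auto simp: power_int_minus)
    hence "1 / real N \<le> - ac_val x"
      using ac_slopes_le_val[of "inverse x"] x ac_val_inverse[OF x] by fastforce
    moreover have "1 / real N > 0" using N by simp
    ultimately show False using v by linarith
  qed
qed

section \<open>From the valuation to the norm\<close>

definition ac_norm :: "'p :: prime_card padic alg_closure \<Rightarrow> real" where
  "ac_norm x = (if x = 0 then 0 else real CARD('p) powr (- ac_val x))"

lemma CARD_prime_gt_1: "real CARD('p :: prime_card) > 1"
  by (rule real_p_gt_1[OF prime_card])

lemma ac_norm_0 [simp]: "ac_norm (0 :: 'p :: prime_card padic alg_closure) = 0"
  by (simp add: ac_norm_def)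

lemma ac_norm_pos: "x \<noteq> 0 \<Longrightarrow> ac_norm (x :: 'p :: prime_card padic alg_closure) > 0"
  by (simp add: ac_norm_def)

lemma ac_norm_nonneg [simp]: "ac_norm (x :: 'p :: prime_card padic alg_closure) \<ge> 0"
  by (simp add: ac_norm_def)

lemma ac_norm_eq_0_iff [simp]: "ac_norm (x :: 'p :: prime_card padic alg_closure) = 0 \<longleftrightarrow> x = 0"
  by (simp add: ac_norm_def)

lemma ac_norm_mult: "ac_norm (x * y) = ac_norm x * ac_norm (y :: 'p :: prime_card padic alg_closure)"
  by (simp add: ac_norm_def ac_val_mult powr_add[symmetric])

lemma ac_norm_1 [simp]: "ac_norm (1 :: 'p :: prime_card padic alg_closure) = 1"
  by (simp add: ac_norm_def ac_val_1)

lemma ac_norm_le_1_iff: "ac_norm (x :: 'p :: prime_card padic alg_closure) \<le> 1 \<longleftrightarrow> padic_integral x"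
proof (cases "x = 0")
  case True
  thus ?thesis using padic_integral_of_nat[of 0, where 'p = 'p] by simp
next
  case False
  thus ?thesis using CARD_prime_gt_1[where 'p = 'p] ac_val_nonneg_iff[OF False]
      powr_le_cancel_iff[of "real CARD('p)" "- ac_val x" 0]
    by (simp add: ac_norm_def)
qed

lemma ac_norm_inverse: "ac_norm (inverse x) = inverse (ac_norm (x :: 'p :: prime_card padic alg_closure))"
  by (simp add: ac_norm_def ac_val_inverse powr_minus)

lemma ac_norm_divide: "ac_norm (x / y) = ac_norm x / ac_norm (y :: 'p :: prime_card padic alg_closure)"
  by (simp only: divide_inverse ac_norm_mult ac_norm_inverse)

lemma ac_norm_power: "ac_norm (x ^ n) = ac_norm (x :: 'p :: prime_card padic alg_closure) ^ n"
  by (induction n) (simp_all add: ac_norm_mult)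

lemma ac_norm_prod: "ac_norm (prod f A) = (\<Prod>i\<in>A. ac_norm (f i :: 'p :: prime_card padic alg_closure))"
  by (induction A rule: infinite_finite_induct) (simp_all add: ac_norm_mult)

lemma ac_norm_minus [simp]: "ac_norm (- x) = ac_norm (x :: 'p :: prime_card padic alg_closure)"
proof -
  have "ac_norm (- 1 :: 'p padic alg_closure) * ac_norm (- 1 :: 'p padic alg_closure) = 1"
    by (subst ac_norm_mult[symmetric]) simp
  hence "ac_norm (- 1 :: 'p padic alg_closure) ^ 2 = 1 ^ 2" by (simp add: power2_eq_square)
  hence "ac_norm (- 1 :: 'p padic alg_closure) = 1" by (rule power2_eq_imp_eq) simp_all
  thus ?thesis using ac_norm_mult[of "- 1" x] by simp
qed

text \<open>Dividing by the larger term reduces this to the closure of integral elements under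
  addition.\<close>

lemma ac_norm_ultrametric:
  fixes x y :: "'p :: prime_card padic alg_closure"
  shows "ac_norm (x + y) \<le> max (ac_norm x) (ac_norm y)"
proof -
  have *: "ac_norm (x + y) \<le> ac_norm y" if le: "ac_norm x \<le> ac_norm y" for x y :: "'p padic alg_closure"
  proof (cases "y = 0")
    case True
    thus ?thesis using le ac_norm_eq_0_iff[of x] ac_norm_nonneg[of x] by auto
  next
    case False
    have "ac_norm (x / y) \<le> 1" using le ac_norm_pos[OF False] by (simp add: ac_norm_divide)
    hence "ac_norm (x / y + 1) \<le> 1"
      unfolding ac_norm_le_1_iff using padic_integral_of_nat[of 1, where 'p = 'p]
      by (intro padic_integral_add) auto
    hence "ac_norm ((x / y + 1) * y) \<le> ac_norm y"
      unfolding ac_norm_mult using ac_norm_nonneg[of y] by (metis mult_right_mono mult_1)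
    moreover have "(x / y + 1) * y = x + y" using False by (simp add: field_simps)
    ultimately show ?thesis by simp
  qed
  show ?thesis
  proof (cases "ac_norm x \<le> ac_norm y")
    case True
    thus ?thesis using *[of x y] by simp
  next
    case False
    thus ?thesis using *[of y x] by (simp add: add.commute)
  qed
qed

lemma ac_norm_ultrametric_diff:
  "ac_norm (x - y) \<le> max (ac_norm x) (ac_norm (y :: 'p :: prime_card padic alg_closure))"
  using ac_norm_ultrametric[of x "- y"] by simp

lemma ac_norm_add_eq:
  fixes x y :: "'p :: prime_card padic alg_closure"
  assumes "ac_norm y < ac_norm x"
  shows "ac_norm (x + y) = ac_norm x"
  using ac_norm_ultrametric[of x y] ac_norm_ultrametric_diff[of "x + y" y] assms by simp

lemma ac_norm_sum_le:
  assumes "\<And>i. i \<in> A \<Longrightarrow> ac_norm (f i :: 'p :: prime_card padic alg_closure) \<le> B" "B \<ge> 0"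
  shows "ac_norm (sum f A) \<le> B"
  using assms
proof (induction A rule: infinite_finite_induct)
  case (insert i A)
  have "ac_norm (f i + sum f A) \<le> max (ac_norm (f i)) (ac_norm (sum f A))"
    by (rule ac_norm_ultrametric)
  also have "\<dots> \<le> B" using insert by auto
  finally show ?case using insert by simp
qed auto

lemma ac_norm_p: "ac_norm (ac_p :: 'p :: prime_card padic alg_closure) = 1 / real CARD('p)"
proof -
  let ?P = "ac_p :: 'p padic alg_closure"
  have one: "padic_integral (1 :: 'p padic alg_closure)"
    using padic_integral_of_nat[of 1, where 'p = 'p] by simp
  have "of_int 1 / real 1 \<in> ac_slopes ?P" using one by (intro ac_slopesI) (auto simp: power_int_minus)
  hence 1: "1 \<le> ac_val ?P" using ac_slopes_le_val[of ?P 1] by simp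
  have "of_int (- 1) / real 1 \<in> ac_slopes (inverse ?P)"
    using one by (intro ac_slopesI) auto
  hence "- 1 \<le> ac_val (inverse ?P)" using ac_slopes_le_val[of "inverse ?P" "- 1"] by simp
  hence "ac_val ?P = 1" using 1 ac_val_inverse[of ?P] by simp
  thus ?thesis using CARD_prime_gt_1[where 'p = 'p] by (simp add: ac_norm_def powr_minus field_simps)
qed

lemma ac_norm_of_int_le_1: "ac_norm (of_int k :: 'p :: prime_card padic alg_closure) \<le> 1"
  by (simp add: ac_norm_le_1_iff)

text \<open>Product formula for the places \<open>p\<close> and infinity: with
  \<open>k = p^m u\<close> the powers of \<open>p\<close> cancel, and \<open>u\<close> is a unit at
  \<open>p\<close> of ordinary absolute value at least 1.\<close>

lemma ac_norm_of_int_ge: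
  assumes "k \<noteq> 0"
  shows "1 \<le> ac_norm (of_int k :: 'p :: prime_card padic alg_closure) * \<bar>real_of_int k\<bar>"
proof -
  have p: "prime (int CARD('p))" using prime_card[where 'a = 'p] by simp
  obtain u where u: "k = int CARD('p) ^ multiplicity (int CARD('p)) k * u" "\<not> int CARD('p) dvd u"
    using multiplicity_decompose'[of k "int CARD('p)"] assms p not_prime_unit by blast
  define m where "m = multiplicity (int CARD('p)) k"
  have u0: "u \<noteq> 0" using u(1) assms by auto
  have "padic_norm (of_int u :: 'p padic) = 1"
    using u(2) u0 by (simp add: padic_norm_of_int padic_abs_of_int[OF prime_card] not_dvd_imp_multiplicity_0)
  hence "padic_integral (to_ac (inverse (of_int u) :: 'p padic))"
    by (simp only: padic_integral_to_ac_iff padic_norm_inverse) simp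
  hence "ac_norm (inverse (of_int u :: 'p padic alg_closure)) \<le> 1"
    by (simp add: ac_norm_le_1_iff)
  moreover have "0 < ac_norm (of_int u :: 'p padic alg_closure)" using u0 by (intro ac_norm_pos) simp
  ultimately have nu: "1 \<le> ac_norm (of_int u :: 'p padic alg_closure)"
    unfolding ac_norm_inverse by (simp add: field_simps)
  have "ac_norm (of_int k :: 'p padic alg_closure) = (1 / real CARD('p)) ^ m * ac_norm (of_int u :: 'p padic alg_closure)"
    by (subst u(1)) (simp add: ac_norm_mult ac_norm_power ac_norm_p m_def)
  moreover have "\<bar>real_of_int k\<bar> = real CARD('p) ^ m * \<bar>real_of_int u\<bar>"
    by (subst u(1)) (simp add: abs_mult m_def)
  ultimately have "ac_norm (of_int k :: 'p padic alg_closure) * \<bar>real_of_int k\<bar> =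
      ac_norm (of_int u :: 'p padic alg_closure) * \<bar>real_of_int u\<bar>"
    using CARD_prime_gt_1[where 'p = 'p] by (simp add: power_divide)
  moreover have "1 * 1 \<le> ac_norm (of_int u :: 'p padic alg_closure) * \<bar>real_of_int u\<bar>"
    using nu u0 by (intro mult_mono) auto
  ultimately show ?thesis by simp
qed

section \<open>Finite extensions and their residue fields\<close>

lemma ac_norm_to_ac_le:
  assumes "padic_norm (u :: 'p :: prime_card padic) < 1"
  shows "ac_norm (to_ac u) \<le> 1 / real CARD('p)"
proof -
  have "padic_integral (to_ac (u / of_nat CARD('p)))"
    unfolding padic_integral_to_ac_iff padic_norm_divide padic_norm_p
    using padic_norm_discrete[OF assms] by (simp add: field_simps)
  hence "ac_norm (to_ac u / ac_p) \<le> 1" by (simp add: ac_norm_le_1_iff)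
  thus ?thesis unfolding ac_norm_divide ac_norm_p by (simp add: field_simps)
qed

lemma ac_norm_of_int_dvd_le:
  assumes "int CARD('p) dvd k"
  shows "ac_norm (of_int k :: 'p :: prime_card padic alg_closure) \<le> 1 / real CARD('p)"
proof -
  obtain l where k: "k = int CARD('p) * l" using assms by blast
  have "ac_norm (of_int k :: 'p padic alg_closure) = 1 / real CARD('p) * ac_norm (of_int l :: 'p padic alg_closure)"
    by (simp add: k ac_norm_mult ac_norm_p)
  also have "\<dots> \<le> 1 / real CARD('p) * 1"
    by (intro mult_left_mono ac_norm_of_int_le_1) simp
  finally show ?thesis by simp
qed

lemma padic_closure_simps:
  "carrier (padic_closure :: 'p :: prime_card padic alg_closure ring) = UNIV"
  "\<zero>\<^bsub>padic_closure\<^esub> = (0 :: 'p padic alg_closure)" "\<one>\<^bsub>padic_closure\<^esub> = (1 :: 'p padic alg_closure)"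
  "x \<otimes>\<^bsub>padic_closure\<^esub> y = (x * y :: 'p padic alg_closure)"
  "x \<oplus>\<^bsub>padic_closure\<^esub> y = (x + y :: 'p padic alg_closure)"
  by (simp_all add: ring_of_type_algebra_def)

locale padic_extension =
  fixes K :: "'p :: prime_card padic alg_closure set"
  assumes finite_ext: "finite_padic_extension K"
begin

abbreviation "R \<equiv> (padic_closure :: 'p padic alg_closure ring)"

sublocale R: field R by (rule field_from_type_algebra)

lemma R_minus: "\<ominus>\<^bsub>R\<^esub> x = - x"
  by (rule R.minus_equality) (simp_all add: padic_closure_simps)

lemma R_inv: "x \<noteq> 0 \<Longrightarrow> inv\<^bsub>R\<^esub> x = inverse x"
  by (rule R.inv_unique'[symmetric]) (simp_all add: padic_closure_simps)

lemma subfield_K: "subfield K R"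
  using finite_ext by (simp add: finite_padic_extension_def)

lemma to_ac_in_K [simp]: "to_ac x \<in> K"
  using finite_ext by (auto simp: finite_padic_extension_def)

lemmas K_subring = subringE[OF subfieldE(1)[OF subfield_K]]

lemma K_0 [simp]: "0 \<in> K" and K_1 [simp]: "1 \<in> K"
  using K_subring(2,3) by (simp_all add: padic_closure_simps)

lemma K_add: "x \<in> K \<Longrightarrow> y \<in> K \<Longrightarrow> x + y \<in> K"
  using K_subring(7)[of x y] by (simp add: padic_closure_simps)

lemma K_mult: "x \<in> K \<Longrightarrow> y \<in> K \<Longrightarrow> x * y \<in> K"
  using K_subring(6)[of x y] by (simp add: padic_closure_simps)

lemma K_minus: "x \<in> K \<Longrightarrow> - x \<in> K"
  using K_subring(5)[of x] by (simp add: R_minus)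

lemma K_diff: "x \<in> K \<Longrightarrow> y \<in> K \<Longrightarrow> x - y \<in> K"
  using K_add[of x "- y"] K_minus by simp

lemma K_inverse: "x \<in> K \<Longrightarrow> inverse x \<in> K"
  using R.subfield_m_inv(1)[OF subfield_K, of x] R_inv[of x]
  by (cases "x = 0") (auto simp: padic_closure_simps)

lemma K_power: "x \<in> K \<Longrightarrow> x ^ n \<in> K"
  by (induction n) (auto intro: K_mult)

lemma K_sum: "(\<And>i. i \<in> A \<Longrightarrow> f i \<in> K) \<Longrightarrow> sum f A \<in> K"
  by (induction A rule: infinite_finite_induct) (auto intro: K_add)

lemma K_of_nat [simp]: "of_nat n \<in> K"
  using to_ac_in_K[of "of_nat n"] by simp

lemma K_of_int [simp]: "of_int n \<in> K"
  using to_ac_in_K[of "of_int n"] by simp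

section \<open>Dimension of \<open>K\<close> and its integers modulo powers of
  \<open>p\<close>\<close>

definition deg :: nat where "deg = padic_extension_degree K"

lemma combine_eq_sum:
  "R.combine ks us = (\<Sum>i<min (length ks) (length us). ks ! i * us ! i)"
proof (induction ks arbitrary: us)
  case (Cons k ks)
  show ?case
  proof (cases us)
    case (Cons u us')
    thus ?thesis using Cons.IH[of us']
      by (simp add: padic_closure_simps sum.lessThan_Suc_shift del: sum.lessThan_Suc)
  qed (simp add: padic_closure_simps)
qed (simp add: padic_closure_simps)

lemma subfield_range: "subfield (range to_ac) R"
proof (intro R.subfieldI' R.subringI)
  show "inv\<^bsub>R\<^esub> k \<in> range to_ac" if "k \<in> range to_ac - {\<zero>\<^bsub>R\<^esub>}" for k
    using that R_inv[of k] by (auto simp: padic_closure_simps simp flip: to_ac_inverse)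
  show "\<one>\<^bsub>R\<^esub> \<in> range to_ac"
    unfolding padic_closure_simps by (metis rangeI to_ac_1)
qed (auto simp: padic_closure_simps R_minus simp flip: to_ac_minus to_ac_add to_ac_mult)

text \<open>Turns the list-based dimension of HOL-Algebra into a linear relation indexed by numbers,
  with coefficients in the base type.\<close>

lemma dependent:
  assumes "\<And>i. i < N \<Longrightarrow> ys i \<in> K" "N > deg"
  obtains a :: "nat \<Rightarrow> 'p padic" and j where "(\<Sum>i<N. to_ac (a i) * ys i) = 0" "j < N" "a j \<noteq> 0"
proof (rule ccontr)
  assume no: "\<not> thesis"
  define us where "us = map ys [0..<N]"
  have us: "set us \<subseteq> K" "length us = N" using assms(1) by (auto simp: us_def)
  have "R.independent (range to_ac) us"
  proof (rule R.trivial_combine_imp_independent[OF subfield_range])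
    show "set us \<subseteq> carrier R" by (simp add: padic_closure_simps)
    fix ks assume ks: "set ks \<subseteq> range to_ac" "R.combine ks us = \<zero>\<^bsub>R\<^esub>"
    show "set (take (length us) ks) \<subseteq> {\<zero>\<^bsub>R\<^esub>}"
    proof
      fix k assume "k \<in> set (take (length us) ks)"
      then obtain j where j: "j < N" "j < length ks" "k = ks ! j"
        using us(2) by (auto simp: in_set_conv_nth)
      \<comment> \<open>\<open>R.combine\<close> stops at the shorter list, so missing coefficients
        count as 0.\<close>
      define a where "a = (\<lambda>i. if i < length ks then of_ac (ks ! i) else 0 :: 'p padic)"
      have a: "to_ac (a i) = ks ! i" if "i < length ks" for i
        using ks(1) that nth_mem[OF that] by (auto simp: a_def intro!: to_ac_of_ac)
      have "(\<Sum>i<N. to_ac (a i) * ys i) = (\<Sum>i<min (length ks) (length us). ks ! i * us ! i)"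
        using us(2) a by (intro sum.mono_neutral_cong_right) (auto simp: us_def a_def)
      also have "\<dots> = 0" using ks(2) by (simp add: combine_eq_sum padic_closure_simps)
      finally have "(\<Sum>i<N. to_ac (a i) * ys i) = 0" .
      hence "a j = 0" using no that j(1) by blast
      thus "k \<in> {\<zero>\<^bsub>R\<^esub>}" using a[OF j(2)] j(3) by (simp add: padic_closure_simps)
    qed
  qed
  moreover have "R.dimension deg (range to_ac) K"
    using R.finite_dimensionE[OF subfield_range, of K] finite_ext
    by (simp add: deg_def padic_extension_degree_def finite_padic_extension_def over_def)
  ultimately have "length us \<le> deg"
    using R.independent_length_le_dimension[OF subfield_range _ _ us(1)] by blast
  thus False using us(2) assms(2) by simp
qed

text \<open>Norm at most \<open>1 / p\<close> means divisible by \<open>p\<close>, so this is linear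
  independence over the field of \<open>p\<close> elements in the integers of \<open>K\<close>
  modulo \<open>p\<close>, phrased with integer coefficients.\<close>

definition p_independent :: "nat \<Rightarrow> (nat \<Rightarrow> 'p padic alg_closure) \<Rightarrow> bool" where
  "p_independent m y \<longleftrightarrow> (\<forall>i<m. y i \<in> K \<and> ac_norm (y i) \<le> 1) \<and>
     (\<forall>c :: nat \<Rightarrow> int. ac_norm (\<Sum>i<m. of_int (c i) * y i) \<le> 1 / real CARD('p) \<longrightarrow>
        (\<forall>i<m. int CARD('p) dvd c i))"

text \<open>A relation over the \<open>p\<close>-adic numbers, divided by its largest coefficient
  and reduced modulo \<open>p\<close>, is a relation with one coefficient equal to 1, which
  independence forbids.\<close>

lemma p_independent_le:
  assumes "p_independent m y"
  shows "m \<le> deg"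
proof (rule ccontr)
  assume "\<not> m \<le> deg"
  hence m: "m > deg" by simp
  have y: "y i \<in> K" "ac_norm (y i) \<le> 1" if "i < m" for i
    using assms that by (auto simp: p_independent_def)
  obtain a :: "nat \<Rightarrow> 'p padic" and j0 where a: "(\<Sum>i<m. to_ac (a i) * y i) = 0" "j0 < m" "a j0 \<noteq> 0"
    by (rule dependent[OF _ m, of y]) (auto intro: y)
  define M where "M = Max ((\<lambda>i. padic_norm (a i)) ` {..<m})"
  have "M \<in> (\<lambda>i. padic_norm (a i)) ` {..<m}" unfolding M_def using a(2) by (intro Max_in) auto
  then obtain j where j: "j < m" "M = padic_norm (a j)" by auto
  have M: "padic_norm (a i) \<le> M" if "i < m" for i unfolding M_def using that by (intro Max_ge) auto
  have "M > 0" using M[OF a(2)] padic_norm_pos[OF a(3)] by simp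
  hence aj: "a j \<noteq> 0" using j(2) by auto
  define b where "b = (\<lambda>i. a i / a j)"
  have b: "padic_norm (b i) \<le> 1" if "i < m" for i
    using M[OF that] \<open>M > 0\<close> by (simp add: b_def padic_norm_divide j(2)[symmetric])
  have "\<exists>c. \<forall>i\<in>{..<m}. c i < CARD('p) \<and> padic_norm (b i - of_nat (c i)) < 1"
    by (intro bchoice ballI) (use b padic_residue in \<open>metis lessThan_iff\<close>)
  then obtain c where c: "\<And>i. i < m \<Longrightarrow> c i < CARD('p)" "\<And>i. i < m \<Longrightarrow> padic_norm (b i - of_nat (c i)) < 1"
    by auto
  have "(\<Sum>i<m. to_ac (b i) * y i) = (\<Sum>i<m. to_ac (a i) * y i) / to_ac (a j)"
    by (simp add: b_def sum_divide_distrib)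
  hence b0: "(\<Sum>i<m. to_ac (b i) * y i) = 0" using a(1) by simp
  have "(\<Sum>i<m. of_int (int (c i)) * y i) = (\<Sum>i<m. to_ac (of_nat (c i) - b i) * y i) + (\<Sum>i<m. to_ac (b i) * y i)"
    by (simp add: sum.distrib[symmetric] algebra_simps)
  also have "ac_norm \<dots> \<le> 1 / real CARD('p)"
    unfolding b0 add_0_right
  proof (rule ac_norm_sum_le)
    fix i assume "i \<in> {..<m}"
    hence i: "i < m" by simp
    have "padic_norm (of_nat (c i) - b i) < 1"
      using c(2)[OF i] padic_norm_minus[of "b i - of_nat (c i)"] by simp
    hence "ac_norm (to_ac (of_nat (c i) - b i)) \<le> 1 / real CARD('p)" by (rule ac_norm_to_ac_le)
    hence "ac_norm (to_ac (of_nat (c i) - b i)) * ac_norm (y i) \<le> 1 / real CARD('p) * 1"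
      using y(2)[OF i] by (intro mult_mono) auto
    thus "ac_norm (to_ac (of_nat (c i) - b i) * y i) \<le> 1 / real CARD('p)" by (simp only: ac_norm_mult mult_1_right)
  qed simp
  finally have "int CARD('p) dvd int (c j)"
    using assms[unfolded p_independent_def, THEN conjunct2, rule_format, of "\<lambda>i. int (c i)" j] j(1) by simp
  hence "c j = 0" using c(1)[OF j(1)] by (auto dest: dvd_imp_le)
  moreover have "b j = 1" using aj by (simp add: b_def)
  ultimately show False using c(2)[OF j(1)] by simp
qed

text \<open>An independent family of maximal size spans modulo \<open>p\<close>; the maximum exists
  because the size is bounded by the degree.\<close>

lemma mod_p_generators:
  obtains m y where "m \<le> deg" "\<And>i. i < m \<Longrightarrow> y i \<in> K" "\<And>i. i < m \<Longrightarrow> ac_norm (y i) \<le> 1"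
    "\<And>z. z \<in> K \<Longrightarrow> ac_norm z \<le> 1 \<Longrightarrow>
       \<exists>c. (\<forall>i<m. c i < CARD('p)) \<and> ac_norm (z - (\<Sum>i<m. of_nat (c i) * y i)) \<le> 1 / real CARD('p)"
proof -
  let ?p = "int CARD('p)"
  let ?e = "1 / real CARD('p)"
  have p: "prime ?p" using prime_card[where 'a = 'p] by simp
  define A where "A = {m. \<exists>y. p_independent m y}"
  have "A \<subseteq> {..deg}" using p_independent_le by (auto simp: A_def)
  hence fin: "finite A" by (rule finite_subset) simp
  have "0 \<in> A" by (simp add: A_def p_independent_def)
  define m where "m = Max A"
  have "m \<in> A" unfolding m_def using \<open>0 \<in> A\<close> by (intro Max_in fin) auto
  then obtain y where y: "p_independent m y" by (auto simp: A_def)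
  have "Suc m \<notin> A" using Max_ge[OF fin, of "Suc m"] by (auto simp: m_def)
  hence maximal: "\<not> p_independent (Suc m) y'" for y' by (auto simp: A_def)
  have y1: "y i \<in> K" "ac_norm (y i) \<le> 1" if "i < m" for i
    using y that by (auto simp: p_independent_def)
  show ?thesis
  proof (rule that[of m y])
    show "m \<le> deg" using p_independent_le[OF y] .
    fix z assume z: "z \<in> K" "ac_norm z \<le> 1"
    define y' where "y' = y(m := z)"
    have y': "y' i = y i" if "i < m" for i using that by (simp add: y'_def)
    have "\<forall>i<Suc m. y' i \<in> K \<and> ac_norm (y' i) \<le> 1"
      using y1 z by (auto simp: y'_def less_Suc_eq)
    then obtain c :: "nat \<Rightarrow> int" and k where
      c: "ac_norm (\<Sum>i<Suc m. of_int (c i) * y' i) \<le> ?e" and k: "k < Suc m" "\<not> ?p dvd c k"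
      using maximal[of y'] unfolding p_independent_def by blast
    have S: "(\<Sum>i<Suc m. of_int (c i) * y' i) = (\<Sum>i<m. of_int (c i) * y i) + of_int (c m) * z"
      using y' by (simp add: y'_def)
    \<comment> \<open>Otherwise the relation would already hold among the \<open>y i\<close>, and
      independence would make every coefficient divisible.\<close>
    have ndvd: "\<not> ?p dvd c m"
    proof
      assume d: "?p dvd c m"
      have "ac_norm (of_int (c m) * z) \<le> ?e * 1"
        unfolding ac_norm_mult using ac_norm_of_int_dvd_le[OF d] z by (intro mult_mono) auto
      moreover have "(\<Sum>i<m. of_int (c i) * y i) = (\<Sum>i<Suc m. of_int (c i) * y' i) - of_int (c m) * z"
        unfolding S by simp
      ultimately have "ac_norm (\<Sum>i<m. of_int (c i) * y i) \<le> ?e"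
        using c ac_norm_ultrametric_diff[of "\<Sum>i<Suc m. of_int (c i) * y' i" "of_int (c m) * z"] by simp
      hence "\<forall>i<m. ?p dvd c i" using y unfolding p_independent_def by blast
      thus False using d k less_Suc_eq by auto
    qed
    hence "coprime (c m) ?p" using prime_imp_coprime[OF p ndvd] by (simp add: coprime_commute)
    then obtain e where e: "[c m * e = 1] (mod ?p)" using cong_solve_coprime_int by blast
    \<comment> \<open>The relation solved for \<open>z\<close> by means of the inverse
      \<open>e\<close> of \<open>c m\<close>, with coefficients reduced to the range from 0 to
      \<open>p - 1\<close>.\<close>
    define C where "C = (\<lambda>i. nat ((- (e * c i)) mod ?p))"
    have p0: "?p > 0" by simp
    have C: "int (C i) = (- (e * c i)) mod ?p" for i by (simp add: C_def)
    have "C i < CARD('p)" for i using pos_mod_bound[OF p0, of "- (e * c i)"] C[of i] by linarith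
    moreover have "ac_norm (z - (\<Sum>i<m. of_nat (C i) * y i)) \<le> ?e"
    proof -
      have "z - (\<Sum>i<m. of_nat (C i) * y i) =
              of_int (1 - c m * e) * z + (of_int e * (\<Sum>i<Suc m. of_int (c i) * y' i) -
              (\<Sum>i<m. of_int (int (C i) + e * c i) * y i))"
        unfolding S by (simp add: algebra_simps sum.distrib sum_distrib_left)
      also have "ac_norm \<dots> \<le> ?e"
      proof (intro order.trans[OF ac_norm_ultrametric] order.trans[OF ac_norm_ultrametric_diff] max.boundedI)
        have "?p dvd 1 - c m * e" using e by (simp add: cong_iff_dvd_diff dvd_diff_commute)
        hence "ac_norm (of_int (1 - c m * e) :: 'p padic alg_closure) \<le> ?e" by (rule ac_norm_of_int_dvd_le)
        hence "ac_norm (of_int (1 - c m * e) :: 'p padic alg_closure) * ac_norm z \<le> ?e * 1"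
          using z by (intro mult_mono) auto
        thus "ac_norm (of_int (1 - c m * e) * z) \<le> ?e" by (simp only: ac_norm_mult mult_1_right)
        have "ac_norm (of_int e :: 'p padic alg_closure) * ac_norm (\<Sum>i<Suc m. of_int (c i) * y' i) \<le> 1 * ?e"
          using c ac_norm_of_int_le_1 by (intro mult_mono) auto
        thus "ac_norm (of_int e * (\<Sum>i<Suc m. of_int (c i) * y' i)) \<le> ?e" by (simp only: ac_norm_mult mult_1)
        show "ac_norm (\<Sum>i<m. of_int (int (C i) + e * c i) * y i) \<le> ?e"
        proof (rule ac_norm_sum_le)
          fix i assume i: "i \<in> {..<m}"
          have "(int (C i) + e * c i) mod ?p = 0" unfolding C by (simp add: mod_simps)
          hence "ac_norm (of_int (int (C i) + e * c i) :: 'p padic alg_closure) \<le> ?e"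
            by (intro ac_norm_of_int_dvd_le) auto
          hence "ac_norm (of_int (int (C i) + e * c i) :: 'p padic alg_closure) * ac_norm (y i) \<le> ?e * 1"
            using y1(2)[of i] i by (intro mult_mono) auto
          thus "ac_norm (of_int (int (C i) + e * c i) * y i) \<le> ?e" by (simp only: ac_norm_mult mult_1_right)
        qed simp
      qed
      finally show ?thesis .
    qed
    ultimately show "\<exists>c. (\<forall>i<m. c i < CARD('p)) \<and> ac_norm (z - (\<Sum>i<m. of_nat (c i) * y i)) \<le> ?e"
      by blast
  qed (use y1 in auto)
qed

text \<open>A set separated at distance \<open>p\<^sup>-\<^sup>s\<close> consists of distinct residues modulo \<open>p\<^sup>s\<close>.\<close>

lemma card_separated_le:
  assumes T: "finite T" "T \<subseteq> K" "\<And>t. t \<in> T \<Longrightarrow> ac_norm t \<le> 1"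
    and sep: "\<And>t t'. t \<in> T \<Longrightarrow> t' \<in> T \<Longrightarrow> t \<noteq> t' \<Longrightarrow> ac_norm (t - t') > (1 / real CARD('p)) ^ s"
  shows "card T \<le> CARD('p) ^ (s * deg)"
proof -
  let ?e = "1 / real CARD('p)"
  obtain m y where y: "m \<le> deg" "\<And>i. i < m \<Longrightarrow> y i \<in> K" "\<And>i. i < m \<Longrightarrow> ac_norm (y i) \<le> 1"
    and gen: "\<And>z. z \<in> K \<Longrightarrow> ac_norm z \<le> 1 \<Longrightarrow>
       \<exists>c. (\<forall>i<m. c i < CARD('p)) \<and> ac_norm (z - (\<Sum>i<m. of_nat (c i) * y i)) \<le> ?e"
    by (rule mod_p_generators) blast
  \<comment> \<open>Base-\<open>p\<close> expansion: the remainder is divided by \<open>p^s\<close>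
    and approximated once more by the generators, which appends one digit to every
    coefficient.\<close>
  have digits: "\<exists>C. (\<forall>i<m. C i < CARD('p) ^ s) \<and> ac_norm (z - (\<Sum>i<m. of_nat (C i) * y i)) \<le> ?e ^ s"
    if z: "z \<in> K" "ac_norm z \<le> 1" for z
  proof (induction s)
    case 0
    show ?case using z by (intro exI[of _ "\<lambda>_. 0"]) simp
  next
    case (Suc s)
    then obtain C where C: "\<And>i. i < m \<Longrightarrow> C i < CARD('p) ^ s"
        "ac_norm (z - (\<Sum>i<m. of_nat (C i) * y i)) \<le> ?e ^ s" by blast
    define w where "w = (z - (\<Sum>i<m. of_nat (C i) * y i)) * inverse (ac_p ^ s)"
    have "w \<in> K" unfolding w_def using z y(2)
      by (intro K_mult K_diff K_sum K_inverse K_power) auto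
    moreover have "ac_norm w \<le> 1"
      using C(2) unfolding w_def ac_norm_mult ac_norm_inverse ac_norm_power ac_norm_p
      by (simp add: power_divide field_simps)
    ultimately obtain D where D: "\<And>i. i < m \<Longrightarrow> D i < CARD('p)"
        "ac_norm (w - (\<Sum>i<m. of_nat (D i) * y i)) \<le> ?e"
      using gen by blast
    have "C i + CARD('p) ^ s * D i < CARD('p) ^ Suc s" if "i < m" for i
    proof -
      have "C i + CARD('p) ^ s * D i < CARD('p) ^ s * Suc (D i)" using C(1)[OF that] by simp
      also have "\<dots> \<le> CARD('p) ^ s * CARD('p)" using D(1)[OF that] by (intro mult_le_mono) auto
      finally show ?thesis by (simp add: mult.commute)
    qed
    moreover have "z - (\<Sum>i<m. of_nat (C i + CARD('p) ^ s * D i) * y i) =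
        ac_p ^ s * (w - (\<Sum>i<m. of_nat (D i) * y i))"
      by (simp add: w_def algebra_simps sum.distrib sum_distrib_left)
    hence "ac_norm (z - (\<Sum>i<m. of_nat (C i + CARD('p) ^ s * D i) * y i)) =
        ?e ^ s * ac_norm (w - (\<Sum>i<m. of_nat (D i) * y i))"
      by (simp only: ac_norm_mult ac_norm_power ac_norm_p)
    hence "ac_norm (z - (\<Sum>i<m. of_nat (C i + CARD('p) ^ s * D i) * y i)) \<le> ?e ^ s * ?e"
      using mult_left_mono[OF D(2), of "?e ^ s"] by simp
    ultimately show ?case by (intro exI[of _ "\<lambda>i. C i + CARD('p) ^ s * D i"]) (simp add: mult.commute)
  qed
  have "\<exists>C. \<forall>t\<in>T. (\<forall>i<m. C t i < CARD('p) ^ s) \<and> ac_norm (t - (\<Sum>i<m. of_nat (C t i) * y i)) \<le> ?e ^ s"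
    by (intro bchoice ballI digits) (use T in auto)
  then obtain C where C: "\<And>t i. t \<in> T \<Longrightarrow> i < m \<Longrightarrow> C t i < CARD('p) ^ s"
      "\<And>t. t \<in> T \<Longrightarrow> ac_norm (t - (\<Sum>i<m. of_nat (C t i) * y i)) \<le> ?e ^ s"
    by blast
  define f where "f = (\<lambda>t. restrict (C t) {..<m})"
  have "inj_on f T"
  proof (rule inj_onI, rule ccontr)
    fix t t' assume t: "t \<in> T" "t' \<in> T" "f t = f t'" "t \<noteq> t'"
    have "C t i = C t' i" if "i < m" for i
      using fun_cong[OF t(3), of i] that by (simp add: f_def)
    hence "t - t' = (t - (\<Sum>i<m. of_nat (C t i) * y i)) - (t' - (\<Sum>i<m. of_nat (C t' i) * y i))"
      by simp
    hence "ac_norm (t - t') \<le> max (ac_norm (t - (\<Sum>i<m. of_nat (C t i) * y i)))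
        (ac_norm (t' - (\<Sum>i<m. of_nat (C t' i) * y i)))"
      by (simp only: ac_norm_ultrametric_diff)
    also have "\<dots> \<le> ?e ^ s" using C(2)[OF t(1)] C(2)[OF t(2)] by (rule max.boundedI)
    finally show False using sep[OF t(1,2,4)] by simp
  qed
  moreover have "f ` T \<subseteq> ({..<m} \<rightarrow>\<^sub>E {..<CARD('p) ^ s})" using C(1) by (auto simp: f_def split: if_splits)
  ultimately have "card T \<le> card ({..<m} \<rightarrow>\<^sub>E {..<CARD('p) ^ s})"
    by (intro card_inj_on_le[of f]) (auto intro: finite_PiE)
  also have "\<dots> = CARD('p) ^ (s * m)" by (simp add: card_PiE power_mult)
  also have "\<dots> \<le> CARD('p) ^ (s * deg)" using y(1) by (intro power_increasing) auto
  finally show ?thesis .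
qed

text \<open>
  The inequality \<open>e f \<le> n\<close>, stated without a uniformiser: for \<open>e\<close> digits from \<open>Rs\<close> the sums
  \<open>\<Sum>j<e. r\<^sub>j x\<^sup>j\<close> are distinct modulo a power of \<open>p\<close> of size about \<open>|x|\<^sup>e\<close>; let \<open>e\<close> tend to infinity.
\<close>

lemma card_residues_le:
  assumes Rs: "finite Rs" "Rs \<subseteq> K" "\<And>r. r \<in> Rs \<Longrightarrow> ac_norm r \<le> 1"
    and dist: "\<And>r r'. r \<in> Rs \<Longrightarrow> r' \<in> Rs \<Longrightarrow> r \<noteq> r' \<Longrightarrow> ac_norm (r - r') \<ge> 1"
    and x: "x \<in> K" "x \<noteq> 0" "ac_norm x < 1"
  shows "real (card Rs) * ac_norm x ^ deg \<le> 1"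
proof (rule ccontr)
  assume "\<not> real (card Rs) * ac_norm x ^ deg \<le> 1"
  hence big: "real (card Rs) * ac_norm x ^ deg > 1" by simp
  define \<rho> where "\<rho> = ac_norm x"
  have \<rho>: "0 < \<rho>" "\<rho> < 1" using ac_norm_pos[OF x(2)] x(3) by (simp_all add: \<rho>_def)
  let ?P = "real CARD('p)"
  have P: "?P > 1" by (rule CARD_prime_gt_1)
  \<comment> \<open>The right-hand side is independent of \<open>e\<close>; if the base exceeded 1,
    its powers would outgrow it.\<close>
  have bound: "(real (card Rs) * \<rho> ^ deg) ^ e \<le> ?P ^ deg" for e
  proof -
    define D where "D = {..<e} \<rightarrow>\<^sub>E Rs"
    define F where "F = (\<lambda>r. \<Sum>j<e. r j * x ^ j)"
    have finD: "finite D" unfolding D_def using Rs(1) by (intro finite_PiE) auto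
    have sep: "ac_norm (F r - F r') \<ge> \<rho> ^ e" if r: "r \<in> D" "r' \<in> D" "r \<noteq> r'" for r r'
    proof -
      have "\<exists>j. j < e \<and> r j \<noteq> r' j"
      proof (rule ccontr)
        assume "\<not> (\<exists>j. j < e \<and> r j \<noteq> r' j)"
        hence "r = r'" using r(1,2) unfolding D_def by (intro PiE_ext[of r _ _ r']) auto
        with r(3) show False ..
      qed
      \<comment> \<open>At the first differing digit the term has norm exactly
        \<open>\<rho> ^ j\<close>, and all later terms are strictly smaller.\<close>
      then obtain j where j: "j < e" "r j \<noteq> r' j" "\<And>i. i < j \<Longrightarrow> \<not> (i < e \<and> r i \<noteq> r' i)"
        using exists_least_iff[of "\<lambda>j. j < e \<and> r j \<noteq> r' j"] by blast
      have mem: "r i \<in> Rs" "r' i \<in> Rs" if "i < e" for i using r that by (auto simp: D_def)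
      have le1: "ac_norm (r i - r' i) \<le> 1" if "i < e" for i
        using ac_norm_ultrametric_diff[of "r i" "r' i"] Rs(3)[OF mem(1)[OF that]] Rs(3)[OF mem(2)[OF that]]
        by simp
      have "ac_norm (r j - r' j) = 1"
        using dist[OF mem(1)[OF j(1)] mem(2)[OF j(1)] j(2)] le1[OF j(1)] by simp
      hence lead: "ac_norm ((r j - r' j) * x ^ j) = \<rho> ^ j"
        by (simp add: ac_norm_mult ac_norm_power \<rho>_def)
      have rest: "ac_norm (\<Sum>i\<in>{..<e}-{j}. (r i - r' i) * x ^ i) \<le> \<rho> ^ Suc j"
      proof (rule ac_norm_sum_le)
        fix i assume i: "i \<in> {..<e} - {j}"
        show "ac_norm ((r i - r' i) * x ^ i) \<le> \<rho> ^ Suc j"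
        proof (cases "i < j")
          case True
          hence "r i = r' i" using j(3)[of i] i by auto
          thus ?thesis using \<rho> by simp
        next
          case False
          hence "Suc j \<le> i" using i by auto
          have "ac_norm (r i - r' i) * \<rho> ^ i \<le> 1 * \<rho> ^ Suc j"
            using le1[of i] i \<rho> \<open>Suc j \<le> i\<close> by (intro mult_mono power_decreasing) auto
          thus ?thesis by (simp add: ac_norm_mult ac_norm_power \<rho>_def)
        qed
      qed (use \<rho> in simp)
      have "\<rho> ^ Suc j < \<rho> ^ j" using \<rho> by simp
      have "F r - F r' = (\<Sum>i<e. (r i - r' i) * x ^ i)"
        by (simp add: F_def sum_subtractf left_diff_distrib)
      also have "\<dots> = (r j - r' j) * x ^ j + (\<Sum>i\<in>{..<e}-{j}. (r i - r' i) * x ^ i)"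
        using j(1) by (subst sum.remove[of _ j]) auto
      also have "ac_norm \<dots> = \<rho> ^ j"
        using rest \<open>\<rho> ^ Suc j < \<rho> ^ j\<close> by (subst ac_norm_add_eq) (simp_all only: lead)
      finally have "ac_norm (F r - F r') = \<rho> ^ j" .
      moreover have "\<rho> ^ e \<le> \<rho> ^ j" using j(1) \<rho> by (intro power_decreasing) auto
      ultimately show ?thesis by simp
    qed
    have injF: "inj_on F D"
    proof (rule inj_onI, rule ccontr)
      fix r r' assume "r \<in> D" "r' \<in> D" "F r = F r'" "r \<noteq> r'"
      thus False using sep[of r r'] zero_less_power[OF \<rho>(1), of e] by simp
    qed
    \<comment> \<open>Minimality of \<open>s\<close> keeps \<open>p^s \<rho>^e\<close> at most
      \<open>p\<close>: rounding to a power of \<open>p\<close> costs a factor that does not grow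
      with \<open>e\<close>.\<close>
    define s where "s = (LEAST s. (1 / ?P) ^ s < \<rho> ^ e)"
    have "\<exists>s. (1 / ?P) ^ s < \<rho> ^ e" using \<rho> P by (intro real_arch_pow_inv) auto
    hence s: "(1 / ?P) ^ s < \<rho> ^ e" unfolding s_def by (rule LeastI_ex)
    have "?P ^ s * \<rho> ^ e \<le> ?P"
    proof (cases s)
      case 0
      have "\<rho> ^ e \<le> 1" using \<rho> by (intro power_le_one) auto
      thus ?thesis using 0 P by simp
    next
      case (Suc s')
      hence "\<not> (1 / ?P) ^ s' < \<rho> ^ e" using not_less_Least[of s' "\<lambda>s. (1 / ?P) ^ s < \<rho> ^ e"] by (simp add: s_def)
      thus ?thesis using P by (simp add: Suc power_divide field_simps)
    qed
    have "card (F ` D) \<le> CARD('p) ^ (s * deg)"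
    proof (rule card_separated_le)
      show "finite (F ` D)" using finD by simp
      show "F ` D \<subseteq> K"
        using Rs(2) x(1) by (auto simp: F_def D_def intro!: K_sum K_mult K_power)
      fix t assume "t \<in> F ` D"
      then obtain r where r: "r \<in> D" "t = F r" by auto
      show "ac_norm t \<le> 1" unfolding r(2) F_def
      proof (rule ac_norm_sum_le)
        fix j assume "j \<in> {..<e}"
        hence "r j \<in> Rs" using r by (auto simp: D_def)
        hence "ac_norm (r j) * \<rho> ^ j \<le> 1 * 1" using Rs(3) \<rho> by (intro mult_mono power_le_one) auto
        thus "ac_norm (r j * x ^ j) \<le> 1" by (simp add: ac_norm_mult ac_norm_power \<rho>_def)
      qed simp
      fix t' assume "t' \<in> F ` D" "t \<noteq> t'"
      then obtain r' where "r' \<in> D" "t' = F r'" "r \<noteq> r'" using r by auto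
      thus "ac_norm (t - t') > (1 / ?P) ^ s" using sep[OF r(1), of r'] s r(2) by simp
    qed
    moreover have "card (F ` D) = card Rs ^ e"
      using card_image[OF injF] by (simp add: D_def card_PiE)
    ultimately have "card Rs ^ e \<le> CARD('p) ^ (s * deg)" by simp
    hence "real (card Rs) ^ e \<le> (?P ^ s) ^ deg" by (metis of_nat_le_iff of_nat_power power_mult)
    hence "real (card Rs) ^ e * (\<rho> ^ e) ^ deg \<le> (?P ^ s) ^ deg * (\<rho> ^ e) ^ deg"
      using \<rho> by (intro mult_right_mono) auto
    also have "\<dots> = (?P ^ s * \<rho> ^ e) ^ deg" by (simp add: power_mult_distrib)
    also have "\<dots> \<le> ?P ^ deg" using \<open>?P ^ s * \<rho> ^ e \<le> ?P\<close> \<rho> P by (intro power_mono) auto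
    finally show ?thesis by (simp add: power_mult_distrib power_mult[symmetric] mult.commute)
  qed
  obtain e where "?P ^ deg < (real (card Rs) * \<rho> ^ deg) ^ e"
    using real_arch_pow big unfolding \<rho>_def by blast
  thus False using bound[of e] by simp
qed

section \<open>The maximal ideal and the residue field\<close>

lemma carrier_ring_of_integers: "carrier (ring_of_integers K) = {x \<in> K. ac_norm x \<le> 1}"
  by (simp add: ring_of_integers_def ac_norm_le_1_iff)

text \<open>An integral element is invertible in the ring exactly when its norm is 1, because its
  inverse must be integral as well.\<close>

lemma maximal_ideal_eq: "maximal_ideal_of K = {x \<in> K. ac_norm x < 1}"
proof -
  have "x \<in> Units (ring_of_integers K) \<longleftrightarrow> x \<in> K \<and> ac_norm x = 1" for x
  proof
    assume "x \<in> Units (ring_of_integers K)"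
    then obtain y where xy: "x \<in> carrier (ring_of_integers K)" "y \<in> carrier (ring_of_integers K)" "x * y = 1"
      by (auto simp: Units_def ring_of_integers_def padic_closure_simps)
    hence "ac_norm x * ac_norm y = 1" by (metis ac_norm_1 ac_norm_mult)
    moreover have "ac_norm x * ac_norm y \<le> ac_norm x * 1"
      using xy by (intro mult_left_mono) (auto simp: carrier_ring_of_integers)
    ultimately show "x \<in> K \<and> ac_norm x = 1" using xy by (auto simp: carrier_ring_of_integers)
  next
    assume x: "x \<in> K \<and> ac_norm x = 1"
    hence x0: "x \<noteq> 0" by auto
    have "inverse x \<in> carrier (ring_of_integers K)"
      using x by (auto simp: carrier_ring_of_integers ac_norm_inverse intro: K_inverse)
    moreover have "x \<in> carrier (ring_of_integers K)" using x by (simp add: carrier_ring_of_integers)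
    moreover have "inverse x * x = 1" "x * inverse x = 1" using x0 by auto
    ultimately show "x \<in> Units (ring_of_integers K)"
      unfolding Units_def by (auto simp: ring_of_integers_def padic_closure_simps)
  qed
  hence U: "Units (ring_of_integers K) = {x \<in> K. ac_norm x = 1}" by blast
  show ?thesis unfolding maximal_ideal_of_def U carrier_ring_of_integers by auto
qed

definition residue :: "'p padic alg_closure \<Rightarrow> 'p padic alg_closure set" where
  "residue a = (\<lambda>h. h + a) ` maximal_ideal_of K"

lemma carrier_residue_field:
  "carrier (residue_field K) = residue ` {x \<in> K. ac_norm x \<le> 1}"
  unfolding residue_field_def FactRing_def
  by (simp add: A_RCOSETS_def' a_r_coset_def' residue_def ring_of_integers_def padic_closure_simps
      UNION_singleton_eq_range ac_norm_le_1_iff)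

lemma residue_eq_iff:
  assumes "a \<in> K" "b \<in> K"
  shows "residue a = residue b \<longleftrightarrow> ac_norm (a - b) < 1"
proof
  assume "residue a = residue b"
  moreover have "0 + a \<in> residue a" unfolding residue_def by (intro imageI) (simp add: maximal_ideal_eq)
  ultimately have "a \<in> residue b" by simp
  thus "ac_norm (a - b) < 1" by (auto simp: residue_def maximal_ideal_eq)
next
  have *: "residue a \<subseteq> residue b" if "a \<in> K" "b \<in> K" "ac_norm (a - b) < 1" for a b
  proof
    fix z assume "z \<in> residue a"
    then obtain h where h: "z = h + a" "h \<in> K" "ac_norm h < 1" by (auto simp: residue_def maximal_ideal_eq)
    have "ac_norm (h + (a - b)) < 1" using ac_norm_ultrametric[of h "a - b"] h that by simp
    hence "h + (a - b) \<in> maximal_ideal_of K"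
      using h that by (auto simp: maximal_ideal_eq intro: K_add K_diff)
    hence "(h + (a - b)) + b \<in> residue b" unfolding residue_def by blast
    thus "z \<in> residue b" using h by simp
  qed
  assume "ac_norm (a - b) < 1"
  moreover have "ac_norm (b - a) = ac_norm (a - b)" using ac_norm_minus[of "a - b"] by simp
  ultimately show "residue a = residue b" using *[of a b] *[of b a] assms by auto
qed

definition q :: nat where "q = card (carrier (residue_field K))"

text \<open>One representative per residue class gives integral elements at mutual distance at least
  1, so the count of residues applies.\<close>

lemma q_norm_power_le_1:
  assumes x: "x \<in> K" "x \<noteq> 0" "ac_norm x < 1"
  shows "real q * ac_norm x ^ deg \<le> 1"
proof (cases "finite (carrier (residue_field K))")
  \<comment> \<open>\<open>card\<close> of an infinite set is 0, so \<open>q = 0\<close>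
    here.\<close>
  case False
  thus ?thesis by (simp add: q_def)
next
  case True
  define rep where "rep = (\<lambda>c. SOME a. a \<in> K \<and> ac_norm a \<le> 1 \<and> residue a = c)"
  have rep: "rep c \<in> K" "ac_norm (rep c) \<le> 1" "residue (rep c) = c" if "c \<in> carrier (residue_field K)" for c
    using someI_ex[of "\<lambda>a. a \<in> K \<and> ac_norm a \<le> 1 \<and> residue a = c"] that
    unfolding rep_def carrier_residue_field by blast+
  have "real (card (rep ` carrier (residue_field K))) * ac_norm x ^ deg \<le> 1"
  proof (rule card_residues_le[OF _ _ _ _ x])
    fix r r' assume "r \<in> rep ` carrier (residue_field K)" "r' \<in> rep ` carrier (residue_field K)" "r \<noteq> r'"
    then obtain c c' where "c \<in> carrier (residue_field K)" "c' \<in> carrier (residue_field K)"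
        "r = rep c" "r' = rep c'" "c \<noteq> c'" by auto
    thus "ac_norm (r - r') \<ge> 1" using residue_eq_iff[of r r'] rep by force
  qed (use True rep in auto)
  moreover have "inj_on rep (carrier (residue_field K))" by (rule inj_on_inverseI[of _ residue]) (rule rep)
  ultimately show ?thesis by (simp add: card_image q_def)
qed

end

section \<open>The Bezout matrix and the Vandermonde determinant\<close>

text \<open>Ordered pairs of distinct indices split into those above and those below the diagonal.
  This connects products over all such pairs with the Vandermonde product.\<close>

lemma prod_off_diagonal:
  fixes g :: "nat \<Rightarrow> nat \<Rightarrow> 'a :: comm_monoid_mult"
  shows "(\<Prod>i<d. \<Prod>l\<in>{..<d}-{i}. g i l) = (\<Prod>k<d. \<Prod>l<k. g k l) * (\<Prod>k<d. \<Prod>l<k. g l k)"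
proof -
  have "(\<Prod>l\<in>{..<d}-{i}. g i l) = (\<Prod>l<i. g i l) * (\<Prod>l\<in>{l\<in>{..<d}. i < l}. g i l)"
    if "i < d" for i
  proof -
    have eq: "{..<d} - {i} = {..<i} \<union> {l\<in>{..<d}. i < l}" using that by auto
    show ?thesis unfolding eq by (rule prod.union_disjoint) auto
  qed
  hence "(\<Prod>i<d. \<Prod>l\<in>{..<d}-{i}. g i l) =
           (\<Prod>i<d. \<Prod>l<i. g i l) * (\<Prod>i<d. \<Prod>l\<in>{l\<in>{..<d}. i < l}. g i l)"
    by (simp add: prod.distrib)
  also have "(\<Prod>i<d. \<Prod>l\<in>{l\<in>{..<d}. i < l}. g i l) = (\<Prod>l<d. \<Prod>i\<in>{i\<in>{..<d}. i < l}. g i l)"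
    by (rule prod.swap_restrict) auto
  also have "\<dots> = (\<Prod>l<d. \<Prod>i<l. g i l)"
    by (intro prod.cong refl) auto
  finally show ?thesis .
qed

section \<open>The Vandermonde determinant\<close>

definition vandermonde_mat :: "nat \<Rightarrow> (nat \<Rightarrow> 'a :: comm_ring_1) \<Rightarrow> 'a mat" where
  "vandermonde_mat d x = mat d d (\<lambda>(i, j). x i ^ j)"

lemma vandermonde_mat_carrier [simp]: "vandermonde_mat d x \<in> carrier_mat d d"
  by (simp add: vandermonde_mat_def)

lemma dim_vandermonde_mat [simp]: "dim_row (vandermonde_mat d x) = d" "dim_col (vandermonde_mat d x) = d"
  by (simp_all add: vandermonde_mat_def)

text \<open>Right multiplication by the unitriangular matrix of coefficients of the Newton
  polynomials \<open>N k\<close> turns row \<open>i\<close> into the values of \<open>N k\<close> at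
  \<open>x i\<close>. These vanish for \<open>k > i\<close>, so the product is lower
  triangular.\<close>

lemma det_vandermonde_mat:
  fixes x :: "nat \<Rightarrow> 'a :: idom"
  shows "det (vandermonde_mat d x) = (\<Prod>k<d. \<Prod>l<k. x k - x l)"
proof -
  define N where "N = (\<lambda>k. \<Prod>l<k. [:- x l, 1:])"
  have deg: "degree (N k) = k" for k
    unfolding N_def by (subst degree_prod_eq_sum_degree) auto
  have lc: "coeff (N k) k = 1" for k
    using deg[of k] lead_coeff_prod[of "\<lambda>l. [:- x l, 1:]" "{..<k}"] by (simp add: N_def)
  define U where "U = mat d d (\<lambda>(j, k). coeff (N k) j)"
  have U: "U \<in> carrier_mat d d" by (simp add: U_def)
  have "upper_triangular U"
    unfolding upper_triangular_def U_def using deg by (auto intro!: coeff_eq_0)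
  hence "det U = (\<Prod>i = 0..<d. U $$ (i, i))"
    using U by (simp add: det_upper_triangular prod_list_diag_prod)
  also have "\<dots> = 1" using lc by (simp add: U_def)
  finally have detU: "det U = 1" .
  have entry: "(vandermonde_mat d x * U) $$ (i, k) = (\<Prod>l<k. x i - x l)" if "i < d" "k < d" for i k
  proof -
    have "(vandermonde_mat d x * U) $$ (i, k) = (\<Sum>j = 0..<d. x i ^ j * coeff (N k) j)"
      using that by (simp add: vandermonde_mat_def U_def scalar_prod_def)
    also have "\<dots> = (\<Sum>j\<le>k. coeff (N k) j * x i ^ j)"
      using that deg[of k] by (intro sum.mono_neutral_cong_right) (auto simp: coeff_eq_0)
    also have "\<dots> = poly (N k) (x i)" by (simp add: poly_altdef deg)
    also have "\<dots> = (\<Prod>l<k. x i - x l)" by (simp add: N_def poly_prod)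
    finally show ?thesis .
  qed
  have VU: "vandermonde_mat d x * U \<in> carrier_mat d d"
    by (rule mult_carrier_mat[OF vandermonde_mat_carrier U])
  have "det (vandermonde_mat d x * U) = prod_list (diag_mat (vandermonde_mat d x * U))"
    by (rule det_lower_triangular[OF _ VU]) (auto simp: entry)
  also have "\<dots> = (\<Prod>k = 0..<d. (vandermonde_mat d x * U) $$ (k, k))"
    using VU by (simp add: prod_list_diag_prod)
  also have "\<dots> = (\<Prod>k<d. \<Prod>l<k. x k - x l)"
    by (simp add: entry lessThan_atLeast0)
  finally show ?thesis
    using det_mult[OF vandermonde_mat_carrier U, of x] detU by simp
qed

text \<open>Coefficients of \<open>(f(x) g(y) - f(y) g(x)) / (x - y)\<close>, collected over the pairs of monomials.\<close>

definition bezout_term :: "nat \<Rightarrow> nat \<Rightarrow> nat \<Rightarrow> nat \<Rightarrow> int" where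
  "bezout_term m k j l = (if k \<le> j \<and> j < m \<and> j + l + 1 = m + k then 1 else 0)"

definition bezout_coeff :: "int poly \<Rightarrow> int poly \<Rightarrow> nat \<Rightarrow> nat \<Rightarrow> nat \<Rightarrow> int" where
  "bezout_coeff f g d j l = (\<Sum>m\<le>d. \<Sum>k\<le>d. coeff f m * coeff g k * (bezout_term m k j l - bezout_term k m j l))"

text \<open>After \<open>x^k y^k\<close> is factored out, the sum is the geometric one for
  \<open>x^(m-k) - y^(m-k)\<close>.\<close>

lemma sum_bezout_term:
  fixes x y :: "'a :: comm_ring_1"
  assumes "m \<le> d" "k \<le> m"
  shows "(\<Sum>j<d. \<Sum>l<d. of_int (bezout_term m k j l) * x ^ j * y ^ l) * (x - y) =
           x ^ m * y ^ k - x ^ k * y ^ m"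
proof -
  have inner: "(\<Sum>l<d. of_int (bezout_term m k j l) * x ^ j * y ^ l) =
          (if k \<le> j \<and> j < m then x ^ j * y ^ (m + k - Suc j) else 0)" for j
  proof (cases "k \<le> j \<and> j < m")
    case True
    have "(\<Sum>l<d. of_int (bezout_term m k j l) * x ^ j * y ^ l) =
            (\<Sum>l\<in>{m + k - Suc j}. of_int (bezout_term m k j l) * x ^ j * y ^ l)"
      using True assms by (intro sum.mono_neutral_right) (auto simp: bezout_term_def)
    also have "\<dots> = x ^ j * y ^ (m + k - Suc j)" using True by (auto simp: bezout_term_def)
    finally show ?thesis using True by simp
  qed (auto simp: bezout_term_def)
  have "(\<Sum>j<d. \<Sum>l<d. of_int (bezout_term m k j l) * x ^ j * y ^ l) =
          (\<Sum>j\<in>{k..<m}. x ^ j * y ^ (m + k - Suc j))"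
    unfolding inner using assms by (intro sum.mono_neutral_cong_right) auto
  also have "\<dots> = (\<Sum>i<m - k. x ^ (k + i) * y ^ (m - Suc i))"
    using assms by (intro sum.reindex_bij_witness[of _ "\<lambda>i. k + i" "\<lambda>j. j - k"]) auto
  also have "\<dots> = (\<Sum>i<m - k. (x ^ k * y ^ k) * (y ^ (m - k - Suc i) * x ^ i))"
  proof (intro sum.cong refl)
    fix i assume "i \<in> {..<m - k}"
    hence "m - Suc i = k + (m - k - Suc i)" by auto
    hence "y ^ (m - Suc i) = y ^ k * y ^ (m - k - Suc i)" by (metis power_add)
    thus "x ^ (k + i) * y ^ (m - Suc i) = (x ^ k * y ^ k) * (y ^ (m - k - Suc i) * x ^ i)"
      by (simp add: power_add ac_simps)
  qed
  also have "\<dots> = (x ^ k * y ^ k) * (\<Sum>i<m - k. y ^ (m - k - Suc i) * x ^ i)"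
    by (simp add: sum_distrib_left)
  also have "\<dots> * (x - y) = (x ^ k * y ^ k) * (x ^ (m - k) - y ^ (m - k))"
    by (simp add: power_diff_sumr2 ac_simps)
  also have "\<dots> = x ^ m * y ^ k - x ^ k * y ^ m"
  proof -
    have "x ^ m = x ^ k * x ^ (m - k)" "y ^ m = y ^ k * y ^ (m - k)"
      using assms by (simp_all flip: power_add)
    thus ?thesis by (simp add: algebra_simps)
  qed
  finally show ?thesis .
qed

lemma sum_bezout_term_diff:
  fixes x y :: "'a :: comm_ring_1"
  assumes "m \<le> d" "k \<le> d"
  shows "(\<Sum>j<d. \<Sum>l<d. of_int (bezout_term m k j l - bezout_term k m j l) * x ^ j * y ^ l) * (x - y) =
           x ^ m * y ^ k - x ^ k * y ^ m"
proof -
  have zero: "bezout_term a b j l = 0" if "a \<le> b" for a b j l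
    using that by (auto simp: bezout_term_def)
  consider "k \<le> m" | "m \<le> k" by linarith
  thus ?thesis
  proof cases
    case 1
    thus ?thesis using sum_bezout_term[OF assms(1) 1, of x y] by (simp add: zero)
  next
    case 2
    thus ?thesis using sum_bezout_term[OF assms(2) 2, of x y]
      by (simp add: zero sum_negf algebra_simps)
  qed
qed

text \<open>Multiplying by \<open>x - y\<close> avoids division of polynomials in two variables.
  Both sides are bilinear in the coefficients of \<open>f\<close> and \<open>g\<close>, which
  reduces the identity to pairs of monomials.\<close>

lemma bezout_coeff_sum:
  fixes x y :: "'a :: field_char_0"
  assumes "degree f \<le> d" "degree g \<le> d"
  shows "(\<Sum>j<d. \<Sum>l<d. of_int (bezout_coeff f g d j l) * x ^ j * y ^ l) * (x - y) =
           poly (map_poly of_int f) x * poly (map_poly of_int g) y -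
           poly (map_poly of_int f) y * poly (map_poly of_int g) x"
proof -
  have p: "poly (map_poly of_int h) z = (\<Sum>m\<le>d. of_int (coeff h m) * z ^ m)"
    if "degree h \<le> d" for h :: "int poly" and z :: 'a
    unfolding poly_altdef using that by (intro sum.mono_neutral_cong_left) (auto simp: coeff_eq_0)
  let ?b = "\<lambda>m k j l. of_int (bezout_term m k j l - bezout_term k m j l) :: 'a"
  have "(\<Sum>j<d. \<Sum>l<d. of_int (bezout_coeff f g d j l) * x ^ j * y ^ l) =
         (\<Sum>j<d. \<Sum>l<d. \<Sum>m\<le>d. \<Sum>k\<le>d. of_int (coeff f m) * of_int (coeff g k) * (?b m k j l * x ^ j * y ^ l))"
    by (simp add: bezout_coeff_def sum_distrib_right mult.assoc)
  also have "\<dots> = (\<Sum>j<d. \<Sum>m\<le>d. \<Sum>l<d. \<Sum>k\<le>d. of_int (coeff f m) * of_int (coeff g k) * (?b m k j l * x ^ j * y ^ l))"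
    by (intro sum.cong refl sum.swap)
  also have "\<dots> = (\<Sum>m\<le>d. \<Sum>j<d. \<Sum>k\<le>d. \<Sum>l<d. of_int (coeff f m) * of_int (coeff g k) * (?b m k j l * x ^ j * y ^ l))"
    by (subst sum.swap) (intro sum.cong refl sum.swap)
  also have "\<dots> = (\<Sum>m\<le>d. \<Sum>k\<le>d. \<Sum>j<d. \<Sum>l<d. of_int (coeff f m) * of_int (coeff g k) * (?b m k j l * x ^ j * y ^ l))"
    by (intro sum.cong refl sum.swap)
  finally have "(\<Sum>j<d. \<Sum>l<d. of_int (bezout_coeff f g d j l) * x ^ j * y ^ l) * (x - y) =
      (\<Sum>m\<le>d. \<Sum>k\<le>d. \<Sum>j<d. \<Sum>l<d. of_int (coeff f m) * of_int (coeff g k) * (?b m k j l * x ^ j * y ^ l)) * (x - y)"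
    by (rule arg_cong)
  also have "\<dots> = (\<Sum>m\<le>d. \<Sum>k\<le>d. of_int (coeff f m) * of_int (coeff g k) *
               ((\<Sum>j<d. \<Sum>l<d. ?b m k j l * x ^ j * y ^ l) * (x - y)))"
    by (simp only: sum_distrib_right sum_distrib_left mult.assoc)
  also have "\<dots> = (\<Sum>m\<le>d. \<Sum>k\<le>d. of_int (coeff f m) * of_int (coeff g k) * (x ^ m * y ^ k - x ^ k * y ^ m))"
    by (intro sum.cong refl arg_cong2[where f = "(*)"] sum_bezout_term_diff) auto
  also have "\<dots> = (\<Sum>m\<le>d. of_int (coeff f m) * x ^ m) * (\<Sum>k\<le>d. of_int (coeff g k) * y ^ k) -
                  (\<Sum>m\<le>d. of_int (coeff f m) * y ^ m) * (\<Sum>k\<le>d. of_int (coeff g k) * x ^ k)"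
    unfolding sum_product by (simp add: algebra_simps sum_subtractf)
  finally show ?thesis using assms by (simp add: p)
qed

lemma poly_pderiv_linear_mult: "poly (pderiv (p * [:- x, 1:])) x = poly p (x :: 'a :: idom)"
  by (simp add: pderiv_mult pderiv_pCons del: mult_pCons_right mult_pCons_left)

text \<open>With \<open>x\<close> a root of \<open>f\<close>, the double sum at
  \<open>(z, x)\<close> times \<open>z - x\<close> equals \<open>g(x) f(z)\<close> as a polynomial
  in \<open>z\<close>; differentiating at \<open>z = x\<close> recovers the value on the
  diagonal.\<close>

lemma bezout_coeff_sum_diag:
  fixes x :: "'a :: field_char_0"
  assumes "degree f \<le> d" "degree g \<le> d" "poly (map_poly of_int f) x = 0"
  shows "(\<Sum>j<d. \<Sum>l<d. of_int (bezout_coeff f g d j l) * x ^ j * x ^ l) =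
           poly (pderiv (map_poly of_int f)) x * poly (map_poly of_int g) x"
proof -
  define b where "b = (\<Sum>j<d. \<Sum>l<d. monom (of_int (bezout_coeff f g d j l) * x ^ l) j)"
  have b: "poly b z = (\<Sum>j<d. \<Sum>l<d. of_int (bezout_coeff f g d j l) * z ^ j * x ^ l)" for z
    by (simp add: b_def poly_sum poly_monom ac_simps)
  have "poly (b * [:- x, 1:]) z = poly (smult (poly (map_poly of_int g) x) (map_poly of_int f)) z" for z
    using bezout_coeff_sum[OF assms(1,2), of z x] assms(3) by (simp add: b algebra_simps)
  hence "b * [:- x, 1:] = smult (poly (map_poly of_int g) x) (map_poly of_int f)"
    by (subst poly_eq_poly_eq_iff[symmetric]) auto
  from arg_cong[OF this, of "\<lambda>p. poly (pderiv p) x"]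
  have "poly b x = poly (pderiv (map_poly of_int f)) x * poly (map_poly of_int g) x"
    by (simp only: poly_pderiv_linear_mult pderiv_smult poly_smult mult.commute)
  thus ?thesis by (simp add: b)
qed

text \<open>For distinct roots this is the square of the leading coefficient times the classical
  discriminant, in a form that is visibly an integer.\<close>

definition bezout_disc :: "int poly \<Rightarrow> int" where
  "bezout_disc f = det (mat (degree f) (degree f) (\<lambda>(j, l). bezout_coeff f (pderiv f) (degree f) j l))"

text \<open>The difference of the two sides has degree below \<open>d\<close> but vanishes at the
  \<open>d\<close> points \<open>x i\<close>.\<close>

lemma poly_eq_prod_roots:
  fixes f :: "'a :: idom poly"
  assumes "degree f = d" "inj_on x {..<d}" "\<And>i. i < d \<Longrightarrow> poly f (x i) = 0" "f \<noteq> 0"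
  shows "f = smult (lead_coeff f) (\<Prod>i<d. [:- x i, 1:])"
proof (rule ccontr)
  define h where "h = f - smult (lead_coeff f) (\<Prod>i<d. [:- x i, 1:])"
  assume "f \<noteq> smult (lead_coeff f) (\<Prod>i<d. [:- x i, 1:])"
  hence h: "h \<noteq> 0" by (simp add: h_def)
  have deg: "degree (\<Prod>i<d. [:- x i, 1:]) = d"
    by (subst degree_prod_eq_sum_degree) auto
  have lc: "coeff (\<Prod>i<d. [:- x i, 1:]) d = 1"
    using deg lead_coeff_prod[of "\<lambda>l. [:- x l, 1:]" "{..<d}"] by simp
  have "degree h \<le> d" unfolding h_def using assms(1) deg
    by (intro degree_diff_le) (auto intro: order.trans[OF degree_smult_le])
  moreover have "coeff h d = 0" using lc assms(1) by (simp add: h_def)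
  ultimately have "degree h < d"
    using h by (metis leading_coeff_0_iff order_le_less)
  moreover have "x ` {..<d} \<subseteq> {z. poly h z = 0}"
    using assms(3) by (auto simp: h_def poly_prod intro!: prod_zero)
  hence "card (x ` {..<d}) \<le> card {z. poly h z = 0}"
    by (intro card_mono poly_roots_finite h)
  hence "d \<le> degree h"
    using card_poly_roots_bound[OF h] assms(2) by (simp add: card_image)
  ultimately show False by simp
qed

text \<open>\<open>V B V^T\<close> evaluates the Bezout form at pairs of roots and is therefore
  diagonal with entries \<open>f'(x i)^2\<close>. Both ways of computing its determinant contain the
  square of \<open>det V\<close>, which is non-zero and cancels.\<close>

lemma bezout_disc_eq:
  fixes x :: "nat \<Rightarrow> 'a :: field_char_0"
  assumes "f \<noteq> 0" "inj_on x {..<degree f}"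
    and roots: "\<And>i. i < degree f \<Longrightarrow> poly (map_poly of_int f) (x i) = 0"
  shows "of_int (bezout_disc f) =
           of_int (lead_coeff f) ^ (2 * degree f) * det (vandermonde_mat (degree f) x) ^ 2"
proof -
  define d where "d = degree f"
  define a :: 'a where "a = of_int (lead_coeff f)"
  define F :: "'a poly" where "F = map_poly of_int f"
  define V where "V = vandermonde_mat d x"
  define B where "B = mat d d (\<lambda>(j, l). of_int (bezout_coeff f (pderiv f) d j l) :: 'a)"
  define c where "c = (\<lambda>i. a * (\<Prod>l\<in>{..<d}-{i}. x i - x l))"
  have V: "V \<in> carrier_mat d d" and B: "B \<in> carrier_mat d d"
    by (simp_all add: V_def B_def)
  have F: "degree F = d" "lead_coeff F = a" "F \<noteq> 0"
    using assms(1) by (simp_all add: F_def d_def a_def)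
  have rt: "poly F (x i) = 0" if "i < d" for i using roots that by (simp add: F_def d_def)
  have F_eq: "F = smult a (\<Prod>i<d. [:- x i, 1:])"
    using poly_eq_prod_roots[of F d x] F rt assms(2) by (simp add: d_def)
  have der: "poly (pderiv F) (x i) = c i" if "i < d" for i
  proof -
    have "(\<Prod>i<d. [:- x i, 1:]) = [:- x i, 1:] * (\<Prod>l\<in>{..<d}-{i}. [:- x l, 1:])"
      using that by (subst prod.remove[of _ i]) auto
    hence "F = smult a (\<Prod>l\<in>{..<d}-{i}. [:- x l, 1:]) * [:- x i, 1:]"
      using F_eq unfolding mult_smult_left by (metis mult.commute)
    hence "poly (pderiv F) (x i) = poly (smult a (\<Prod>l\<in>{..<d}-{i}. [:- x l, 1:])) (x i)"
      by (simp only: poly_pderiv_linear_mult)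
    also have "\<dots> = c i" by (simp add: c_def poly_prod)
    finally show ?thesis .
  qed
  have pd: "map_poly of_int (pderiv f) = pderiv F"
    by (simp add: F_def of_int_hom.map_poly_pderiv)
  have deg': "degree (pderiv f) \<le> d" by (simp add: d_def degree_pderiv)
  have entry: "(V * B * transpose_mat V) $$ (i, k) = (if i = k then c i ^ 2 else 0)"
    if "i < d" "k < d" for i k
  proof -
    have "(V * B * transpose_mat V) $$ (i, k) =
            (\<Sum>l = 0..<d. (\<Sum>j = 0..<d. x i ^ j * of_int (bezout_coeff f (pderiv f) d j l)) * x k ^ l)"
      using that by (simp add: V_def B_def vandermonde_mat_def scalar_prod_def)
    also have "\<dots> = (\<Sum>j<d. \<Sum>l<d. of_int (bezout_coeff f (pderiv f) d j l) * x i ^ j * x k ^ l)"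
      unfolding lessThan_atLeast0 sum_distrib_right by (subst sum.swap) (simp add: ac_simps)
    also have "\<dots> = (if i = k then c i ^ 2 else 0)"
    proof (cases "i = k")
      case True
      thus ?thesis
        using bezout_coeff_sum_diag[of f d "pderiv f" "x i"] deg' rt that der
        by (simp add: d_def[symmetric] F_def[symmetric] pd power2_eq_square)
    next
      case False
      have "x i \<noteq> x k" using assms(2) that False by (auto simp: inj_on_def d_def)
      moreover have "(\<Sum>j<d. \<Sum>l<d. of_int (bezout_coeff f (pderiv f) d j l) * x i ^ j * x k ^ l) * (x i - x k) = 0"
        using bezout_coeff_sum[of f d "pderiv f" "x i" "x k"] deg' rt that
        by (simp add: d_def[symmetric] F_def[symmetric])
      ultimately show ?thesis using False by simp
    qed
    finally show ?thesis .
  qed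
  have M: "V * B * transpose_mat V \<in> carrier_mat d d" using V B by simp
  have "det (V * B * transpose_mat V) = prod_list (diag_mat (V * B * transpose_mat V))"
    by (rule det_lower_triangular[OF _ M]) (auto simp: entry)
  also have "\<dots> = (\<Prod>k = 0..<d. (V * B * transpose_mat V) $$ (k, k))"
    by (simp only: prod_list_diag_prod carrier_matD(1)[OF M])
  also have "\<dots> = (\<Prod>k<d. c k ^ 2)" by (simp add: entry lessThan_atLeast0)
  also have "\<dots> = (\<Prod>k<d. c k) ^ 2" by (simp add: prod_power_distrib)
  also have "(\<Prod>k<d. c k) = a ^ d * (\<Prod>i<d. \<Prod>l\<in>{..<d}-{i}. x i - x l)"
    by (simp add: c_def prod.distrib)
  also have "(\<Prod>i<d. \<Prod>l\<in>{..<d}-{i}. x i - x l) = det V * (\<Prod>k<d. \<Prod>l<k. x l - x k)"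
    unfolding prod_off_diagonal by (simp add: V_def det_vandermonde_mat)
  also have "(a ^ d * (det V * (\<Prod>k<d. \<Prod>l<k. x l - x k))) ^ 2 =
               a ^ (2 * d) * det V ^ 2 * (\<Prod>k<d. \<Prod>l<k. (x l - x k) ^ 2)"
    by (simp add: power_mult_distrib prod_power_distrib power_mult[symmetric] mult.commute)
  also have "(\<Prod>k<d. \<Prod>l<k. (x l - x k) ^ 2) = det V ^ 2"
    by (simp add: V_def det_vandermonde_mat prod_power_distrib[symmetric] power2_commute)
  finally have 1: "det (V * B * transpose_mat V) = a ^ (2 * d) * det V ^ 2 * det V ^ 2" .
  have "det (V * B * transpose_mat V) = det V * det B * det V"
    using det_mult[OF mult_carrier_mat[OF V B] transpose_carrier_mat[THEN iffD2, OF V]]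
      det_mult[OF V B] det_transpose[OF V] by simp
  moreover have "det V \<noteq> 0"
  proof -
    have "x k - x l \<noteq> 0" if "k < d" "l < k" for k l
      using inj_onD[OF assms(2), of k l] that by (auto simp: d_def)
    thus ?thesis unfolding V_def det_vandermonde_mat by simp
  qed
  ultimately have "det B = a ^ (2 * d) * det V ^ 2"
    using 1 by (simp add: power2_eq_square)
  moreover have "B = map_mat of_int (mat d d (\<lambda>(j, l). bezout_coeff f (pderiv f) d j l))"
    by (auto simp: B_def)
  ultimately show ?thesis
    by (simp add: bezout_disc_def d_def a_def V_def of_int_hom.hom_det)
qed

text \<open>The column exponents are at most \<open>d - 1\<close>; the exponent \<open>d\<close> is
  taken so that the bound combines with the factor \<open>a^(2d)\<close> into a power of the Mahler
  measure.\<close>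

lemma norm_det_vandermonde_mat_le:
  fixes x :: "nat \<Rightarrow> complex"
  shows "cmod (det (vandermonde_mat d x)) \<le> fact d * (\<Prod>i<d. max 1 (cmod (x i))) ^ d"
proof -
  let ?P = "{p. p permutes {0..<d}}"
  have "cmod (det (vandermonde_mat d x)) =
          cmod (\<Sum>p\<in>?P. signof p * (\<Prod>i = 0..<d. vandermonde_mat d x $$ (i, p i)))"
    by (subst det_def'[of _ d]) auto
  also have "\<dots> \<le> (\<Sum>p\<in>?P. cmod (signof p * (\<Prod>i = 0..<d. vandermonde_mat d x $$ (i, p i))))"
    by (rule norm_sum)
  also have "\<dots> \<le> (\<Sum>p\<in>?P. (\<Prod>i<d. max 1 (cmod (x i))) ^ d)"
  proof (intro sum_mono)
    fix p assume p: "p \<in> ?P"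
    have pd: "p i < d" if "i < d" for i
      using p that permutes_in_image[of p "{0..<d}" i] by simp
    have "cmod (signof p * (\<Prod>i = 0..<d. vandermonde_mat d x $$ (i, p i))) =
            (\<Prod>i<d. cmod (x i) ^ p i)"
      using pd by (auto simp: norm_mult prod_norm[symmetric] vandermonde_mat_def sign_def norm_power
          lessThan_atLeast0 intro!: prod.cong)
    also have "\<dots> \<le> (\<Prod>i<d. max 1 (cmod (x i)) ^ d)"
    proof (intro prod_mono conjI)
      fix i assume "i \<in> {..<d}"
      hence "p i \<le> d" using pd[of i] by simp
      have "cmod (x i) ^ p i \<le> max 1 (cmod (x i)) ^ p i" by (intro power_mono) auto
      also have "\<dots> \<le> max 1 (cmod (x i)) ^ d" using \<open>p i \<le> d\<close> by (intro power_increasing) auto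
      finally show "cmod (x i) ^ p i \<le> max 1 (cmod (x i)) ^ d" .
    qed auto
    finally show "cmod (signof p * (\<Prod>i = 0..<d. vandermonde_mat d x $$ (i, p i))) \<le>
                    (\<Prod>i<d. max 1 (cmod (x i))) ^ d"
      by (simp add: prod_power_distrib)
  qed
  also have "\<dots> = fact d * (\<Prod>i<d. max 1 (cmod (x i))) ^ d"
    by (simp add: card_permutations)
  finally show ?thesis .
qed

section \<open>Algebraic numbers and their conjugates\<close>

interpretation rat_int: integral_extension "of_rat :: rat \<Rightarrow> complex" UNIV
  by unfold_locales (auto simp: of_rat_add of_rat_mult of_rat_minus)

text \<open>Transfers closure under sums and products from integral elements to algebraic
  numbers.\<close>

lemma integral_of_rat_iff_algebraic: "rat_int.integral x \<longleftrightarrow> algebraic x"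
proof
  assume "rat_int.integral x"
  then obtain f where f: "lead_coeff f = 1" "poly (map_poly of_rat f) x = 0"
    unfolding rat_int.integral_def by blast
  have "coeff (map_poly of_rat f :: complex poly) (degree f) = 1" using f(1) by (simp add: coeff_map_poly)
  hence "map_poly of_rat f \<noteq> (0 :: complex poly)" by auto
  thus "algebraic x"
    unfolding algebraic_altdef using f(2)
    by (intro exI[of _ "map_poly of_rat f"]) (auto simp: coeff_map_poly)
next
  assume "algebraic x"
  then obtain p where p: "\<And>i. coeff p i \<in> \<int>" "p \<noteq> 0" "poly p x = 0"
    unfolding algebraic_def by blast
  define n where "n = degree p"
  have lc: "coeff p n \<noteq> 0" using p(2) by (simp add: n_def)
  have n0: "n > 0"
  proof (rule ccontr)
    assume "\<not> n > 0"
    thus False using p(3) lc by (simp add: poly_altdef n_def)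
  qed
  have "\<exists>r. of_rat r = - (coeff p i / coeff p n)" for i
  proof -
    have "coeff p i \<in> \<rat>" "coeff p n \<in> \<rat>" using p(1) Ints_subset_Rats by blast+
    hence "- (coeff p i / coeff p n) \<in> \<rat>" by simp
    then obtain r where "- (coeff p i / coeff p n) = of_rat r" by (rule Rats_cases)
    thus ?thesis by metis
  qed
  then obtain c where c: "\<And>i. of_rat (c i) = - (coeff p i / coeff p n)" by metis
  have "coeff p n * x ^ n + (\<Sum>i<n. coeff p i * x ^ i) = 0"
    using p(3) by (simp add: poly_altdef n_def lessThan_Suc_atMost[symmetric] add.commute)
  hence "coeff p n * x ^ n = - (\<Sum>i<n. coeff p i * x ^ i)" by (simp add: eq_neg_iff_add_eq_0)
  hence "x ^ n = (\<Sum>i<n. of_rat (c i) * x ^ i)"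
    using lc by (simp add: c sum_negf sum_divide_distrib[symmetric] field_simps)
  thus "rat_int.integral x" using n0 by (intro rat_int.integralI) auto
qed

lemmas algebraic_add = rat_int.integral_add_mult(1)[unfolded integral_of_rat_iff_algebraic]
lemmas algebraic_mult = rat_int.integral_add_mult(2)[unfolded integral_of_rat_iff_algebraic]

lemma algebraic_of_int_complex: "algebraic (of_int k :: complex)"
  using rat_int.integral_hom[of "of_int k"] by (simp add: integral_of_rat_iff_algebraic)

section \<open>Conjugates and their images under the embedding\<close>

lemma algebraic_root_int_poly:
  assumes "f \<noteq> 0" "poly (map_poly of_int f) (x :: complex) = 0"
  shows "algebraic x"
  unfolding algebraic_def using assms
  by (intro exI[of _ "map_poly of_int f"]) (auto simp: coeff_map_poly)

lemma degree_min_int_poly_pos: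
  assumes "algebraic \<alpha>"
  shows "degree (min_int_poly \<alpha>) > 0"
proof (rule ccontr)
  assume *: "\<not> degree (min_int_poly \<alpha>) > 0"
  then obtain c where c: "min_int_poly \<alpha> = [:c:]" by (auto elim: degree_eq_zeroE)
  have "is_min_int_poly \<alpha> (min_int_poly \<alpha>)" by (rule is_min_int_poly_min_int_poly[OF assms])
  thus False using c by (auto simp: is_min_int_poly_def)
qed

text \<open>
  If \<open>\<beta>\<close> were a multiple root, its minimal polynomial would divide \<open>f\<close> up to a constant and have
  smaller degree than \<open>f\<close>, so \<open>\<alpha>\<close> would be a root of a polynomial of smaller degree.
\<close>

lemma min_int_poly_simple_roots:
  assumes \<alpha>: "algebraic \<alpha>" and \<beta>: "poly (map_poly of_int (min_int_poly \<alpha>)) \<beta> = 0"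
  shows "poly (pderiv (map_poly of_int (min_int_poly \<alpha>))) (\<beta> :: complex) \<noteq> 0"
proof
  define f where "f = min_int_poly \<alpha>"
  assume "poly (pderiv (map_poly of_int (min_int_poly \<alpha>))) \<beta> = 0"
  hence der: "poly (map_poly of_int (pderiv f)) \<beta> = 0" by (simp add: f_def of_int_hom.map_poly_pderiv)
  have f: "is_min_int_poly \<alpha> f" unfolding f_def by (rule is_min_int_poly_min_int_poly[OF \<alpha>])
  hence f0: "f \<noteq> 0" by (simp add: is_min_int_poly_def)
  have d0: "degree f > 0" unfolding f_def by (rule degree_min_int_poly_pos[OF \<alpha>])
  have \<beta>': "poly (map_poly of_int f) \<beta> = 0" using \<beta> by (simp add: f_def)
  have alg: "algebraic \<beta>" by (rule algebraic_root_int_poly[OF f0 \<beta>'])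
  define g where "g = min_int_poly \<beta>"
  have g: "is_min_int_poly \<beta> g" unfolding g_def by (rule is_min_int_poly_min_int_poly[OF alg])
  hence g0: "g \<noteq> 0" by (simp add: is_min_int_poly_def)
  have "pderiv f \<noteq> 0" using d0 by (simp add: pderiv_eq_0_iff)
  hence "degree g \<le> degree (pderiv f)" using g der unfolding is_min_int_poly_def by blast
  hence gf: "degree g < degree f" using d0 by (simp add: degree_pderiv)
  \<comment> \<open>Pseudo-division keeps quotient and remainder over the integers, at the price of
    the factor \<open>c\<close>, a power of the leading coefficient of \<open>g\<close>.\<close>
  obtain k r where kr: "pseudo_divmod f g = (k, r)" by force
  define c where "c = coeff g (degree g) ^ (Suc (degree f) - degree g)"
  have c0: "c \<noteq> 0" using g0 by (simp add: c_def)
  have eq: "smult c f = g * k + r" and r: "r = 0 \<or> degree r < degree g"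
    using pseudo_divmod[OF g0 kr] by (simp_all add: c_def)
  have ev: "of_int c * poly (map_poly of_int f) z =
      poly (map_poly of_int g) z * poly (map_poly of_int k) z + poly (map_poly of_int r) z" for z :: complex
    using arg_cong[OF eq, of "\<lambda>p. poly (map_poly of_int p) z"]
    by (simp add: of_int_hom.map_poly_hom_smult of_int_poly_hom.hom_add of_int_poly_hom.hom_mult)
  have g\<beta>: "poly (map_poly of_int g) \<beta> = 0" using g by (simp add: is_min_int_poly_def)
  have "poly (map_poly of_int r) \<beta> = 0" using ev[of \<beta>] \<beta>' g\<beta> by simp
  hence r0: "r = 0" using r g unfolding is_min_int_poly_def by (meson not_less)
  have k0: "k \<noteq> 0" using eq r0 c0 f0 by auto
  have "degree f = degree g + degree k"
    using arg_cong[OF eq, of degree] r0 c0 g0 k0 by (simp add: degree_mult_eq)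
  moreover have "degree g > 0" unfolding g_def by (rule degree_min_int_poly_pos[OF alg])
  ultimately have kf: "degree k < degree f" by simp
  have "poly (map_poly of_int f) \<alpha> = 0" using f by (simp add: is_min_int_poly_def)
  hence "poly (map_poly of_int g) \<alpha> = 0 \<or> poly (map_poly of_int k) \<alpha> = 0"
    using ev[of \<alpha>] r0 by simp
  thus False using f gf kf g0 k0 unfolding is_min_int_poly_def by (meson not_less)
qed

lemma card_galois_conjugates:
  assumes "algebraic \<alpha>"
  shows "finite (galois_conjugates \<alpha>)" "card (galois_conjugates \<alpha>) = alg_degree \<alpha>"
proof -
  define F :: "complex poly" where "F = map_poly of_int (min_int_poly \<alpha>)"
  have f: "is_min_int_poly \<alpha> (min_int_poly \<alpha>)" by (rule is_min_int_poly_min_int_poly[OF assms])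
  hence F0: "F \<noteq> 0" by (simp add: is_min_int_poly_def F_def)
  have conj: "galois_conjugates \<alpha> = {z. poly F z = 0}" by (simp add: galois_conjugates_def F_def)
  show "finite (galois_conjugates \<alpha>)" unfolding conj by (rule poly_roots_finite[OF F0])
  have "rsquarefree F"
    unfolding rsquarefree_roots using min_int_poly_simple_roots[OF assms] by (auto simp: F_def)
  hence "card {z. poly F z = 0} = degree F" using rsquarefree_card_degree[OF F0] by simp
  thus "card (galois_conjugates \<alpha>) = alg_degree \<alpha>" by (simp add: conj alg_degree_def F_def)
qed

text \<open>Horner induction, carried out together with the algebraicity of the value, since
  \<open>i\<close> respects the operations on algebraic numbers only.\<close>

lemma Qbar_embedding_poly:
  fixes i :: "complex \<Rightarrow> 'p :: prime_card padic alg_closure"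
  assumes i: "Qbar_embedding i" and x: "algebraic x"
  shows "i (poly (map_poly of_int f) x) = poly (map_poly of_int f) (i x)"
proof -
  have hom: "i (y * z) = i y * i z" "i (y + z) = i y + i z" "i 1 = 1"
    if "algebraic y" "algebraic z" for y z
    using i that unfolding Qbar_embedding_def Ring.ring_hom_def
    by (auto simp: ring_of_type_algebra_def)
  have alg1: "algebraic (1 :: complex)" using algebraic_of_int_complex[of 1] by simp
  have alg0: "algebraic (0 :: complex)" using algebraic_of_int_complex[of 0] by simp
  have i0: "i 0 = 0" using hom(2)[OF alg0 alg0] by simp
  have nat: "i (of_nat n) = of_nat n" for n
  proof (induction n)
    case (Suc n)
    have "i (1 + of_nat n) = 1 + of_nat n"
      using hom(2)[OF alg1, of "of_nat n"] hom(3)[OF alg1 alg1] algebraic_of_int_complex[of "int n"] Suc by simp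
    thus ?case by simp
  qed (simp add: i0)
  have int: "i (of_int k) = of_int k" for k
  proof (cases k rule: int_cases2)
    case (nonpos n)
    have "i (of_nat n + of_int k) = of_nat n + i (of_int k)"
      using hom(2)[of "of_nat n" "of_int k"] algebraic_of_int_complex[of "int n"]
        algebraic_of_int_complex[of k] nat[of n] by simp
    hence "of_nat n + i (of_int k) = 0" using nonpos i0 by simp
    hence "i (of_int k) = - of_nat n" by (simp add: add_eq_0_iff)
    thus ?thesis using nonpos by simp
  qed (simp add: nat)
  have "algebraic (poly (map_poly of_int f) x) \<and> i (poly (map_poly of_int f) x) = poly (map_poly of_int f) (i x)"
  proof (induction f)
    case 0
    show ?case using alg0 i0 by simp
  next
    case (pCons a f)
    have eq: "poly (map_poly of_int (pCons a f)) z = of_int a + z * poly (map_poly of_int f) z"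
      for z :: "'z :: comm_ring_1" by (simp add: of_int_hom.map_poly_pCons_hom)
    have am: "algebraic (x * poly (map_poly of_int f) x)" using pCons x by (intro algebraic_mult) auto
    show ?case
      unfolding eq using pCons hom(2)[OF algebraic_of_int_complex am, of a] hom(1)[OF x]
        algebraic_add[OF algebraic_of_int_complex am, of a] int[of a] by simp
  qed
  thus ?thesis ..
qed

text \<open>A Gauss norm argument: multiplication by \<open>X - x\<close> scales the largest coefficient by \<open>max 1 |x|\<close>.\<close>

lemma ac_gauss_step:
  fixes g :: "'p :: prime_card padic alg_closure poly"
  assumes "ac_norm (coeff g k) \<ge> B" "B > 0"
  obtains j where "ac_norm (coeff ([:- x, 1:] * g) j) \<ge> max 1 (ac_norm x) * B"
proof -
  define M where "M = Max ((\<lambda>i. ac_norm (coeff g i)) ` {..degree g})"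
  have "M \<in> (\<lambda>i. ac_norm (coeff g i)) ` {..degree g}" unfolding M_def by (rule Max_in) auto
  then obtain j0 where j0: "M = ac_norm (coeff g j0)" by auto
  have Mle: "ac_norm (coeff g i) \<le> M" if "i \<le> degree g" for i
    unfolding M_def using that by (intro Max_ge) auto
  have "coeff g k \<noteq> 0" using assms by auto
  hence "M \<ge> B" using Mle[of k] assms by (simp add: le_degree)
  hence M: "M > 0" using assms by simp
  have Mle': "ac_norm (coeff g i) \<le> M" for i
    using Mle[of i] M by (cases "i \<le> degree g") (auto simp: coeff_eq_0)
  have c: "coeff ([:- x, 1:] * g) (Suc i) = coeff g i + - (x * coeff g (Suc i))" for i by simp
  have c0: "coeff ([:- x, 1:] * g) 0 = - (x * coeff g 0)" by simp
  show ?thesis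
  proof (cases "ac_norm x \<le> 1")
    case True
    \<comment> \<open>One place above the last maximal coefficient, the shifted coefficient
      dominates: the next one is strictly smaller, and multiplication by \<open>x\<close> does not
      enlarge it.\<close>
    define A where "A = {i. ac_norm (coeff g i) = M}"
    have "A \<subseteq> {..degree g}"
    proof
      fix i assume "i \<in> A"
      hence "coeff g i \<noteq> 0" using M by (auto simp: A_def)
      thus "i \<in> {..degree g}" by (simp add: le_degree)
    qed
    hence fin: "finite A" by (rule finite_subset) simp
    have "j0 \<in> A" using j0 by (simp add: A_def)
    hence j: "Max A \<in> A" by (intro Max_in fin) auto
    have "Suc (Max A) \<notin> A" using Max_ge[OF fin, of "Suc (Max A)"] by auto
    hence lt: "ac_norm (coeff g (Suc (Max A))) < M" using Mle'[of "Suc (Max A)"] by (simp add: A_def)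
    have "ac_norm x * ac_norm (coeff g (Suc (Max A))) \<le> 1 * ac_norm (coeff g (Suc (Max A)))"
      using True by (intro mult_right_mono) auto
    hence "ac_norm (- (x * coeff g (Suc (Max A)))) < ac_norm (coeff g (Max A))"
      using lt j by (simp add: ac_norm_mult A_def)
    hence "ac_norm (coeff ([:- x, 1:] * g) (Suc (Max A))) = M"
      unfolding c using j by (subst ac_norm_add_eq) (auto simp: A_def)
    thus ?thesis using True \<open>M \<ge> B\<close> by (intro that[of "Suc (Max A)"]) simp
  next
    case False
    \<comment> \<open>For \<open>|x| > 1\<close> a maximal coefficient multiplied by
      \<open>x\<close> exceeds the one shifted into its place.\<close>
    have "ac_norm (coeff ([:- x, 1:] * g) j0) = ac_norm x * M"
    proof (cases j0)
      case 0
      thus ?thesis using c0 j0 by (simp add: ac_norm_mult)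
    next
      case (Suc i)
      have eq: "ac_norm (- (x * coeff g (Suc i))) = ac_norm x * M"
        using j0 Suc by (simp add: ac_norm_mult)
      have "1 * M < ac_norm x * M" using False M by (intro mult_strict_right_mono) auto
      hence "ac_norm (coeff g i) < ac_norm x * M" using Mle'[of i] by linarith
      hence "ac_norm (- (x * coeff g (Suc i)) + coeff g i) = ac_norm x * M"
        by (subst ac_norm_add_eq) (simp_all only: eq)
      thus ?thesis unfolding Suc c by (simp add: add.commute)
    qed
    moreover have "ac_norm x * B \<le> ac_norm x * M" using \<open>M \<ge> B\<close> by (intro mult_left_mono) auto
    ultimately show ?thesis using False by (intro that[of j0]) simp
  qed
qed

lemma ac_gauss:
  fixes x :: "nat \<Rightarrow> 'p :: prime_card padic alg_closure"
  shows "\<exists>j. ac_norm (coeff (\<Prod>k<d. [:- x k, 1:]) j) \<ge> (\<Prod>k<d. max 1 (ac_norm (x k)))"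
proof (induction d)
  case 0
  show ?case by (intro exI[of _ 0]) simp
next
  case (Suc d)
  then obtain k where "ac_norm (coeff (\<Prod>k<d. [:- x k, 1:]) k) \<ge> (\<Prod>k<d. max 1 (ac_norm (x k)))" by blast
  moreover have "(\<Prod>k<d. max 1 (ac_norm (x k))) > 0" by (intro prod_pos) auto
  ultimately obtain j where "ac_norm (coeff ([:- x d, 1:] * (\<Prod>k<d. [:- x k, 1:])) j) \<ge>
      max 1 (ac_norm (x d)) * (\<Prod>k<d. max 1 (ac_norm (x k)))"
    by (rule ac_gauss_step)
  thus ?case by (intro exI[of _ j]) (simp only: prod.lessThan_Suc mult.commute)
qed

text \<open>By the Gauss bound, this \<open>p\<close>-adic Mahler measure is at most the norm of
  some coefficient of \<open>f\<close>, and the coefficients are integers.\<close>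

lemma ac_mahler_le_1:
  fixes x :: "nat \<Rightarrow> 'p :: prime_card padic alg_closure"
  assumes "f \<noteq> 0" "inj_on x {..<degree f}" "\<And>i. i < degree f \<Longrightarrow> poly (map_poly of_int f) (x i) = 0"
  shows "ac_norm (of_int (lead_coeff f) :: 'p padic alg_closure) * (\<Prod>k<degree f. max 1 (ac_norm (x k))) \<le> 1"
proof -
  define F :: "'p padic alg_closure poly" where "F = map_poly of_int f"
  have F: "F = smult (of_int (lead_coeff f)) (\<Prod>k<degree f. [:- x k, 1:])"
    using poly_eq_prod_roots[of F "degree f" x] assms by (simp add: F_def)
  obtain j where j: "ac_norm (coeff (\<Prod>k<degree f. [:- x k, 1:]) j) \<ge> (\<Prod>k<degree f. max 1 (ac_norm (x k)))"
    using ac_gauss by blast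
  have "ac_norm (of_int (lead_coeff f) :: 'p padic alg_closure) * (\<Prod>k<degree f. max 1 (ac_norm (x k)))
      \<le> ac_norm (of_int (lead_coeff f) :: 'p padic alg_closure) * ac_norm (coeff (\<Prod>k<degree f. [:- x k, 1:]) j)"
    using j by (intro mult_left_mono) auto
  also have "\<dots> = ac_norm (coeff F j)" by (subst F) (simp add: ac_norm_mult)
  also have "\<dots> \<le> 1" by (simp add: F_def coeff_map_poly ac_norm_of_int_le_1)
  finally show ?thesis .
qed

section \<open>Repulsion of conjugates in \<open>K\<close>\<close>

lemma prod_le_prod_subset:
  fixes f :: "'a \<Rightarrow> real"
  assumes "finite A" "B \<subseteq> A" "\<And>x. x \<in> A \<Longrightarrow> 0 \<le> f x" "\<And>x. x \<in> A \<Longrightarrow> f x \<le> 1"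
  shows "prod f A \<le> prod f B"
proof -
  have "prod f A = prod f (A - B) * prod f B" using assms by (intro prod.subset_diff) auto
  also have "\<dots> \<le> 1 * prod f B"
    using assms by (intro mult_right_mono prod_le_1 prod_nonneg) auto
  finally show ?thesis by simp
qed

text \<open>Cauchy-Schwarz for the class sizes: summing over all elements the size of their class
  gives the sum of the squared sizes. Pairs of an element with itself are included.\<close>

lemma card_sq_le_same_class:
  assumes S: "finite S" and C: "finite C" "c ` S \<subseteq> C"
  shows "real (card S) ^ 2 \<le> real (card C) * (\<Sum>x\<in>S. real (card {y\<in>S. c y = c x}))"
proof -
  define n where "n = (\<lambda>b. real (card {y\<in>S. c y = b}))"
  have "real (card S) = (\<Sum>x\<in>S. 1)" by simp
  also have "\<dots> = (\<Sum>b\<in>c ` S. n b)" using S by (subst sum.image_gen[of _ _ c]) (auto simp: n_def)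
  finally have 1: "real (card S) = (\<Sum>b\<in>c ` S. n b)" .
  have "(\<Sum>x\<in>S. n (c x)) = (\<Sum>b\<in>c ` S. \<Sum>x\<in>{x\<in>S. c x = b}. n (c x))"
    by (rule sum.image_gen[OF S])
  also have "\<dots> = (\<Sum>b\<in>c ` S. n b ^ 2)"
    by (intro sum.cong refl) (simp add: n_def power2_eq_square)
  finally have 2: "(\<Sum>x\<in>S. n (c x)) = (\<Sum>b\<in>c ` S. n b ^ 2)" .
  have "real (card S) ^ 2 \<le> (\<Sum>b\<in>c ` S. n b ^ 2) * real (card (c ` S))"
    unfolding 1 by (rule sum_squared_le_sum_of_squares)
  also have "\<dots> \<le> (\<Sum>b\<in>c ` S. n b ^ 2) * real (card C)"
    using C by (intro mult_left_mono) (auto intro: card_mono sum_nonneg)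
  finally show ?thesis using 2 by (simp add: n_def mult.commute)
qed

text \<open>The distance of \<open>[x : 1]\<close> and \<open>[y : 1]\<close> on the projective
  line. It is invariant under inversion, so points outside the unit disc can be moved
  inside.\<close>

definition chordal :: "'p :: prime_card padic alg_closure \<Rightarrow> 'p padic alg_closure \<Rightarrow> real" where
  "chordal x y = ac_norm (x - y) / (max 1 (ac_norm x) * max 1 (ac_norm y))"

lemma chordal_nonneg: "chordal x y \<ge> 0"
  by (simp add: chordal_def)

lemma chordal_le_1: "chordal x y \<le> 1"
proof -
  have "max (ac_norm x) (ac_norm y) \<le> max 1 (ac_norm x) * max 1 (ac_norm y)"
    using mult_mono[of "ac_norm x" "max 1 (ac_norm x)" 1 "max 1 (ac_norm y)"]
      mult_mono[of 1 "max 1 (ac_norm x)" "ac_norm y" "max 1 (ac_norm y)"] by simp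
  hence "ac_norm (x - y) \<le> max 1 (ac_norm x) * max 1 (ac_norm y)"
    using ac_norm_ultrametric_diff[of x y] by linarith
  moreover have "max 1 (ac_norm x) * max 1 (ac_norm y) > 0" by simp
  ultimately show ?thesis unfolding chordal_def by (simp add: divide_le_eq)
qed

context padic_extension
begin

text \<open>The reduction map to the projective line over the residue field; \<open>None\<close> is the point at infinity.\<close>

definition proj_class :: "'p padic alg_closure \<Rightarrow> 'p padic alg_closure set option" where
  "proj_class x = (if ac_norm x \<le> 1 then Some (residue x) else None)"

text \<open>Two points that reduce to infinity are replaced by their inverses, which lie in the
  maximal ideal and differ by exactly the chordal distance in norm.\<close>

lemma chordal_same_class:
  assumes xy: "x \<in> K" "y \<in> K" "x \<noteq> y" "proj_class x = proj_class y"
  shows "real q * chordal x y ^ deg \<le> 1"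
proof (cases "ac_norm x \<le> 1")
  case True
  hence y: "ac_norm y \<le> 1" "residue x = residue y"
    using xy(4) by (auto simp: proj_class_def split: if_splits)
  hence "ac_norm (x - y) < 1" using residue_eq_iff xy by blast
  moreover have "chordal x y = ac_norm (x - y)" using True y by (simp add: chordal_def max_def)
  ultimately show ?thesis using q_norm_power_le_1[of "x - y"] xy K_diff by simp
next
  case False
  hence y: "ac_norm y > 1" using xy(4) by (auto simp: proj_class_def split: if_splits)
  have x: "ac_norm x > 1" using False by simp
  have nz: "x \<noteq> 0" "y \<noteq> 0" using x y by auto
  define z where "z = inverse y - inverse x"
  have "z = (x - y) * inverse x * inverse y" using nz by (simp add: z_def field_simps)
  hence "ac_norm z = ac_norm (x - y) / (ac_norm x * ac_norm y)"
    by (simp only: ac_norm_mult ac_norm_inverse) (simp add: field_simps)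
  hence eq: "chordal x y = ac_norm z" using x y by (simp add: chordal_def max_def)
  have "ac_norm (inverse x) < 1" "ac_norm (inverse y) < 1"
    unfolding ac_norm_inverse using x y by (auto simp: inverse_less_1_iff)
  hence "ac_norm z < 1" using ac_norm_ultrametric_diff[of "inverse y" "inverse x"] by (simp add: z_def)
  moreover have "z \<in> K" "z \<noteq> 0" using xy by (auto simp: z_def intro: K_diff K_inverse)
  ultimately show ?thesis using q_norm_power_le_1 eq by simp
qed

text \<open>\<open>P\<close> counts ordered pairs of distinct indices in a common class. All other
  factors are at most 1 and are dropped; each remaining factor has its power \<open>deg\<close>
  bounded by \<open>1 / q\<close>.\<close>

lemma prod_chordal_le:
  fixes x :: "nat \<Rightarrow> 'p padic alg_closure"
  assumes q: "q > 0" and inj: "inj_on x {..<d}"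
  defines "S \<equiv> {k. k < d \<and> x k \<in> K}"
  shows "\<exists>P :: nat. real (card S) ^ 2 / (real q + 1) - real (card S) \<le> real P \<and>
           real q ^ P * (\<Prod>k<d. \<Prod>l\<in>{..<d}-{k}. chordal (x k) (x l)) ^ deg \<le> 1"
proof -
  have finS: "finite S" by (simp add: S_def)
  define c where "c = (\<lambda>k. proj_class (x k))"
  define T where "T = (\<lambda>k. {l \<in> S - {k}. c l = c k})"
  define P where "P = (\<Sum>k\<in>S. card (T k))"
  have fin: "finite (carrier (residue_field K))" using q by (auto simp: q_def intro: card_ge_0_finite)
  have "c ` S \<subseteq> insert None (Some ` carrier (residue_field K))"
    by (auto simp: c_def proj_class_def S_def carrier_residue_field)
  hence "real (card S) ^ 2 \<le> real (card (insert None (Some ` carrier (residue_field K)))) *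
      (\<Sum>k\<in>S. real (card {l\<in>S. c l = c k}))"
    using fin by (intro card_sq_le_same_class finS) auto
  also have "card (insert None (Some ` carrier (residue_field K))) = q + 1"
    using fin by (subst card_insert_disjoint) (auto simp: q_def card_image)
  \<comment> \<open>The pair of \<open>k\<close> with itself is split off; this is the origin of the
    term \<open>- card S\<close>.\<close>
  also have "(\<Sum>k\<in>S. real (card {l\<in>S. c l = c k})) = (\<Sum>k\<in>S. real (card (T k)) + 1)"
  proof (intro sum.cong refl)
    fix k assume k: "k \<in> S"
    have "{l\<in>S. c l = c k} = insert k (T k)" using k by (auto simp: T_def)
    moreover have "finite (T k)" "k \<notin> T k" using finS by (auto simp: T_def)
    ultimately show "real (card {l\<in>S. c l = c k}) = real (card (T k)) + 1" by simp
  qed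
  also have "\<dots> = real P + real (card S)" by (simp add: P_def sum.distrib)
  finally have "real (card S) ^ 2 / (real q + 1) \<le> real P + real (card S)"
    by (simp add: field_simps)
  moreover have "real q ^ P * (\<Prod>k<d. \<Prod>l\<in>{..<d}-{k}. chordal (x k) (x l)) ^ deg \<le> 1"
  proof -
    have inner: "(\<Prod>l\<in>{..<d}-{k}. chordal (x k) (x l)) \<le> (\<Prod>l\<in>T k. chordal (x k) (x l))" for k
      by (intro prod_le_prod_subset) (auto simp: T_def S_def chordal_nonneg chordal_le_1)
    have "(\<Prod>k<d. \<Prod>l\<in>{..<d}-{k}. chordal (x k) (x l)) \<le> (\<Prod>k\<in>S. \<Prod>l\<in>{..<d}-{k}. chordal (x k) (x l))"
      by (intro prod_le_prod_subset)
         (auto simp: S_def chordal_nonneg chordal_le_1 intro!: prod_nonneg prod_le_1)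
    also have "\<dots> \<le> (\<Prod>k\<in>S. \<Prod>l\<in>T k. chordal (x k) (x l))"
      by (intro prod_mono conjI inner prod_nonneg) (auto simp: chordal_nonneg)
    finally have "(\<Prod>k<d. \<Prod>l\<in>{..<d}-{k}. chordal (x k) (x l)) ^ deg \<le>
        (\<Prod>k\<in>S. \<Prod>l\<in>T k. chordal (x k) (x l)) ^ deg"
      by (intro power_mono prod_nonneg) (auto simp: chordal_nonneg intro!: prod_nonneg)
    hence "real q ^ P * (\<Prod>k<d. \<Prod>l\<in>{..<d}-{k}. chordal (x k) (x l)) ^ deg \<le>
        real q ^ P * (\<Prod>k\<in>S. \<Prod>l\<in>T k. chordal (x k) (x l)) ^ deg"
      by (intro mult_left_mono) auto
    also have "\<dots> = (\<Prod>k\<in>S. \<Prod>l\<in>T k. real q * chordal (x k) (x l) ^ deg)"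
      by (simp add: P_def power_sum prod.distrib prod_power_distrib)
    also have "\<dots> \<le> 1"
    proof (intro prod_le_1 conjI prod_nonneg)
      fix k l assume k: "k \<in> S" and l: "l \<in> T k"
      have "x k \<noteq> x l" using inj_onD[OF inj, of k l] k l by (auto simp: S_def T_def)
      thus "real q * chordal (x k) (x l) ^ deg \<le> 1"
        using k l by (intro chordal_same_class) (auto simp: S_def T_def c_def)
    qed (auto simp: chordal_nonneg)
    finally show ?thesis .
  qed
  ultimately show ?thesis by (intro exI[of _ P]) simp
qed

end

text \<open>Each difference is \<open>m k * m l\<close> times a chordal distance. Including the
  diagonal factors, which are at least 1, raises the exponent of each \<open>m k\<close> from
  \<open>2 * d - 2\<close> to \<open>2 * d\<close>, matching the power of the leading
  coefficient.\<close>

lemma ac_norm_det_vandermonde_le: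
  fixes x :: "nat \<Rightarrow> 'p :: prime_card padic alg_closure"
  shows "ac_norm (det (vandermonde_mat d x)) ^ 2 \<le>
    (\<Prod>k<d. max 1 (ac_norm (x k))) ^ (2 * d) * (\<Prod>k<d. \<Prod>l\<in>{..<d}-{k}. chordal (x k) (x l))"
proof -
  define m where "m = (\<lambda>k. max 1 (ac_norm (x k)))"
  have m: "m k \<ge> 1" for k by (simp add: m_def)
  have "ac_norm (det (vandermonde_mat d x)) ^ 2 =
      (\<Prod>k<d. \<Prod>l<k. ac_norm (x k - x l)) * (\<Prod>k<d. \<Prod>l<k. ac_norm (x l - x k))"
  proof -
    have "ac_norm (x l - x k) = ac_norm (x k - x l)" for k l
      using ac_norm_minus[of "x k - x l"] by simp
    thus ?thesis by (simp add: det_vandermonde_mat ac_norm_prod power2_eq_square)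
  qed
  also have "\<dots> = (\<Prod>k<d. \<Prod>l\<in>{..<d}-{k}. ac_norm (x k - x l))"
    by (rule prod_off_diagonal[symmetric])
  also have "\<dots> = (\<Prod>k<d. \<Prod>l\<in>{..<d}-{k}. (m k * m l) * chordal (x k) (x l))"
  proof (intro prod.cong refl)
    fix k l
    have "m k * m l \<noteq> 0" using m[of k] m[of l] by auto
    thus "ac_norm (x k - x l) = (m k * m l) * chordal (x k) (x l)" by (simp add: chordal_def m_def)
  qed
  also have "\<dots> = (\<Prod>k<d. \<Prod>l\<in>{..<d}-{k}. m k * m l) * (\<Prod>k<d. \<Prod>l\<in>{..<d}-{k}. chordal (x k) (x l))"
    by (simp only: prod.distrib)
  also have "(\<Prod>k<d. \<Prod>l\<in>{..<d}-{k}. m k * m l) \<le> (\<Prod>k<d. \<Prod>l<d. m k * m l)"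
  proof (intro prod_mono conjI prod_nonneg)
    fix k
    show "0 \<le> m k * m l" for l using m[of k] m[of l] by (intro mult_nonneg_nonneg) auto
    have ge: "1 \<le> m k * m l" for l using mult_mono[of 1 "m k" 1 "m l"] m[of k] m[of l] by simp
    show "(\<Prod>l\<in>{..<d}-{k}. m k * m l) \<le> (\<Prod>l<d. m k * m l)"
      by (intro prod_mono2) (auto intro: ge order.trans[OF zero_le_one ge])
  qed
  also have "(\<Prod>k<d. \<Prod>l<d. m k * m l) = (\<Prod>k<d. m k) ^ (2 * d)"
    by (simp add: prod.distrib prod_power_distrib[symmetric] power_add[symmetric] mult_2)
  finally show ?thesis by (simp add: m_def mult_right_mono prod_nonneg chordal_nonneg)
qed

section \<open>Mahler measure and the product formula\<close>

lemma prod_galois_conjugates: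
  assumes "bij_betw b {..<d} (galois_conjugates \<alpha>)"
  shows "mahler_measure \<alpha> = real_of_int \<bar>lead_coeff (min_int_poly \<alpha>)\<bar> * (\<Prod>k<d. max 1 (cmod (b k)))"
  unfolding mahler_measure_def by (subst prod.reindex_bij_betw[OF assms, symmetric]) simp

lemma mahler_measure_ge_1:
  assumes "algebraic \<alpha>"
  shows "mahler_measure \<alpha> \<ge> 1"
proof -
  have "lead_coeff (min_int_poly \<alpha>) > 0"
    using is_min_int_poly_min_int_poly[OF assms] by (simp add: is_min_int_poly_def)
  hence "1 \<le> real_of_int \<bar>lead_coeff (min_int_poly \<alpha>)\<bar>" by linarith
  moreover have "1 \<le> (\<Prod>\<beta>\<in>galois_conjugates \<alpha>. max 1 (cmod \<beta>))" by (intro prod_ge_1) auto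
  ultimately show ?thesis
    unfolding mahler_measure_def using mult_mono[of 1 _ 1] by fastforce
qed

text \<open>At \<open>p\<close> the Gauss bound absorbs the leading coefficient together with the
  large conjugates, leaving only the chordal product \<open>\<Delta>\<close>. The product formula
  then forces the Mahler measure to compensate for the crowding of conjugates in
  \<open>K\<close>.\<close>

lemma (in padic_extension) mahler_measure_bound:
  assumes i: "Qbar_embedding i" and \<alpha>: "algebraic \<alpha>" and q: "q > 0"
  defines "d \<equiv> alg_degree \<alpha>" and "N \<equiv> real (card (conjugates_in i K \<alpha>))"
  shows "(N ^ 2 / (real q + 1) - N) * ln (real q) \<le>
           real deg * (2 * real d * ln (real d) + 2 * real d * ln (mahler_measure \<alpha>))"
proof -
  define f where "f = min_int_poly \<alpha>"
  have f: "is_min_int_poly \<alpha> f" unfolding f_def by (rule is_min_int_poly_min_int_poly[OF \<alpha>])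
  have f0: "f \<noteq> 0" and lc: "lead_coeff f > 0" using f by (simp_all add: is_min_int_poly_def)
  have df: "degree f = d" by (simp add: d_def f_def alg_degree_def)
  have d0: "d > 0" using degree_min_int_poly_pos[OF \<alpha>] df by (simp add: f_def)
  obtain b where b: "bij_betw b {..<d} (galois_conjugates \<alpha>)"
    using ex_bij_betw_nat_finite[OF card_galois_conjugates(1)[OF \<alpha>]] card_galois_conjugates(2)[OF \<alpha>]
    by (auto simp: d_def lessThan_atLeast0)
  have broot: "poly (map_poly of_int f) (b k) = 0" if "k < d" for k
    using bij_betwE[OF b] that by (auto simp: galois_conjugates_def f_def)
  have balg: "algebraic (b k)" if "k < d" for k
    by (rule algebraic_root_int_poly[OF f0 broot[OF that]])
  have binj: "inj_on b {..<degree f}" using b by (simp add: bij_betw_def df)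
  define x where "x = (\<lambda>k. i (b k))"
  have inj_i: "inj_on i Qbar" using i by (simp add: Qbar_embedding_def)
  have xroot: "poly (map_poly of_int f) (x k) = 0" if "k < d" for k
  proof -
    have "poly (map_poly of_int f) (x k) = i (poly (map_poly of_int f) (b k))"
      unfolding x_def by (rule Qbar_embedding_poly[OF i balg[OF that], symmetric])
    \<comment> \<open>The zero polynomial supplies \<open>i 0 = 0\<close>.\<close>
    also have "\<dots> = i (poly (map_poly of_int 0) (b k))" by (simp add: broot[OF that])
    also have "\<dots> = poly (map_poly of_int 0) (x k)"
      unfolding x_def by (rule Qbar_embedding_poly[OF i balg[OF that]])
    finally show ?thesis by simp
  qed
  have xinj: "inj_on x {..<degree f}"
  proof (rule inj_onI)
    fix k l assume kl: "k \<in> {..<degree f}" "l \<in> {..<degree f}" "x k = x l"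
    hence "b k = b l" using inj_onD[OF inj_i, of "b k" "b l"] balg df by (simp add: x_def)
    thus "k = l" using inj_onD[OF binj] kl by blast
  qed
  define E where "E = bezout_disc f"
  define a where "a = lead_coeff f"
  let ?M = "mahler_measure \<alpha>"
  define \<Delta> where "\<Delta> = (\<Prod>k<d. \<Prod>l\<in>{..<d}-{k}. chordal (x k) (x l))"
  have EC: "complex_of_int E = of_int a ^ (2 * d) * det (vandermonde_mat d b) ^ 2"
    unfolding E_def a_def using bezout_disc_eq[OF f0 binj] broot df by simp
  have EK: "of_int E = (of_int a ^ (2 * d) * det (vandermonde_mat d x) ^ 2 :: 'p padic alg_closure)"
    unfolding E_def a_def using bezout_disc_eq[OF f0 xinj] xroot df by simp
  have "det (vandermonde_mat d b) \<noteq> 0"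
  proof -
    have "b k - b l \<noteq> 0" if "k < d" "l < k" for k l
      using inj_onD[OF binj, of k l] that df by auto
    thus ?thesis unfolding det_vandermonde_mat by simp
  qed
  hence E0: "E \<noteq> 0" using EC lc by (auto simp: a_def)
  have M: "?M = real_of_int a * (\<Prod>k<d. max 1 (cmod (b k)))"
    using prod_galois_conjugates[OF b] lc by (simp add: f_def[symmetric] a_def)
  have M1: "?M \<ge> 1" by (rule mahler_measure_ge_1[OF \<alpha>])
  have a0: "real_of_int a > 0" using lc by (simp add: a_def)
  have "\<bar>real_of_int E\<bar> = cmod (complex_of_int E)" by simp
  also have "\<dots> = real_of_int a ^ (2 * d) * cmod (det (vandermonde_mat d b)) ^ 2"
    unfolding EC using a0 by (simp add: norm_mult norm_power)
  also have "\<dots> \<le> real_of_int a ^ (2 * d) * (fact d * (\<Prod>k<d. max 1 (cmod (b k))) ^ d) ^ 2"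
    using a0 by (intro mult_left_mono power_mono norm_det_vandermonde_mat_le) auto
  also have "\<dots> = fact d ^ 2 * ?M ^ (2 * d)"
    unfolding M by (simp add: power_mult_distrib power_mult[symmetric] mult.commute)
  \<comment> \<open>\<open>d! \<le> d^d\<close> suffices: the resulting \<open>2 d ln d\<close> is
    negligible against \<open>d^2\<close>.\<close>
  also have "\<dots> \<le> (real d ^ d) ^ 2 * ?M ^ (2 * d)"
    using fact_le_power[of d, where 'a = real] M1
    by (intro mult_right_mono power_mono) auto
  finally have Einf: "\<bar>real_of_int E\<bar> \<le> (real d ^ d) ^ 2 * ?M ^ (2 * d)" .
  have \<Delta>0: "\<Delta> \<ge> 0" by (auto simp: \<Delta>_def chordal_nonneg intro!: prod_nonneg)
  define A where "A = ac_norm (of_int a :: 'p padic alg_closure)"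
  have A0: "A \<ge> 0" by (simp add: A_def)
  have "ac_norm (of_int E :: 'p padic alg_closure) = A ^ (2 * d) * ac_norm (det (vandermonde_mat d x)) ^ 2"
    unfolding EK A_def by (simp add: ac_norm_mult ac_norm_power)
  also have "\<dots> \<le> A ^ (2 * d) * ((\<Prod>k<d. max 1 (ac_norm (x k))) ^ (2 * d) * \<Delta>)"
    unfolding \<Delta>_def using A0 by (intro mult_left_mono ac_norm_det_vandermonde_le) auto
  also have "\<dots> = (A * (\<Prod>k<d. max 1 (ac_norm (x k)))) ^ (2 * d) * \<Delta>"
    by (simp add: power_mult_distrib)
  also have "\<dots> \<le> 1 * \<Delta>"
  proof (intro mult_right_mono power_le_one \<Delta>0)
    show "A * (\<Prod>k<d. max 1 (ac_norm (x k))) \<le> 1"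
      using ac_mahler_le_1[OF f0 xinj] xroot df by (simp add: A_def a_def)
    show "0 \<le> A * (\<Prod>k<d. max 1 (ac_norm (x k)))" using A0 by (intro mult_nonneg_nonneg prod_nonneg) auto
  qed
  finally have Ep: "ac_norm (of_int E :: 'p padic alg_closure) \<le> \<Delta>" by simp
  define B where "B = (real d ^ d) ^ 2 * ?M ^ (2 * d)"
  have Bpos: "B > 0" using d0 M1 by (simp add: B_def)
  have "1 \<le> ac_norm (of_int E :: 'p padic alg_closure) * \<bar>real_of_int E\<bar>"
    by (rule ac_norm_of_int_ge[OF E0])
  also have "\<dots> \<le> \<Delta> * B" using Ep Einf \<Delta>0 by (intro mult_mono) (auto simp: B_def)
  finally have prodform: "1 \<le> \<Delta> * B" .
  have S: "card {k. k < d \<and> x k \<in> K} = card (conjugates_in i K \<alpha>)"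
  proof -
    have "conjugates_in i K \<alpha> = b ` {k. k < d \<and> x k \<in> K}"
      using b by (auto simp: conjugates_in_def x_def bij_betw_def)
    moreover have "inj_on b {k. k < d \<and> x k \<in> K}" using binj df by (auto intro: inj_on_subset)
    ultimately show ?thesis by (simp add: card_image)
  qed
  obtain P :: nat where P: "N ^ 2 / (real q + 1) - N \<le> real P" "real q ^ P * \<Delta> ^ deg \<le> 1"
    using prod_chordal_le[OF q, of x d] xinj df by (auto simp: S N_def \<Delta>_def)
  \<comment> \<open>The product formula is raised to the power \<open>deg\<close> to meet the bound
    on \<open>\<Delta> ^ deg\<close>.\<close>
  have "real q ^ P * 1 \<le> real q ^ P * (\<Delta> * B) ^ deg"
    using prodform by (intro mult_left_mono one_le_power) auto
  also have "\<dots> = (real q ^ P * \<Delta> ^ deg) * B ^ deg" by (simp add: power_mult_distrib)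
  also have "\<dots> \<le> 1 * B ^ deg" using P(2) Bpos by (intro mult_right_mono) auto
  finally have "real q ^ P \<le> B ^ deg" by simp
  hence "ln (real q ^ P) \<le> ln (B ^ deg)" using q Bpos by (subst ln_le_cancel_iff) auto
  hence "real P * ln (real q) \<le> real deg * ln B" using q Bpos by (simp add: ln_realpow)
  moreover have "ln B = 2 * real d * ln (real d) + 2 * real d * ln ?M"
    using d0 M1 by (simp add: B_def ln_mult ln_realpow)
  moreover have "(N ^ 2 / (real q + 1) - N) * ln (real q) \<le> real P * ln (real q)"
    using P(1) q by (intro mult_right_mono) auto
  ultimately show ?thesis by simp
qed

text \<open>\<open>D * L\<close> is the loss \<open>N * L\<close> from the diagonal pairs after
  \<open>N \<le> D\<close>; division by \<open>2 * n * D^2\<close> isolates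
  \<open>h\<close>.\<close>

lemma divide_height_bound:
  fixes n D Q N L l h :: real
  assumes pos: "n > 0" "D > 0" "Q > 0"
    and le: "N ^ 2 / Q * L - D * L \<le> n * (2 * D * l + 2 * D * (D * h))"
  shows "1 / (2 * n) * (N / D)\<^sup>2 * (L / Q) - (L / (2 * n) * inverse D + l / D) \<le> h"
proof -
  define c where "c = 2 * n * D ^ 2"
  have c: "c > 0" using pos by (simp add: c_def)
  have 1: "1 / (2 * n) * (N / D)\<^sup>2 * (L / Q) * c = N ^ 2 / Q * L"
    using pos by (simp add: c_def power_divide)
  have 2: "L / (2 * n) * inverse D * c = D * L"
    using pos by (simp add: c_def power2_eq_square)
  have 3: "l / D * c = 2 * n * D * l"
    using pos by (simp add: c_def power2_eq_square)
  have "(1 / (2 * n) * (N / D)\<^sup>2 * (L / Q) - (L / (2 * n) * inverse D + l / D)) * c =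
      1 / (2 * n) * (N / D)\<^sup>2 * (L / Q) * c - (L / (2 * n) * inverse D * c + l / D * c)"
    by (simp only: left_diff_distrib distrib_right)
  also have "\<dots> = N ^ 2 / Q * L - D * L - 2 * n * D * l" unfolding 1 2 3 by simp
  also have "\<dots> \<le> h * c" using le by (simp add: c_def power2_eq_square distrib_left mult_ac)
  finally show ?thesis using c by (rule mult_right_le_imp_le)
qed

theorem theorem1p1:
  fixes i :: "complex \<Rightarrow> 'p :: prime_card padic alg_closure"
    and K :: "'p padic alg_closure set"
    and q :: nat
  assumes "Qbar_embedding i"
    and "finite_padic_extension K"
    and "q = card (carrier (residue_field K))"
  shows "\<exists>\<epsilon> :: nat \<Rightarrow> real. \<epsilon> \<longlonglongrightarrow> 0 \<and>
    (\<forall>\<alpha> :: complex. algebraic \<alpha> \<and> \<alpha> \<noteq> 0 \<longrightarrow>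
      weil_height \<alpha> \<ge>
        1 / (2 * real (padic_extension_degree K)) *
        (real (card (conjugates_in i K \<alpha>)) / real (alg_degree \<alpha>))\<^sup>2 *
        (ln (real q) / (real q + 1))
        + \<epsilon> (alg_degree \<alpha>))"
proof -
  interpret padic_extension K by unfold_locales (rule assms(2))
  have q: "q = local.q" by (simp add: assms(3) q_def)
  define n where "n = real deg"
  \<comment> \<open>The first term comes from the diagonal pairs, \<open>d ln q\<close>, the second
    from the factorials, \<open>2 n d ln d\<close>; each is divided by
    \<open>2 n d^2\<close>.\<close>
  define \<epsilon> where "\<epsilon> = (\<lambda>d :: nat. - (ln (real q) / (2 * n) * inverse (real d) + ln (real d) / real d))"
  have "(\<lambda>d :: nat. ln (real d) / real d) \<longlonglongrightarrow> 0"
    using filterlim_compose[OF ln_x_over_x_tendsto_0 filterlim_real_sequentially] .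
  hence "\<epsilon> \<longlonglongrightarrow> - (ln (real q) / (2 * n) * 0 + 0)"
    unfolding \<epsilon>_def by (intro tendsto_intros lim_inverse_n)
  hence "\<epsilon> \<longlonglongrightarrow> 0" by simp
  moreover have "weil_height \<alpha> \<ge> 1 / (2 * real (padic_extension_degree K)) *
        (real (card (conjugates_in i K \<alpha>)) / real (alg_degree \<alpha>))\<^sup>2 *
        (ln (real q) / (real q + 1)) + \<epsilon> (alg_degree \<alpha>)" if \<alpha>: "algebraic \<alpha>" for \<alpha>
  proof -
    define d where "d = alg_degree \<alpha>"
    define N where "N = real (card (conjugates_in i K \<alpha>))"
    define h where "h = weil_height \<alpha>"
    have d0: "real d \<ge> 1" using degree_min_int_poly_pos[OF \<alpha>] by (simp add: d_def alg_degree_def)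
    have M1: "mahler_measure \<alpha> \<ge> 1" by (rule mahler_measure_ge_1[OF \<alpha>])
    have h: "ln (mahler_measure \<alpha>) = real d * h" using d0 by (simp add: h_def weil_height_def d_def)
    have h0: "h \<ge> 0" using M1 by (simp add: h_def weil_height_def)
    have lnd: "ln (real d) / real d \<ge> 0" using d0 by simp
    have lnq: "ln (real q) \<ge> 0" by (cases "q = 0") auto
    have Nd: "N \<le> real d"
      using card_mono[OF card_galois_conjugates(1)[OF \<alpha>], of "conjugates_in i K \<alpha>"]
      by (simp add: N_def d_def card_galois_conjugates(2)[OF \<alpha>] conjugates_in_def)
    have "1 / (2 * n) * (N / real d)\<^sup>2 * (ln (real q) / (real q + 1)) + \<epsilon> d \<le> h"
    proof (cases "q = 0 \<or> deg = 0")
      \<comment> \<open>\<open>ln 0\<close> and division by 0 are 0, so the main term vanishes,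
        while \<open>\<epsilon> d\<close> is at most 0 and the height is non-negative.\<close>
      case True
      hence "1 / (2 * n) * (N / real d)\<^sup>2 * (ln (real q) / (real q + 1)) = 0" "\<epsilon> d \<le> 0"
        using lnd by (auto simp: n_def \<epsilon>_def)
      thus ?thesis using h0 by linarith
    next
      case False
      hence q0: "local.q > 0" and n0: "n > 0" by (auto simp: q n_def)
      define L where "L = ln (real q)"
      have "(N ^ 2 / (real q + 1) - N) * L \<le> n * (2 * real d * ln (real d) + 2 * real d * (real d * h))"
        using mahler_measure_bound[OF assms(1) \<alpha> q0]
        by (simp only: q[symmetric] N_def[symmetric] d_def[symmetric] h n_def[symmetric] L_def)
      \<comment> \<open>Makes the error depend on the degree alone.\<close>
      moreover have "N * L \<le> real d * L" using Nd lnq by (intro mult_right_mono) (auto simp: L_def)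
      ultimately have "N ^ 2 / (real q + 1) * L - real d * L \<le>
          n * (2 * real d * ln (real d) + 2 * real d * (real d * h))"
        by (simp add: left_diff_distrib)
      from divide_height_bound[OF n0 _ _ this] show ?thesis using d0 by (simp add: \<epsilon>_def L_def)
    qed
    thus ?thesis by (simp only: h_def N_def d_def n_def deg_def)
  qed
  ultimately show ?thesis by blast
qed

end
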